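(* Let $\Omega=\{x\in\mathbb{R}^n:x_n<\varphi(\overline x)\}$ with $\varphi:\mathbb{R}^{n-1}\to\mathbb{R}$ Lipschitz continuous with constant $M$, and let $T$ be Burenkov's extension operator for $\Omega$ described in the context. Let $l\in\mathbb{N}_0$, $p\in[1,\infty[$, $\phi:]0,+\infty[\to]0,+\infty[$. The following statements hold: (i) There exists $c>0$ such that $$\|Tf\|_{M^{\phi,\delta}_p(\mathbb{R}^n)}\le c\,\|f\|_{M^{\phi,\delta}_p(\Omega)}$$ for all $\delta\in]0,\infty]$ and $f\in W^{l,p}(\Omega)$. (ii) Let $D>0$. There exists $c>0$ such that $$\|D^{\alpha}Tf\|_{M^{\phi,\delta}_p(\mathbb{R}^n)}\le c\sum_{|\beta|=l}\|D^{\beta}f\|_{M^{\phi,\delta}_p(\Omega)}$$ for all $\delta\in]0,\infty]$, all $f\in W^{l,p}(\Omega)$ with $\operatorname{supp}f\subset\{x\in\Omega:|\rho_n(x)|<D\}$, and all $\alpha\in\mathbb{N}_0^n$ with $|\alpha|=l$.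
   Context: Points of $\mathbb{R}^n$ are written $x=(\overline x,x_n)$ with $\overline x\in\mathbb{R}^{n-1}$, $x_n\in\mathbb{R}$. $\mathbb{N}_0=\mathbb{N}\cup\{0\}$. $B_r(x)$ is the ball with center $x$ and radius $r$. $W^{l,p}(\Omega)$ is the Sobolev space of functions $f\in L^p(\Omega)$ with weak derivatives $D^\alpha f\in L^p(\Omega)$ for all $|\alpha|\le l$. **Morrey norms.** For $\delta\in]0,\infty]$, an open set $U\subset\mathbb{R}^n$ and $f\in L^p_{loc}(U)$, $\|f\|_{M^{\phi,\delta}_p(U)}=\sup_{x\in U}\sup_{0<r<\delta}\big(\frac1{\phi(r)}\int_{B_r(x)\cap U}|f|^p\,dy\big)^{1/p}\in[0,\infty]$. **Geometry.** $|\varphi(\overline x)-\varphi(\overline y)|\le M|\overline x-\overline y|$ for all $\overline x,\overline y\in\mathbb{R}^{n-1}$, $M>0$. $G=\mathbb{R}^n\setminus\overline\Omega$, $\rho_n(x)=x_n-\varphi(\overline x)$, and $G_k=\{x\in G:2^{-k-1}<\rho_n(x)\le2^{-k}\}$ for $k\in\mathbb{Z}$. **Partition of unity.** Fix nonnegative $\psi_k\in C^\infty(\mathbb{R}^n)$, $k\in\mathbb{Z}$, with: $\sum_k\psi_k=1$ on $G$ and $=0$ off $G$; $G=\bigcup_k\operatorname{supp}\psi_k$ and the covering $\{\operatorname{supp}\psi_k\}_k$ has multiplicity $2$; $G_k\subset\operatorname{supp}\psi_k\subset G_{k-1}\cup G_k\cup G_{k+1}$; $|D^\alpha\psi_k(x)|\le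 c(\alpha)2^{k|\alpha|}$ for all $x\in\mathbb{R}^n,k\in\mathbb{Z},\alpha\in\mathbb{N}_0^n$. **Burenkov's operator.** Let $A=16(M+1)$ and fix $\omega\in C_c^\infty(\mathbb{R}^n)$ with $\operatorname{supp}\omega\subset\{x\in\overline{B_1(0)}:x_n\ge1/2\}$, $\int\omega\,dz=1$ and $\int\omega(z)z^\alpha dz=0$ for $0<|\alpha|\le l$. For $f\in W^{l,p}(\Omega)$, $Tf=f$ on $\Omega$ and $Tf(x)=\sum_{k\in\mathbb{Z}}\psi_k(x)f_k(x)$ for $x\in G$, where $$f_k(x)=\int_{\mathbb{R}^n}f(\overline x-2^{-k}\overline z,\ x_n-A2^{-k}z_n)\,\omega(z)\,dz.$$ $T$ is bounded from $W^{l,p}(\Omega)$ to $W^{l,p}(\mathbb{R}^n)$. *)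

theory Defs
  imports "HOL-Analysis.Analysis"
begin

(* R^n is real^'n, written 'n rvec, with 'n finite and linearly ordered, so n = CARD('n) >= 1 is
   arbitrary.  The last coordinate x_n is x $ last_ix, and R^(n-1) is identified with the hyperplane
   x_n = 0 of R^n: hbar x stands for the first n - 1 coordinates of x.  A function vphi on R^(n-1)
   is given as a function on R^n of which only the values on that hyperplane, vphi (hbar x), are
   ever used. *)

type_synonym 'n rvec = "(real, 'n) vec"

definition last_ix :: "'n::{finite,linorder}" where
  "last_ix = Max UNIV"

definition hbar :: "'n::{finite,linorder} rvec \<Rightarrow> 'n rvec" where
  "hbar x = (\<chi> i. if i = last_ix then 0 else x $ i)"


section \<open>Multi-indices, smooth functions, supports\<close>

type_synonym 'n multi_index = "'n \<Rightarrow> nat"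

definition mi_order :: "'n::finite multi_index \<Rightarrow> nat" where
  "mi_order \<alpha> = (\<Sum>i\<in>UNIV. \<alpha> i)"

definition mi_power :: "'n::finite rvec \<Rightarrow> 'n multi_index \<Rightarrow> real" where
  "mi_power z \<alpha> = (\<Prod>i\<in>UNIV. (z $ i) ^ \<alpha> i)"

definition partial_deriv :: "'n::finite \<Rightarrow> ('n rvec \<Rightarrow> real) \<Rightarrow> ('n rvec \<Rightarrow> real)" where
  "partial_deriv i f x = deriv (\<lambda>t. f (x + t *\<^sub>R axis i 1)) 0"

(* D_1^(alpha_1) ... D_n^(alpha_n) f, in the classical sense *)
definition mi_deriv ::
  "'n::{finite,linorder} multi_index \<Rightarrow> ('n rvec \<Rightarrow> real) \<Rightarrow> ('n rvec \<Rightarrow> real)" where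
  "mi_deriv \<alpha> f = foldr (\<lambda>i. partial_deriv i ^^ \<alpha> i) (sorted_list_of_set UNIV) f"

(* C^infinity(R^n): the iterated partial derivatives along every finite sequence of coordinates
   exist and are continuous *)
definition smooth :: "('n::finite rvec \<Rightarrow> real) \<Rightarrow> bool" where
  "smooth f \<longleftrightarrow> (\<forall>js. continuous_on UNIV (foldr partial_deriv js f) \<and>
     (\<forall>i x. (\<lambda>t. foldr partial_deriv js f (x + t *\<^sub>R axis i 1)) differentiable (at 0)))"

definition supp :: "('n::finite rvec \<Rightarrow> real) \<Rightarrow> 'n rvec set" where
  "supp f = closure {x. f x \<noteq> 0}"

(* The support of an almost-everywhere class of functions on an open set U, taken relative to U:
   the complement in U of the largest open subset of U on which f vanishes almost everywhere. *)
definition ess_supp :: "'n::finite rvec set \<Rightarrow> ('n rvec \<Rightarrow> real) \<Rightarrow> 'n rvec set" where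
  "ess_supp U f =
     {x \<in> U. \<forall>e>0. \<not> (AE y in lebesgue. y \<in> ball x e \<inter> U \<longrightarrow> f y = 0)}"


section \<open>Lebesgue, Sobolev and Morrey spaces\<close>

(* Functions on U are represented by total functions of which only the values on U matter. *)

definition Lp_on :: "real \<Rightarrow> 'n::finite rvec set \<Rightarrow> ('n rvec \<Rightarrow> real) set" where
  "Lp_on p U = {f. f \<in> borel_measurable (lebesgue_on U) \<and>
                   integrable (lebesgue_on U) (\<lambda>x. \<bar>f x\<bar> powr p)}"

definition locally_integrable :: "'n::finite rvec set \<Rightarrow> ('n rvec \<Rightarrow> real) \<Rightarrow> bool" where
  "locally_integrable U f \<longleftrightarrow> (\<forall>K. compact K \<and> K \<subseteq> U \<longrightarrow> set_integrable lebesgue K f)"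

definition test_function :: "'n::finite rvec set \<Rightarrow> ('n rvec \<Rightarrow> real) \<Rightarrow> bool" where
  "test_function U \<eta> \<longleftrightarrow> smooth \<eta> \<and> compact (supp \<eta>) \<and> supp \<eta> \<subseteq> U"

definition has_weak_deriv ::
  "'n::{finite,linorder} rvec set \<Rightarrow> 'n multi_index \<Rightarrow> ('n rvec \<Rightarrow> real) \<Rightarrow> ('n rvec \<Rightarrow> real) \<Rightarrow> bool"
  where
  "has_weak_deriv U \<alpha> f g \<longleftrightarrow> locally_integrable U f \<and> locally_integrable U g \<and>
     (\<forall>\<eta>. test_function U \<eta> \<longrightarrow>
        (LINT x:U|lebesgue. f x * mi_deriv \<alpha> \<eta> x) =
        (-1) ^ mi_order \<alpha> * (LINT x:U|lebesgue. g x * \<eta> x))"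

(* A representative of the weak derivative, which is unique up to null sets; unspecified if f has
   no weak derivative of this order on U. *)
definition weak_deriv ::
  "'n::{finite,linorder} rvec set \<Rightarrow> 'n multi_index \<Rightarrow> ('n rvec \<Rightarrow> real) \<Rightarrow> ('n rvec \<Rightarrow> real)" where
  "weak_deriv U \<alpha> f = (SOME g. has_weak_deriv U \<alpha> f g)"

definition sobolev ::
  "nat \<Rightarrow> real \<Rightarrow> 'n::{finite,linorder} rvec set \<Rightarrow> ('n rvec \<Rightarrow> real) set" where
  "sobolev l p U = {f \<in> Lp_on p U. \<forall>\<alpha>. mi_order \<alpha> \<le> l \<longrightarrow>
                      (\<exists>g \<in> Lp_on p U. has_weak_deriv U \<alpha> f g)}"

definition ennreal_powr :: "ennreal \<Rightarrow> real \<Rightarrow> ennreal" where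
  "ennreal_powr a s = (if a = \<infinity> then \<infinity> else ennreal (enn2real a powr s))"

definition morrey_norm ::
  "(real \<Rightarrow> real) \<Rightarrow> ennreal \<Rightarrow> real \<Rightarrow> 'n::finite rvec set \<Rightarrow> ('n rvec \<Rightarrow> real) \<Rightarrow> ennreal" where
  "morrey_norm \<phi> \<delta> p U f =
     (SUP x\<in>U. SUP r\<in>{r. 0 < r \<and> ennreal r < \<delta>}.
        ennreal_powr
          ((\<integral>\<^sup>+ y. ennreal (\<bar>f y\<bar> powr p) * indicator (ball x r \<inter> U) y \<partial>lebesgue)
             / ennreal (\<phi> r))
          (1 / p))"


section \<open>The domain, the partition of unity and Burenkov's operator\<close>

definition rho :: "('n::{finite,linorder} rvec \<Rightarrow> real) \<Rightarrow> 'n rvec \<Rightarrow> real" where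
  "rho vphi x = x $ last_ix - vphi (hbar x)"

definition Omega :: "('n::{finite,linorder} rvec \<Rightarrow> real) \<Rightarrow> 'n rvec set" where
  "Omega vphi = {x. x $ last_ix < vphi (hbar x)}"

definition G_set :: "('n::{finite,linorder} rvec \<Rightarrow> real) \<Rightarrow> 'n rvec set" where
  "G_set vphi = UNIV - closure (Omega vphi)"

definition G_layer :: "('n::{finite,linorder} rvec \<Rightarrow> real) \<Rightarrow> int \<Rightarrow> 'n rvec set" where
  "G_layer vphi k = {x \<in> G_set vphi. 2 powi (- k - 1) < rho vphi x \<and> rho vphi x \<le> 2 powi (- k)}"

definition burenkov_partition ::
  "('n::{finite,linorder} rvec \<Rightarrow> real) \<Rightarrow> (int \<Rightarrow> 'n rvec \<Rightarrow> real) \<Rightarrow> bool" where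
  "burenkov_partition vphi \<psi> \<longleftrightarrow>
     (\<forall>k. smooth (\<psi> k) \<and> (\<forall>x. 0 \<le> \<psi> k x)) \<and>
     (\<forall>x. ((\<lambda>k. \<psi> k x) has_sum (if x \<in> G_set vphi then 1 else 0)) UNIV) \<and>
     G_set vphi = (\<Union>k. supp (\<psi> k)) \<and>
     (\<forall>x. finite {k. x \<in> supp (\<psi> k)} \<and> card {k. x \<in> supp (\<psi> k)} \<le> 2) \<and>
     (\<exists>x. card {k. x \<in> supp (\<psi> k)} = 2) \<and>
     (\<forall>k. G_layer vphi k \<subseteq> supp (\<psi> k) \<and>
          supp (\<psi> k) \<subseteq> G_layer vphi (k - 1) \<union> G_layer vphi k \<union> G_layer vphi (k + 1)) \<and>
     (\<forall>\<alpha>. \<exists>c. \<forall>x k. \<bar>mi_deriv \<alpha> (\<psi> k) x\<bar> \<le> c * 2 powi (k * int (mi_order \<alpha>)))"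

definition burenkov_kernel :: "nat \<Rightarrow> ('n::{finite,linorder} rvec \<Rightarrow> real) \<Rightarrow> bool" where
  "burenkov_kernel l \<omega> \<longleftrightarrow>
     smooth \<omega> \<and> supp \<omega> \<subseteq> {x \<in> cball 0 1. 1 / 2 \<le> x $ last_ix} \<and>
     (LINT z|lebesgue. \<omega> z) = 1 \<and>
     (\<forall>\<alpha>. 0 < mi_order \<alpha> \<and> mi_order \<alpha> \<le> l \<longrightarrow> (LINT z|lebesgue. \<omega> z * mi_power z \<alpha>) = 0)"

definition burenkov_shift ::
  "real \<Rightarrow> int \<Rightarrow> 'n::{finite,linorder} rvec \<Rightarrow> 'n rvec \<Rightarrow> 'n rvec" where
  "burenkov_shift A k x z =
     (\<chi> i. if i = last_ix then x $ i - A * 2 powi (- k) * z $ i else x $ i - 2 powi (- k) * z $ i)"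

(* The values of f outside Omega are irrelevant: if x is in supp (psi k) and z in supp omega, then
   the shifted point lies in Omega. *)
definition burenkov_avg ::
  "real \<Rightarrow> ('n::{finite,linorder} rvec \<Rightarrow> real) \<Rightarrow> ('n rvec \<Rightarrow> real) \<Rightarrow> int \<Rightarrow> 'n rvec \<Rightarrow> real" where
  "burenkov_avg M \<omega> f k x =
     (LINT z|lebesgue. f (burenkov_shift (16 * (M + 1)) k x z) * \<omega> z)"

(* On the boundary of Omega, a null set, all psi k vanish and the value is 0.  At every point the
   series has at most two nonzero terms. *)
definition burenkov_op ::
  "real \<Rightarrow> ('n::{finite,linorder} rvec \<Rightarrow> real) \<Rightarrow> (int \<Rightarrow> 'n rvec \<Rightarrow> real) \<Rightarrow> ('n rvec \<Rightarrow> real) \<Rightarrow>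
   ('n rvec \<Rightarrow> real) \<Rightarrow> 'n rvec \<Rightarrow> real" where
  "burenkov_op M vphi \<psi> \<omega> f x =
     (if x \<in> Omega vphi then f x else (\<Sum>\<^sub>\<infinity>k\<in>UNIV. \<psi> k x * burenkov_avg M \<omega> f k x))"

end

theory Submission
  imports Defs
begin

text \<open>
  Write \<open>f\<^sub>k\<close> for the average of \<open>f\<close> that enters the extension on the layer where the distance
  \<open>rho\<close> to the graph is about \<open>2\<^sup>-\<^sup>k\<close>. The \<open>\<psi>\<^sub>k\<close> add up to 1, so near a point of a layer the extension is
  \<open>f\<^sub>j + \<Sum>\<^sub>k \<psi>\<^sub>k (f\<^sub>k - f\<^sub>j)\<close>, where only a few \<open>k\<close> close to \<open>j\<close> occur. Differentiate this \<open>l\<close> times.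
  A derivative \<open>D\<^sup>a \<psi>\<^sub>k\<close> costs a factor \<open>2\<^bsup>k|a|\<^esup>\<close>, but it multiplies a difference of averages of
  \<open>D\<^sup>b f\<close>, \<open>|b| = l - |a|\<close>, at two comparable scales. Both averages reproduce the Taylor polynomial of
  degree \<open>|a| - 1\<close> of \<open>D\<^sup>b f\<close> at a common base point, because the moments of the kernel vanish; hence
  the difference is of size \<open>2\<^bsup>-k|a|\<^esup>\<close> times averages of derivatives of order \<open>l\<close>
  (\<open>poincare_weak\<close>). The powers of 2 cancel, and on each layer the derivatives of the extension are
  controlled in \<open>L\<^sup>p\<close> by the derivatives of order \<open>l\<close> of \<open>f\<close> on translates of the layer by vectors
  of length about \<open>2\<^sup>-\<^sup>j\<close> that lead into the domain (\<open>local_estimate\<close>).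

  Now intersect the layers with a ball of radius \<open>r\<close>. The translates that belong to layers with
  \<open>2\<^sup>-\<^sup>j \<le> r\<close> stay in a ball of radius \<open>C r\<close>, and since they have depth about \<open>2\<^sup>-\<^sup>j\<close> in the domain they
  overlap boundedly often. Layers with \<open>2\<^sup>-\<^sup>j > r\<close> meet the ball for boundedly many \<open>j\<close> only, and each of
  them contributes part of a translate of the ball. Finally a ball of radius \<open>C r\<close> is covered by a fixed number
  of balls of radius \<open>r\<close>. So the integral over a ball of radius \<open>r\<close> is bounded by integrals over
  balls of the same radius \<open>r\<close> with centres in the domain (\<open>layer_sum_bound\<close>, \<open>g_morrey\<close>), and the
  weight \<open>\<phi> r\<close> is the same on both sides. The estimate of \<open>T f\<close> itself is the case \<open>l = 0\<close>.

  It remains to see that the function which is \<open>D\<^sup>\<alpha> f\<close> in the domain and the classical derivative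
  outside is the weak derivative of \<open>T f\<close> across the boundary. The functions
  \<open>F\<^sub>j = f\<^sub>j + \<Sum>\<^bsub>k<j\<^esub> \<psi>\<^sub>k (f\<^sub>k - f\<^sub>j)\<close> are smooth on the whole space, agree with \<open>T f\<close> where
  \<open>rho > 2\<^bsup>1-j\<^esup>\<close>, and equal \<open>f\<^sub>j\<close> in the domain, whose derivatives tend weakly to those of
  \<open>f\<close>. In the thin layer between, the local estimate bounds the derivatives of \<open>F\<^sub>j\<close> by integrals of
  \<open>D\<^sup>\<gamma> f\<close> over a strip that shrinks to the boundary, so this part disappears in the limit
  (\<open>thin_layer_vanishes\<close>, \<open>glue_limit\<close>, \<open>weakly_g\<close>). The derivatives in the theorem are arbitrary
  representatives, which is harmless by \<open>weak_deriv_AE_unique\<close>.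

  Throughout, \<open>f\<close> and its weak derivatives are replaced by Borel functions that vanish outside the
  domain. The averages are then smooth on the whole space, and Fubini's theorem applies to them.
\<close>

section \<open>Iterated partial derivatives of smooth functions\<close>

text \<open>Derivatives along a list of coordinates are easier to handle by induction than
  multi-indices; for smooth functions only the multiset of the coordinates matters.\<close>
abbreviation pds :: "'n::finite list \<Rightarrow> ('n rvec \<Rightarrow> real) \<Rightarrow> 'n rvec \<Rightarrow> real" where
  "pds js f \<equiv> foldr partial_deriv js f"

lemma partial_derivI:
  "((\<lambda>t. f (x + t *\<^sub>R axis i 1)) has_real_derivative D) (at 0) \<Longrightarrow> partial_deriv i f x = D"
  by (simp add: partial_deriv_def DERIV_imp_deriv)

lemma smooth_partial_deriv:
  assumes "smooth f" shows "smooth (partial_deriv i f)"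
proof -
  have "foldr partial_deriv js (partial_deriv i f) = foldr partial_deriv (js @ [i]) f" for js
    by simp
  then show ?thesis using assms unfolding smooth_def by metis
qed

lemma smooth_pds: "smooth f \<Longrightarrow> smooth (pds js f)"
  by (induction js) (auto intro: smooth_partial_deriv)

lemma smooth_continuous: "smooth f \<Longrightarrow> continuous_on UNIV f"
  unfolding smooth_def by (metis foldr.simps(1) id_apply)

lemma smooth_DERIV:
  assumes "smooth f"
  shows "((\<lambda>t. f (x + t *\<^sub>R axis i 1)) has_real_derivative partial_deriv i f (x + s *\<^sub>R axis i 1)) (at s)"
proof -
  have "(\<lambda>t. f ((x + s *\<^sub>R axis i 1) + t *\<^sub>R axis i 1)) differentiable (at 0)"
    using assms unfolding smooth_def by (metis foldr.simps(1) id_apply)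
  then have "((\<lambda>t. f ((x + s *\<^sub>R axis i 1) + t *\<^sub>R axis i 1)) has_real_derivative
      partial_deriv i f (x + s *\<^sub>R axis i 1)) (at 0)"
    unfolding partial_deriv_def
    by (simp add: DERIV_deriv_iff_real_differentiable)
  then have "((\<lambda>t. f ((x + s *\<^sub>R axis i 1) + t *\<^sub>R axis i 1)) has_real_derivative
      partial_deriv i f (x + s *\<^sub>R axis i 1)) (at (s + - s))" by simp
  from this[unfolded DERIV_shift] show ?thesis
    by (simp add: algebra_simps)
qed

lemma smooth_DERIV0:
  assumes "smooth f"
  shows "((\<lambda>t. f (x + t *\<^sub>R axis i 1)) has_real_derivative partial_deriv i f x) (at 0)"
  using smooth_DERIV[OF assms, of x i 0] by simp

text \<open>Smoothness is a greatest fixed point: a class of functions closed under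
  partial derivatives consists of smooth functions as soon as its members are continuous and partially
  differentiable.\<close>
lemma smooth_coinduct:
  assumes "P f"
    and step: "\<And>f. P f \<Longrightarrow> continuous_on UNIV f \<and>
      (\<forall>i. (\<forall>x. (\<lambda>t. f (x + t *\<^sub>R axis i 1)) differentiable (at 0)) \<and> P (partial_deriv i f))"
  shows "smooth f"
proof -
  have "P (pds js f)" for js
    by (induction js) (use assms in auto)
  then show ?thesis unfolding smooth_def using step by blast
qed

lemma partial_deriv_const: "partial_deriv i (\<lambda>x. c) = (\<lambda>x. 0)"
  by (intro ext partial_derivI) simp

lemma smooth_const [simp]: "smooth (\<lambda>x. c)"
proof (rule smooth_coinduct[where P="\<lambda>f. \<exists>c. f = (\<lambda>x. c)"])
  fix f :: "'a rvec \<Rightarrow> real" assume "\<exists>c. f = (\<lambda>x. c)"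
  then obtain c where "f = (\<lambda>x. c)" ..
  then show "continuous_on UNIV f \<and>
      (\<forall>i. (\<forall>x. (\<lambda>t. f (x + t *\<^sub>R axis i 1)) differentiable (at 0)) \<and> (\<exists>c. partial_deriv i f = (\<lambda>x. c)))"
    by (auto simp: partial_deriv_const intro: exI[of _ 0])
qed auto

lemma partial_deriv_lincomb:
  assumes "smooth f" "smooth g"
  shows "partial_deriv i (\<lambda>x. a * f x + b * g x) = (\<lambda>x. a * partial_deriv i f x + b * partial_deriv i g x)"
  by (intro ext partial_derivI DERIV_add DERIV_cmult smooth_DERIV0 assms)

lemma smooth_lincomb:
  assumes "smooth f" "smooth g"
  shows "smooth (\<lambda>x. a * f x + b * g x)"
proof (rule smooth_coinduct[where P="\<lambda>h. \<exists>f g. smooth f \<and> smooth g \<and> h = (\<lambda>x. a * f x + b * g x)"])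
  fix h :: "'a rvec \<Rightarrow> real" assume "\<exists>f g. smooth f \<and> smooth g \<and> h = (\<lambda>x. a * f x + b * g x)"
  then obtain f g where s: "smooth f" "smooth g" and h: "h = (\<lambda>x. a * f x + b * g x)" by blast
  have "continuous_on UNIV h"
    unfolding h by (intro continuous_intros smooth_continuous s)
  moreover have "(\<lambda>t. h (x + t *\<^sub>R axis i 1)) differentiable (at 0)" for x i
    unfolding h real_differentiable_def
    using DERIV_add[OF DERIV_cmult[OF smooth_DERIV0[OF s(1)]] DERIV_cmult[OF smooth_DERIV0[OF s(2)]]] by blast
  moreover have "\<exists>f g. smooth f \<and> smooth g \<and> partial_deriv i h = (\<lambda>x. a * f x + b * g x)" for i
    unfolding h partial_deriv_lincomb[OF s] using s smooth_partial_deriv by blast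
  ultimately show "continuous_on UNIV h \<and>
      (\<forall>i. (\<forall>x. (\<lambda>t. h (x + t *\<^sub>R axis i 1)) differentiable (at 0)) \<and>
       (\<exists>f g. smooth f \<and> smooth g \<and> partial_deriv i h = (\<lambda>x. a * f x + b * g x)))" by blast
qed (use assms in blast)

lemma pds_lincomb:
  assumes "smooth f" "smooth g"
  shows "pds js (\<lambda>x. a * f x + b * g x) = (\<lambda>x. a * pds js f x + b * pds js g x)"
  by (induction js) (auto simp: partial_deriv_lincomb smooth_pds assms)

lemma smooth_add: "smooth f \<Longrightarrow> smooth g \<Longrightarrow> smooth (\<lambda>x. f x + g x)"
  and smooth_diff: "smooth f \<Longrightarrow> smooth g \<Longrightarrow> smooth (\<lambda>x. f x - g x)"
  using smooth_lincomb[of f g 1 1] smooth_lincomb[of f g 1 "-1"] by auto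

lemma pds_add: "smooth f \<Longrightarrow> smooth g \<Longrightarrow> pds js (\<lambda>x. f x + g x) = (\<lambda>x. pds js f x + pds js g x)"
  and pds_diff: "smooth f \<Longrightarrow> smooth g \<Longrightarrow> pds js (\<lambda>x. f x - g x) = (\<lambda>x. pds js f x - pds js g x)"
  using pds_lincomb[of f g js 1 1] pds_lincomb[of f g js 1 "-1"] by auto

lemma smooth_sum:
  assumes "\<And>k. k \<in> K \<Longrightarrow> smooth (F k)"
  shows "smooth (\<lambda>x. \<Sum>k\<in>K. F k x)"
  using assms by (induction K rule: infinite_finite_induct) (auto intro: smooth_add)

lemma pds_zero: "pds js (\<lambda>x. 0) = (\<lambda>x. 0)"
  by (induction js) (auto simp: partial_deriv_const)

lemma pds_sum:
  assumes "\<And>k. k \<in> K \<Longrightarrow> smooth (F k)"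
  shows "pds js (\<lambda>x. \<Sum>k\<in>K. F k x) = (\<lambda>x. \<Sum>k\<in>K. pds js (F k) x)"
  using assms by (induction K rule: infinite_finite_induct) (auto simp: pds_add smooth_sum pds_zero)

section \<open>The Leibniz rule\<close>

text \<open>All ways of distributing the derivatives of a list over two factors, with multiplicity,
  so that the Leibniz rule needs no binomial coefficients.\<close>
fun splits :: "'a list \<Rightarrow> ('a list \<times> 'a list) list" where
  "splits [] = [([], [])]"
| "splits (j # js) = map (\<lambda>(a, b). (j # a, b)) (splits js) @ map (\<lambda>(a, b). (a, j # b)) (splits js)"

lemma splits_length: "(a, b) \<in> set (splits js) \<Longrightarrow> length a + length b = length js"
  by (induction js arbitrary: a b) auto

lemma smooth_DERIV_sum_list:
  fixes L :: "(('n::finite rvec \<Rightarrow> real) \<times> ('n rvec \<Rightarrow> real)) list"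
  assumes "\<And>a b. (a, b) \<in> set L \<Longrightarrow> smooth a \<and> smooth b"
  shows "((\<lambda>t. \<Sum>(a, b)\<leftarrow>L. a (x + t *\<^sub>R axis i 1) * b (x + t *\<^sub>R axis i 1)) has_real_derivative
    (\<Sum>(a, b)\<leftarrow>L. partial_deriv i a x * b x + a x * partial_deriv i b x)) (at 0)"
  using assms
proof (induction L)
  case (Cons p L)
  obtain a b where p: "p = (a, b)" by force
  have "smooth a" "smooth b" using Cons.prems p by auto
  from this[THEN smooth_DERIV0, of x i] have
    "((\<lambda>t. a (x + t *\<^sub>R axis i 1) * b (x + t *\<^sub>R axis i 1)) has_real_derivative
      (partial_deriv i a x * b x + a x * partial_deriv i b x)) (at 0)"
    by (auto intro!: derivative_eq_intros)
  from DERIV_add[OF this Cons.IH] show ?case using Cons.prems p by auto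
qed auto

lemma continuous_sum_list_mult:
  fixes L :: "(('n::finite rvec \<Rightarrow> real) \<times> ('n rvec \<Rightarrow> real)) list"
  assumes "\<And>a b. (a, b) \<in> set L \<Longrightarrow> smooth a \<and> smooth b"
  shows "continuous_on UNIV (\<lambda>x. \<Sum>(a, b)\<leftarrow>L. a x * b x)"
  using assms
proof (induction L)
  case (Cons p L)
  obtain a b where p: "p = (a, b)" by force
  with Cons.prems have "smooth a" "smooth b" by auto
  from this[THEN smooth_continuous] Cons show ?case
    by (auto simp: p intro!: continuous_intros)
qed auto

lemma smooth_sum_list_mult:
  fixes L :: "(('n::finite rvec \<Rightarrow> real) \<times> ('n rvec \<Rightarrow> real)) list"
  assumes "\<And>a b. (a, b) \<in> set L \<Longrightarrow> smooth a \<and> smooth b"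
  shows "smooth (\<lambda>x. \<Sum>(a, b)\<leftarrow>L. a x * b x)"
proof (rule smooth_coinduct[where P="\<lambda>h. \<exists>L. (\<forall>(a,b)\<in>set L. smooth a \<and> smooth b) \<and>
     h = (\<lambda>x. \<Sum>(a, b)\<leftarrow>L. a x * b x)"])
  fix h :: "'n rvec \<Rightarrow> real"
  assume "\<exists>L. (\<forall>(a,b)\<in>set L. smooth a \<and> smooth b) \<and> h = (\<lambda>x. \<Sum>(a, b)\<leftarrow>L. a x * b x)"
  then obtain L where L: "\<And>a b. (a, b) \<in> set L \<Longrightarrow> smooth a \<and> smooth b"
    and h: "h = (\<lambda>x. \<Sum>(a, b)\<leftarrow>L. a x * b x)" by blast
  have D: "((\<lambda>t. h (x + t *\<^sub>R axis i 1)) has_real_derivative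
    (\<Sum>(a, b)\<leftarrow>L. partial_deriv i a x * b x + a x * partial_deriv i b x)) (at 0)" for x i
    unfolding h by (rule smooth_DERIV_sum_list[OF L])
  have "\<exists>L. (\<forall>(a,b)\<in>set L. smooth a \<and> smooth b) \<and> partial_deriv i h = (\<lambda>x. \<Sum>(a, b)\<leftarrow>L. a x * b x)" for i
  proof (intro exI conjI)
    let ?L = "map (\<lambda>(a, b). (partial_deriv i a, b)) L @ map (\<lambda>(a, b). (a, partial_deriv i b)) L"
    show "\<forall>(a,b)\<in>set ?L. smooth a \<and> smooth b" using L smooth_partial_deriv by fastforce
    have "(\<Sum>(a, b)\<leftarrow>L. partial_deriv i a x * b x + a x * partial_deriv i b x) = (\<Sum>(a, b)\<leftarrow>?L. a x * b x)" for x
      by (induction L) auto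
    then show "partial_deriv i h = (\<lambda>x. \<Sum>(a, b)\<leftarrow>?L. a x * b x)"
      using partial_derivI[OF D] by auto
  qed
  moreover have "continuous_on UNIV h" unfolding h by (rule continuous_sum_list_mult[OF L])
  moreover have "(\<lambda>t. h (x + t *\<^sub>R axis i 1)) differentiable (at 0)" for x i
    using D real_differentiable_def by blast
  ultimately show "continuous_on UNIV h \<and>
      (\<forall>i. (\<forall>x. (\<lambda>t. h (x + t *\<^sub>R axis i 1)) differentiable (at 0)) \<and>
       (\<exists>L. (\<forall>(a,b)\<in>set L. smooth a \<and> smooth b) \<and> partial_deriv i h = (\<lambda>x. \<Sum>(a, b)\<leftarrow>L. a x * b x)))"
    by blast
qed (use assms in blast)

lemma smooth_mult: "smooth f \<Longrightarrow> smooth g \<Longrightarrow> smooth (\<lambda>x. f x * g x)"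
  using smooth_sum_list_mult[of "[(f, g)]"] by auto

lemma pds_mult:
  assumes "smooth f" "smooth g"
  shows "pds js (\<lambda>x. f x * g x) = (\<lambda>x. \<Sum>(a, b)\<leftarrow>splits js. pds a f x * pds b g x)"
proof (induction js)
  case (Cons j js)
  let ?L = "map (\<lambda>(a, b). (pds a f, pds b g)) (splits js)"
  have eq: "(\<lambda>x. \<Sum>(a, b)\<leftarrow>splits js. pds a f x * pds b g x) = (\<lambda>x. \<Sum>(a, b)\<leftarrow>?L. a x * b x)"
    by (simp add: o_def case_prod_unfold)
  have L: "\<And>a b. (a, b) \<in> set ?L \<Longrightarrow> smooth a \<and> smooth b"
    using assms smooth_pds by auto
  have "partial_deriv j (\<lambda>x. \<Sum>(a, b)\<leftarrow>?L. a x * b x) x =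
      (\<Sum>(a, b)\<leftarrow>?L. partial_deriv j a x * b x + a x * partial_deriv j b x)" for x
    by (rule partial_derivI, rule smooth_DERIV_sum_list[OF L])
  then show ?case using Cons
    by (auto simp: eq o_def case_prod_unfold sum_list_addf)
qed auto

section \<open>Supports and diagonal changes of variables\<close>

lemma pds_local:
  assumes "open U" "\<And>x. x \<in> U \<Longrightarrow> f x = g x"
  shows "x \<in> U \<Longrightarrow> pds js f x = pds js g x"
proof (induction js arbitrary: x)
  case (Cons j js)
  have "((\<lambda>t. x + t *\<^sub>R axis j 1) \<longlongrightarrow> x + 0 *\<^sub>R axis j 1) (nhds (0::real))"
    by (intro tendsto_intros) (simp add: filterlim_ident)
  then have "eventually (\<lambda>t::real. x + t *\<^sub>R axis j 1 \<in> U) (nhds 0)"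
    using topological_tendstoD assms(1) Cons.prems by fastforce
  then have "eventually (\<lambda>t::real. pds js f (x + t *\<^sub>R axis j 1) = pds js g (x + t *\<^sub>R axis j 1)) (nhds 0)"
    by eventually_elim (rule Cons.IH)
  then show ?case
    by (simp only: foldr.simps o_apply, subst (1 2) partial_deriv_def, intro deriv_cong_ev) auto
qed (use assms in auto)

lemma pds_outside_supp:
  assumes "x \<notin> supp f" shows "pds js f x = 0"
proof -
  have "pds js f x = pds js (\<lambda>x. 0) x"
    by (rule pds_local[of "- supp f"]) (use assms closure_subset[of "{x. f x \<noteq> 0}"] in \<open>auto simp: supp_def\<close>)
  then show ?thesis by (simp add: pds_zero)
qed

lemma supp_pds: "supp (pds js f) \<subseteq> supp f"
proof -
  have "{x. pds js f x \<noteq> 0} \<subseteq> supp f" using pds_outside_supp by blast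
  then show ?thesis using closure_minimal[of _ "supp f"] by (auto simp: supp_def)
qed

definition diag_mult :: "('n \<Rightarrow> real) \<Rightarrow> 'n::finite rvec \<Rightarrow> 'n rvec" where
  "diag_mult c z = (\<chi> i. c i * z $ i)"

lemma linear_diag_mult: "linear (diag_mult c)"
  by (rule linearI) (auto simp: diag_mult_def vec_eq_iff algebra_simps)

lemmas bounded_linear_diag_mult = linear_diag_mult[THEN linear_conv_bounded_linear[THEN iffD1]]

text \<open>A diagonal change of variables covers both the anisotropic scaling of the kernel and the
  reflection that turns a convolution kernel into a test function.\<close>
lemma partial_deriv_affine:
  assumes "smooth f"
  shows "((\<lambda>t. b * f (a + diag_mult c (x + t *\<^sub>R axis i 1))) has_real_derivative
      b * c i * partial_deriv i f (a + diag_mult c x)) (at 0)"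
proof -
  have "a + diag_mult c (x + t *\<^sub>R axis i 1) = (a + diag_mult c x) + (c i * t) *\<^sub>R axis i 1" for t
    by (auto simp: diag_mult_def vec_eq_iff axis_def algebra_simps)
  moreover have d: "((\<lambda>t. f ((a + diag_mult c x) + (c i * t) *\<^sub>R axis i 1)) has_real_derivative
      partial_deriv i f (a + diag_mult c x) * c i) (at 0)"
    by (rule DERIV_chain2[where g="\<lambda>t. c i * t"])
       (auto intro!: derivative_eq_intros smooth_DERIV0 assms)
  ultimately show ?thesis
    using DERIV_cmult[of "\<lambda>t. f ((a + diag_mult c x) + (c i * t) *\<^sub>R axis i 1)" _ 0 UNIV b, OF d]
    by (simp add: mult_ac add.assoc)
qed

lemma smooth_affine:
  assumes "smooth f" shows "smooth (\<lambda>x. b * f (a + diag_mult c x))"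
proof (rule smooth_coinduct[where P="\<lambda>h. \<exists>f b. smooth f \<and> h = (\<lambda>x. b * f (a + diag_mult c x))"])
  fix h :: "'a rvec \<Rightarrow> real" assume "\<exists>f b. smooth f \<and> h = (\<lambda>x. b * f (a + diag_mult c x))"
  then obtain f b where f: "smooth f" and h: "h = (\<lambda>x. b * f (a + diag_mult c x))" by blast
  have "partial_deriv i h = (\<lambda>x. (b * c i) * partial_deriv i f (a + diag_mult c x))" for i
    unfolding h by (intro ext partial_derivI partial_deriv_affine f)
  then have "\<exists>f b. smooth f \<and> partial_deriv i h = (\<lambda>x. b * f (a + diag_mult c x))" for i
    using f smooth_partial_deriv by blast
  moreover have "continuous_on UNIV h" unfolding h
    by (intro continuous_intros continuous_on_compose2[OF smooth_continuous[OF f]]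
        linear_continuous_on bounded_linear_diag_mult) auto
  moreover have "(\<lambda>t. h (x + t *\<^sub>R axis i 1)) differentiable (at 0)" for x i
    unfolding h using partial_deriv_affine[OF f] real_differentiable_def by blast
  ultimately show "continuous_on UNIV h \<and>
      (\<forall>i. (\<forall>x. (\<lambda>t. h (x + t *\<^sub>R axis i 1)) differentiable (at 0)) \<and>
       (\<exists>f b. smooth f \<and> partial_deriv i h = (\<lambda>x. b * f (a + diag_mult c x))))" by blast
qed (use assms in blast)

lemma pds_affine:
  assumes "smooth f"
  shows "pds js (\<lambda>x. b * f (a + diag_mult c x)) = (\<lambda>x. b * prod_list (map c js) * pds js f (a + diag_mult c x))"
proof (induction js)
  case (Cons j js)
  show ?case
    apply (simp add: Cons del: mult.assoc)
    apply (intro ext)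
    apply (rule partial_derivI)
    apply (rule DERIV_cong, rule partial_deriv_affine[OF smooth_pds[OF assms]])
    by (simp add: mult_ac)
qed simp

section \<open>Total derivatives and commuting partial derivatives\<close>

text \<open>The increment is telescoped coordinate by coordinate; along each coordinate the mean value
  inequality applies to \<open>f\<close> minus its linear part.\<close>
lemma smooth_has_derivative:
  fixes f :: "'n::finite rvec \<Rightarrow> real"
  assumes f: "smooth f"
  shows "(f has_derivative (\<lambda>h. \<Sum>i\<in>UNIV. h $ i * partial_deriv i f x)) (at x)"
proof -
  define r where "r A h = (\<chi> i. if i \<in> A then h $ i else 0)" for A and h :: "'n rvec"
  have lin: "linear (\<lambda>h. \<Sum>i\<in>UNIV. h $ i * partial_deriv i f x)"
    by (rule linearI) (auto simp: sum.distrib sum_distrib_left algebra_simps)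
  have main: "\<exists>d>0. \<forall>h. norm h < d \<longrightarrow> \<bar>f (x + h) - f x - (\<Sum>i\<in>UNIV. h $ i * partial_deriv i f x)\<bar> \<le> e * norm h"
    if "e > 0" for e
  proof -
    define e' where "e' = e / real (CARD('n))"
    have e': "e' > 0" using that by (simp add: e'_def)
    have "\<exists>d>0. \<forall>y. norm (y - x) < d \<longrightarrow> \<bar>partial_deriv i f y - partial_deriv i f x\<bar> < e'" for i
      using smooth_continuous[OF smooth_partial_deriv[OF f], of i] e'
      unfolding continuous_on_iff dist_norm by (metis UNIV_I real_norm_def)
    then obtain D where D: "\<And>i. D i > 0"
      "\<And>i y. norm (y - x) < D i \<Longrightarrow> \<bar>partial_deriv i f y - partial_deriv i f x\<bar> < e'" by metis
    define d where "d = Min (range D)"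
    have d: "d > 0" "\<And>i. d \<le> D i" using D by (auto simp: d_def)
    have step: "\<bar>f (x + r A h) - f x - (\<Sum>i\<in>A. h $ i * partial_deriv i f x)\<bar> \<le> real (card A) * e' * norm h"
      if h: "norm h < d" for A h
      using finite[of A]
    proof (induction A rule: finite_induct)
      case empty
      have "r {} h = 0" by (simp add: r_def vec_eq_iff)
      then show ?case by simp
    next
      case (insert j A)
      define g where "g t = f ((x + r A h) + t *\<^sub>R axis j 1) - t * partial_deriv j f x" for t
      have "norm (g (h $ j) - g 0) \<le> e' * norm (h $ j - 0)"
      proof (rule field_differentiable_bound[of "cball 0 \<bar>h $ j\<bar>"])
        fix t :: real assume t: "t \<in> cball 0 \<bar>h $ j\<bar>"
        show "(g has_field_derivative partial_deriv j f ((x + r A h) + t *\<^sub>R axis j 1) - partial_deriv j f x) (at t within cball 0 \<bar>h $ j\<bar>)"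
          unfolding g_def
          by (rule has_field_derivative_at_within) (auto intro!: derivative_eq_intros smooth_DERIV f)
        have "norm (r A h + t *\<^sub>R axis j 1) \<le> norm h"
          using t insert.hyps by (intro norm_le_componentwise_cart) (auto simp: r_def axis_def)
        then have "norm (((x + r A h) + t *\<^sub>R axis j 1) - x) < D j"
          using h d(2)[of j] by (simp add: add.assoc)
        from D(2)[OF this] show "norm (partial_deriv j f (x + r A h + t *\<^sub>R axis j 1) - partial_deriv j f x) \<le> e'"
          by simp
      qed auto
      moreover have "x + r (insert j A) h = (x + r A h) + (h $ j) *\<^sub>R axis j 1"
        using insert.hyps by (auto simp: r_def axis_def vec_eq_iff)
      ultimately have "\<bar>f (x + r (insert j A) h) - f (x + r A h) - h $ j * partial_deriv j f x\<bar> \<le> e' * \<bar>h $ j\<bar>"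
        by (simp add: g_def algebra_simps)
      also have "\<dots> \<le> e' * norm h" using e' component_le_norm_cart[of h j] by simp
      finally show ?case using insert by (simp add: algebra_simps)
    qed
    have "r UNIV h = h" for h by (simp add: r_def)
    moreover have "real CARD('n) * e' = e" by (simp add: e'_def)
    ultimately show ?thesis using step[of _ UNIV] d(1) by auto
  qed
  show ?thesis
    unfolding has_derivative_at_alt
  proof (intro conjI allI impI)
    show "bounded_linear (\<lambda>h. \<Sum>i\<in>UNIV. h $ i * partial_deriv i f x)"
      using lin linear_conv_bounded_linear by blast
    fix e :: real assume "e > 0"
    from main[OF this] obtain d where "d > 0"
      and d: "\<And>h. norm h < d \<Longrightarrow> \<bar>f (x + h) - f x - (\<Sum>i\<in>UNIV. h $ i * partial_deriv i f x)\<bar> \<le> e * norm h"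
      by blast
    show "\<exists>d>0. \<forall>y. norm (y - x) < d \<longrightarrow>
        norm (f y - f x - (\<Sum>i\<in>UNIV. (y - x) $ i * partial_deriv i f x)) \<le> e * norm (y - x)"
    proof (intro exI[of _ d] conjI allI impI)
      fix y assume "norm (y - x) < d"
      from d[OF this] show "norm (f y - f x - (\<Sum>i\<in>UNIV. (y - x) $ i * partial_deriv i f x)) \<le> e * norm (y - x)"
        by simp
    qed fact
  qed
qed

text \<open>The mixed second difference, divided by \<open>s t\<close>, tends to the mixed derivative in either order;
  it is symmetric in the two directions, which gives equality of the mixed derivatives.\<close>
lemma second_difference:
  fixes f :: "'n::finite rvec \<Rightarrow> real"
  assumes f: "smooth f" and "e > 0"
  shows "\<exists>d>0. \<forall>s t. \<bar>s\<bar> < d \<and> \<bar>t\<bar> < d \<longrightarrow>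
     \<bar>f (x + s *\<^sub>R axis i 1 + t *\<^sub>R axis j 1) - f (x + s *\<^sub>R axis i 1) - f (x + t *\<^sub>R axis j 1) + f x
        - s * t * partial_deriv i (partial_deriv j f) x\<bar> \<le> e * \<bar>s\<bar> * \<bar>t\<bar>"
proof -
  let ?c = "partial_deriv i (partial_deriv j f) x"
  have sj: "smooth (partial_deriv j f)" by (rule smooth_partial_deriv[OF f])
  obtain d where d: "d > 0" "\<And>y. norm (y - x) < d \<Longrightarrow> \<bar>partial_deriv i (partial_deriv j f) y - ?c\<bar> < e"
    using smooth_continuous[OF smooth_partial_deriv[OF sj], of i] \<open>e > 0\<close>
    unfolding continuous_on_iff dist_norm by (metis UNIV_I real_norm_def)
  have A: "\<bar>partial_deriv j f (x + s *\<^sub>R axis i 1 + u *\<^sub>R axis j 1) - partial_deriv j f (x + u *\<^sub>R axis j 1) - s * ?c\<bar> \<le> e * \<bar>s\<bar>"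
    if "\<bar>s\<bar> < d/2" "\<bar>u\<bar> < d/2" for s u
  proof -
    define g where "g v = partial_deriv j f ((x + u *\<^sub>R axis j 1) + v *\<^sub>R axis i 1) - v * ?c" for v
    have "norm (g s - g 0) \<le> e * norm (s - 0)"
    proof (rule field_differentiable_bound[of "cball 0 \<bar>s\<bar>"])
      fix v :: real assume v: "v \<in> cball 0 \<bar>s\<bar>"
      show "(g has_field_derivative partial_deriv i (partial_deriv j f) ((x + u *\<^sub>R axis j 1) + v *\<^sub>R axis i 1) - ?c) (at v within cball 0 \<bar>s\<bar>)"
        unfolding g_def
        by (rule has_field_derivative_at_within) (auto intro!: derivative_eq_intros smooth_DERIV sj)
      have "norm (u *\<^sub>R axis j 1 + v *\<^sub>R (axis i 1 :: 'n rvec)) \<le> \<bar>u\<bar> + \<bar>v\<bar>"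
        by (rule order_trans[OF norm_triangle_ineq]) (simp add: norm_axis_1)
      also have "\<dots> < d" using that v by auto
      finally have "norm (((x + u *\<^sub>R axis j 1) + v *\<^sub>R axis i 1) - x) < d" by (simp add: add.assoc)
      from d(2)[OF this] show "norm (partial_deriv i (partial_deriv j f) (x + u *\<^sub>R axis j 1 + v *\<^sub>R axis i 1) - ?c) \<le> e"
        by simp
    qed auto
    then show ?thesis by (simp add: g_def algebra_simps)
  qed
  have "\<bar>f (x + s *\<^sub>R axis i 1 + t *\<^sub>R axis j 1) - f (x + s *\<^sub>R axis i 1) - f (x + t *\<^sub>R axis j 1) + f x - s * t * ?c\<bar> \<le> e * \<bar>s\<bar> * \<bar>t\<bar>"
    if "\<bar>s\<bar> < d/2" "\<bar>t\<bar> < d/2" for s t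
  proof -
    define g where "g v = f (x + s *\<^sub>R axis i 1 + v *\<^sub>R axis j 1) - f (x + v *\<^sub>R axis j 1) - s * v * ?c" for v
    have "norm (g t - g 0) \<le> (e * \<bar>s\<bar>) * norm (t - 0)"
    proof (rule field_differentiable_bound[of "cball 0 \<bar>t\<bar>"])
      fix v :: real assume v: "v \<in> cball 0 \<bar>t\<bar>"
      show "(g has_field_derivative partial_deriv j f (x + s *\<^sub>R axis i 1 + v *\<^sub>R axis j 1)
          - partial_deriv j f (x + v *\<^sub>R axis j 1) - s * ?c) (at v within cball 0 \<bar>t\<bar>)"
        unfolding g_def
        by (rule has_field_derivative_at_within) (auto intro!: derivative_eq_intros smooth_DERIV f)
      show "norm (partial_deriv j f (x + s *\<^sub>R axis i 1 + v *\<^sub>R axis j 1)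
          - partial_deriv j f (x + v *\<^sub>R axis j 1) - s * ?c) \<le> e * \<bar>s\<bar>"
        using A[of s v] that v by simp
    qed auto
    then show ?thesis by (simp add: g_def algebra_simps)
  qed
  then show ?thesis using d(1) by (intro exI[of _ "d/2"]) auto
qed

lemma partial_deriv_commute:
  assumes f: "smooth f"
  shows "partial_deriv i (partial_deriv j f) = partial_deriv j (partial_deriv i f)"
proof
  fix x
  let ?a = "partial_deriv i (partial_deriv j f) x" and ?b = "partial_deriv j (partial_deriv i f) x"
  have "\<bar>?a - ?b\<bar> \<le> 2 * e" if e: "e > 0" for e
  proof -
    obtain d where d: "d > 0" "\<And>s t. \<bar>s\<bar> < d \<and> \<bar>t\<bar> < d \<Longrightarrow>
      \<bar>f (x + s *\<^sub>R axis i 1 + t *\<^sub>R axis j 1) - f (x + s *\<^sub>R axis i 1) - f (x + t *\<^sub>R axis j 1) + f x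
        - s * t * ?a\<bar> \<le> e * \<bar>s\<bar> * \<bar>t\<bar>" using second_difference[OF f e, of x i j] by blast
    obtain d' where d': "d' > 0" "\<And>s t. \<bar>s\<bar> < d' \<and> \<bar>t\<bar> < d' \<Longrightarrow>
      \<bar>f (x + s *\<^sub>R axis j 1 + t *\<^sub>R axis i 1) - f (x + s *\<^sub>R axis j 1) - f (x + t *\<^sub>R axis i 1) + f x
        - s * t * ?b\<bar> \<le> e * \<bar>s\<bar> * \<bar>t\<bar>" using second_difference[OF f e, of x j i] by blast
    define s where "s = min d d' / 2"
    have s: "s > 0" "\<bar>s\<bar> < d" "\<bar>s\<bar> < d'" using d(1) d'(1) by (auto simp: s_def)
    have eq: "x + s *\<^sub>R axis j 1 + s *\<^sub>R axis i 1 = x + s *\<^sub>R axis i 1 + s *\<^sub>R axis j 1"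
      by (simp add: add_ac)
    have "\<bar>s * s * ?a - s * s * ?b\<bar> \<le> 2 * (e * \<bar>s\<bar> * \<bar>s\<bar>)"
      using d(2)[of s s] d'(2)[of s s] s unfolding eq by linarith
    then have "s * s * \<bar>?a - ?b\<bar> \<le> s * s * (2 * e)"
      using s(1) by (simp add: abs_mult mult_ac flip: right_diff_distrib)
    then show ?thesis using s(1) by simp
  qed
  from this[of "\<bar>?a - ?b\<bar> / 4"] show "?a = ?b" by (cases "?a = ?b") auto
qed

lemma pds_move:
  assumes "smooth f" shows "pds (xs @ j # ys) f = pds (j # xs @ ys) f"
proof (induction xs)
  case (Cons a xs)
  have "pds ((a # xs) @ j # ys) f = partial_deriv a (partial_deriv j (pds (xs @ ys) f))"
    using Cons by simp
  also have "\<dots> = partial_deriv j (partial_deriv a (pds (xs @ ys) f))"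
    by (rule partial_deriv_commute) (rule smooth_pds[OF assms])
  finally show ?case by simp
qed simp

lemma pds_mset:
  assumes "smooth f" shows "mset js = mset js' \<Longrightarrow> pds js f = pds js' f"
proof (induction js arbitrary: js')
  case (Cons j js)
  then have "j \<in> set js'" by (metis list.set_intros(1) set_mset_mset)
  then obtain xs ys where js': "js' = xs @ j # ys" by (meson split_list)
  with Cons have "pds js f = pds (xs @ ys) f" by (intro Cons.IH) auto
  then show ?case using pds_move[OF assms, of xs j ys] js' by simp
qed simp

definition mi_list :: "'n::{finite,linorder} multi_index \<Rightarrow> 'n list" where
  "mi_list \<alpha> = concat (map (\<lambda>i. replicate (\<alpha> i) i) (sorted_list_of_set UNIV))"

lemma mi_deriv_eq_pds: "mi_deriv \<alpha> f = pds (mi_list \<alpha>) f"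
proof -
  have r: "foldr partial_deriv (replicate m i) h = (partial_deriv i ^^ m) h" for m and i :: 'a and h
    by (induction m) auto
  have "foldr (\<lambda>i. partial_deriv i ^^ \<alpha> i) L f = foldr partial_deriv (concat (map (\<lambda>i. replicate (\<alpha> i) i) L)) f" for L
    by (induction L) (auto simp: r)
  then show ?thesis unfolding mi_deriv_def mi_list_def by simp
qed

lemma count_mi_list: "count_list (mi_list \<alpha>) i = \<alpha> i"
proof -
  have r: "count_list (replicate m k) i = (if k = i then m else 0)" for m and k i :: 'a
    by (induction m) auto
  have "count_list (concat (map (\<lambda>i. replicate (\<alpha> i) i) L)) i = (if i \<in> set L then \<alpha> i else 0)" if "distinct L" for L
    using that by (induction L) (auto simp: r)
  from this[of "sorted_list_of_set UNIV"] show ?thesis unfolding mi_list_def by simp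
qed

lemma mi_order_count_list: "mi_order (count_list js) = length js"
proof -
  have "(\<Sum>i\<in>UNIV. count_list js i) = (\<Sum>i\<in>set js. count_list js i)"
    by (rule sum.mono_neutral_right) (auto simp: count_list_0_iff)
  then show ?thesis unfolding mi_order_def by (simp add: sum_count_set)
qed

lemma count_list_mi_list: "count_list (mi_list \<alpha>) = \<alpha>"
  by (auto simp: count_mi_list)

lemma length_mi_list: "length (mi_list \<alpha>) = mi_order \<alpha>"
  using mi_order_count_list[of "mi_list \<alpha>"] by (simp add: count_list_mi_list)

lemma pds_eq_mi_deriv:
  assumes "smooth f" shows "pds js f = mi_deriv (count_list js) f"
  unfolding mi_deriv_eq_pds
  by (rule pds_mset[OF assms], rule multiset_eqI) (simp add: count_mset count_mi_list)

section \<open>Convolution with test functions\<close>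

lemma dominated_convergence_at:
  fixes F :: "'b::first_countable_topology \<Rightarrow> 'a \<Rightarrow> real"
  assumes "\<And>t. t \<in> S \<Longrightarrow> F t \<in> borel_measurable M" "F0 \<in> borel_measurable M"
    and "integrable M G"
    and "\<And>t. t \<in> S \<Longrightarrow> AE y in M. \<bar>F t y\<bar> \<le> G y"
    and "AE y in M. ((\<lambda>t. F t y) \<longlongrightarrow> F0 y) (at a within S)"
  shows "((\<lambda>t. \<integral>y. F t y \<partial>M) \<longlongrightarrow> (\<integral>y. F0 y \<partial>M)) (at a within S)"
  unfolding tendsto_at_iff_sequentially
proof (intro allI impI)
  fix X :: "nat \<Rightarrow> 'b" assume X: "\<forall>i. X i \<in> S - {a}" "X \<longlonglongrightarrow> a"
  have "(\<lambda>i. \<integral>y. F (X i) y \<partial>M) \<longlonglongrightarrow> (\<integral>y. F0 y \<partial>M)"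
  proof (rule integral_dominated_convergence[where w=G])
    show "AE y in M. (\<lambda>i. F (X i) y) \<longlonglongrightarrow> F0 y"
      using assms(5)
    proof eventually_elim
      case (elim y)
      then show ?case using X unfolding tendsto_at_iff_sequentially o_def by blast
    qed
  qed (use assms X in auto)
  then show "((\<lambda>t. \<integral>y. F t y \<partial>M) \<circ> X) \<longlonglongrightarrow> (\<integral>y. F0 y \<partial>M)" by (simp add: o_def)
qed

text \<open>Local integrability for Borel functions on the whole space, with balls about the origin in
  place of arbitrary compact sets.\<close>
definition loc_int :: "('n::finite rvec \<Rightarrow> real) \<Rightarrow> bool" where
  "loc_int f \<longleftrightarrow> f \<in> borel_measurable borel \<and> (\<forall>R. set_integrable lborel (cball 0 R) f)"

lemma loc_int_const: "loc_int (\<lambda>x. c)"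
  by (auto simp: loc_int_def set_integrable_def emeasure_lborel_cball_finite[unfolded infinity_ennreal_def]
      intro!: integrable_mult_left integrable_real_indicator)

lemma loc_int_mult_bounded:
  assumes "loc_int f" "\<zeta> \<in> borel_measurable borel" "\<And>x. \<bar>\<zeta> x\<bar> \<le> B" "\<And>x. norm x > R \<Longrightarrow> \<zeta> x = 0"
  shows "integrable lborel (\<lambda>y. f y * \<zeta> y)"
proof (rule Bochner_Integration.integrable_bound)
  show "integrable lborel (\<lambda>y. B * (indicator (cball 0 R) y *\<^sub>R f y))"
    using assms(1) by (auto simp: loc_int_def set_integrable_def)
  have [measurable]: "f \<in> borel_measurable borel" using assms by (simp add: loc_int_def)
  show "(\<lambda>y. f y * \<zeta> y) \<in> borel_measurable lborel" using assms(2) by measurable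
  have "B \<ge> 0" using assms(3)[of 0] by linarith
  have "norm (f y * \<zeta> y) \<le> norm (B * (indicator (cball 0 R) y *\<^sub>R f y))" for y
  proof (cases "norm y \<le> R")
    case True
    have "\<bar>f y\<bar> * \<bar>\<zeta> y\<bar> \<le> \<bar>f y\<bar> * B" using assms(3) by (intro mult_left_mono) auto
    then show ?thesis using True \<open>B \<ge> 0\<close> by (simp add: abs_mult mult.commute)
  qed (use assms(4) in auto)
  then show "AE y in lborel. norm (f y * \<zeta> y) \<le> norm (B * (indicator (cball 0 R) y *\<^sub>R f y))"
    by simp
qed

lemma test_function_bounds:
  assumes "test_function U K"
  obtains B R where "B \<ge> 0" "R \<ge> 0" "\<And>x. \<bar>pds js K x\<bar> \<le> B" "\<And>x. norm x > R \<Longrightarrow> pds js K x = 0"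
proof -
  have K: "smooth K" "compact (supp K)" using assms by (auto simp: test_function_def)
  have c: "continuous_on UNIV (pds js K)" using smooth_continuous smooth_pds K(1) by blast
  have "bounded (pds js K ` supp K)"
    using K(2) c by (intro compact_imp_bounded compact_continuous_image) (auto intro: continuous_on_subset)
  then obtain B where B: "\<And>x. x \<in> supp K \<Longrightarrow> \<bar>pds js K x\<bar> \<le> B" "B > 0"
    unfolding bounded_pos by auto
  obtain R where R: "\<And>x. x \<in> supp K \<Longrightarrow> norm x \<le> R" "R > 0"
    using compact_imp_bounded[OF K(2)] unfolding bounded_pos by auto
  show ?thesis
  proof (rule that[of B R])
    show "\<bar>pds js K x\<bar> \<le> B" for x using B pds_outside_supp[of x K js] by (cases "x \<in> supp K") auto
    show "pds js K x = 0" if "norm x > R" for x using R that pds_outside_supp[of x K js] by force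
  qed (use B R in auto)
qed

lemma test_function_pds: "test_function U K \<Longrightarrow> test_function U (pds js K)"
  using supp_pds[of js K] unfolding test_function_def
  by (auto simp: smooth_pds supp_def compact_eq_bounded_closed intro: bounded_subset)

lemma test_function_measurable: "test_function U K \<Longrightarrow> K \<in> borel_measurable borel"
  unfolding test_function_def by (auto intro: borel_measurable_continuous_onI smooth_continuous)

lemma smooth_measurable: "smooth K \<Longrightarrow> K \<in> borel_measurable borel"
  by (auto intro: borel_measurable_continuous_onI smooth_continuous)

definition conv :: "('n::finite rvec \<Rightarrow> real) \<Rightarrow> ('n rvec \<Rightarrow> real) \<Rightarrow> 'n rvec \<Rightarrow> real" where
  "conv K f x = (\<integral>y. f y * K (x - y) \<partial>lborel)"

lemma conv_continuous:
  fixes f K :: "'n::finite rvec \<Rightarrow> real"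
  assumes f: "loc_int f" and K: "test_function U K"
  shows "continuous_on UNIV (conv K f)"
  unfolding continuous_on_def
proof
  fix x :: "'n rvec"
  obtain B R where B: "B \<ge> 0" "\<And>x. \<bar>K x\<bar> \<le> B" and R: "\<And>x. norm x > R \<Longrightarrow> K x = 0"
    using test_function_bounds[OF K, of "[]"] by (metis foldr.simps(1) id_apply)
  have [measurable]: "f \<in> borel_measurable borel" "K \<in> borel_measurable borel"
    using f K test_function_measurable by (auto simp: loc_int_def)
  have cK: "continuous_on UNIV K" using K smooth_continuous by (auto simp: test_function_def)
  have "(conv K f \<longlongrightarrow> conv K f x) (at x within ball x 1)"
    unfolding conv_def
  proof (rule dominated_convergence_at[where G="\<lambda>y. \<bar>f y * (B * indicator (cball 0 (norm x + 1 + R)) y)\<bar>"])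
    show "integrable lborel (\<lambda>y. \<bar>f y * (B * indicator (cball 0 (norm x + 1 + R)) y)\<bar>)"
      by (intro integrable_abs loc_int_mult_bounded[OF f, where B=B and R="norm x + 1 + R"])
         (use B(1) in \<open>auto simp: indicator_def\<close>)
    fix t assume t: "t \<in> ball x 1"
    have "\<bar>f y * K (t - y)\<bar> \<le> \<bar>f y * (B * indicator (cball 0 (norm x + 1 + R)) y)\<bar>" for y
    proof (cases "norm y \<le> norm x + 1 + R")
      case True
      then show ?thesis using B by (auto simp: abs_mult intro!: mult_left_mono)
    next
      case False
      have "norm y \<le> norm (t - y) + norm (t - x) + norm x"
        using norm_triangle_ineq4[of x "x - y"] norm_triangle_ineq4[of "t - y" "t - x"] by simp
      then have "norm (t - y) > R" using False t by (auto simp: dist_norm norm_minus_commute)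
      then show ?thesis using R by simp
    qed
    then show "AE y in lborel. \<bar>f y * K (t - y)\<bar> \<le> \<bar>f y * (B * indicator (cball 0 (norm x + 1 + R)) y)\<bar>" by simp
  next
    have "((\<lambda>t. f y * K (t - y)) \<longlongrightarrow> f y * K (x - y)) (at x within ball x 1)" for y
      by (intro tendsto_intros continuous_on_tendsto_compose[OF cK]) auto
    then show "AE y in lborel. ((\<lambda>t. f y * K (t - y)) \<longlongrightarrow> f y * K (x - y)) (at x within ball x 1)" by simp
  qed auto
  then show "(conv K f \<longlongrightarrow> conv K f x) (at x within UNIV)"
    by (simp add: at_within_open[of x "ball x 1"])
qed

lemma conv_DERIV:
  fixes f K :: "'n::finite rvec \<Rightarrow> real"
  assumes f: "loc_int f" and K: "test_function U K"
  shows "((\<lambda>t. conv K f (x + t *\<^sub>R axis i 1)) has_real_derivative conv (partial_deriv i K) f x) (at 0)"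
proof -
  obtain B' R where R: "\<And>x. norm x > R \<Longrightarrow> K x = 0" and B': "\<And>x. \<bar>K x\<bar> \<le> B'"
    using test_function_bounds[OF K, of "[]"] by (metis foldr.simps(1) id_apply)
  obtain B where B: "B \<ge> 0" "\<And>x. \<bar>partial_deriv i K x\<bar> \<le> B"
    using test_function_bounds[OF K, of "[i]"] by (metis foldr.simps o_apply id_apply)
  have sK: "smooth K" using K by (auto simp: test_function_def)
  have [measurable]: "f \<in> borel_measurable borel" "K \<in> borel_measurable borel" "partial_deriv i K \<in> borel_measurable borel"
    using f K test_function_measurable smooth_measurable smooth_partial_deriv[OF sK] by (auto simp: loc_int_def)
  define q where "q t y = (K (x + t *\<^sub>R axis i 1 - y) - K (x - y)) / t" for t :: real and y :: "'n rvec"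
  have int: "integrable lborel (\<lambda>y. f y * K (x - y))" for x
  proof (rule loc_int_mult_bounded[OF f, where B=B' and R="norm x + R"])
    fix y :: "'n rvec" assume "norm x + R < norm y"
    then have "norm (x - y) > R" using norm_triangle_ineq3[of y x] by (simp add: norm_minus_commute)
    then show "K (x - y) = 0" using R by simp
  qed (use B' in auto)
  have bound: "\<bar>q t y\<bar> \<le> B" if "t \<noteq> 0" for t :: real and y :: "'n rvec"
  proof -
    have "norm (K ((x - y) + t *\<^sub>R axis i 1) - K ((x - y) + 0 *\<^sub>R axis i 1)) \<le> B * norm (t - 0)"
    proof (rule field_differentiable_bound[of UNIV "\<lambda>t. K ((x - y) + t *\<^sub>R axis i 1)"
          "\<lambda>t. partial_deriv i K ((x - y) + t *\<^sub>R axis i 1)"])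
    qed (use B smooth_DERIV[OF sK] in auto)
    then show ?thesis using that by (simp add: q_def field_simps abs_mult)
  qed
  have "((\<lambda>t. \<integral>y. f y * q t y \<partial>lborel) \<longlongrightarrow> (\<integral>y. f y * partial_deriv i K (x - y) \<partial>lborel)) (at 0 within (ball 0 1 - {0}))"
  proof (rule dominated_convergence_at[where G="\<lambda>y. \<bar>f y * (B * indicator (cball 0 (norm x + 1 + R)) y)\<bar>"])
    show "integrable lborel (\<lambda>y. \<bar>f y * (B * indicator (cball 0 (norm x + 1 + R)) y)\<bar>)"
      by (intro integrable_abs loc_int_mult_bounded[OF f, where B=B and R="norm x + 1 + R"])
         (use B(1) in \<open>auto simp: indicator_def\<close>)
    fix t :: real assume t: "t \<in> ball 0 1 - {0}"
    show "(\<lambda>y. f y * q t y) \<in> borel_measurable lborel" unfolding q_def by measurable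
    have "\<bar>f y * q t y\<bar> \<le> \<bar>f y * (B * indicator (cball 0 (norm x + 1 + R)) y)\<bar>" for y
    proof (cases "norm y \<le> norm x + 1 + R")
      case True
      then show ?thesis using B bound[of t y] t by (auto simp: abs_mult intro!: mult_left_mono)
    next
      case False
      have "norm y \<le> norm (x - y) + norm x"
        using norm_triangle_ineq4[of x "x - y"] by simp
      then have 1: "norm (x - y) > R" using False by auto
      have "norm (x - y) \<le> norm (x + t *\<^sub>R axis i 1 - y) + \<bar>t\<bar>"
        using norm_triangle_ineq4[of "x + t *\<^sub>R axis i 1 - y" "t *\<^sub>R axis i 1"] by (simp add: norm_axis_1)
      then have "norm (x + t *\<^sub>R axis i 1 - y) > R" using False t \<open>norm y \<le> norm (x - y) + norm x\<close>  by (auto simp: dist_norm)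
      then show ?thesis using R 1 by (simp add: q_def)
    qed
    then show "AE y in lborel. \<bar>f y * q t y\<bar> \<le> \<bar>f y * (B * indicator (cball 0 (norm x + 1 + R)) y)\<bar>" by simp
  next
    have "((\<lambda>t. f y * q t y) \<longlongrightarrow> f y * partial_deriv i K (x - y)) (at 0 within (ball 0 1 - {0}))" for y
    proof -
      have "((\<lambda>t. K ((x - y) + t *\<^sub>R axis i 1)) has_real_derivative partial_deriv i K (x - y)) (at 0)"
        by (rule smooth_DERIV0[OF sK])
      then have "((\<lambda>t. q t y) \<longlongrightarrow> partial_deriv i K (x - y)) (at 0)"
        unfolding DERIV_def q_def by (simp add: algebra_simps)
      then show ?thesis by (intro tendsto_intros) (auto intro: tendsto_within_subset)
    qed
    then show "AE y in lborel. ((\<lambda>t. f y * q t y) \<longlongrightarrow> f y * partial_deriv i K (x - y)) (at 0 within (ball 0 1 - {0}))" by simp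
  qed auto
  moreover have "at (0::real) within (ball 0 1 - {0}) = at 0"
    using at_within_open[of 0 "ball 0 (1::real)"] by (simp add: at_within_def)
  moreover have "(\<integral>y. f y * q t y \<partial>lborel) = (conv K f (x + t *\<^sub>R axis i 1) - conv K f x) / t" for t
  proof -
    have "(\<integral>y. f y * q t y \<partial>lborel) = (\<integral>y. (f y * K (x + t *\<^sub>R axis i 1 - y) - f y * K (x - y)) / t \<partial>lborel)"
      by (simp add: q_def algebra_simps diff_divide_distrib)
    also have "\<dots> = (conv K f (x + t *\<^sub>R axis i 1) - conv K f x) / t"
      unfolding conv_def using int by (simp add: Bochner_Integration.integral_diff)
    finally show ?thesis .
  qed
  ultimately show ?thesis unfolding DERIV_def conv_def[symmetric] by simp
qed

lemma smooth_conv: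
  assumes f: "loc_int f" and K: "test_function U K"
  shows "smooth (conv K f)"
proof (rule smooth_coinduct[where P="\<lambda>h. \<exists>K. test_function U K \<and> h = conv K f"])
  fix h assume "\<exists>K. test_function U K \<and> h = conv K f"
  then obtain K where K: "test_function U K" and h: "h = conv K f" by blast
  have "partial_deriv i h = conv (partial_deriv i K) f" for i
    unfolding h by (intro ext partial_derivI conv_DERIV[OF f K])
  moreover have "test_function U (partial_deriv i K)" for i
    using test_function_pds[OF K, of "[i]"] by simp
  ultimately show "continuous_on UNIV h \<and> (\<forall>i. (\<forall>x. (\<lambda>t. h (x + t *\<^sub>R axis i 1)) differentiable at 0) \<and> (\<exists>K. test_function U K \<and> partial_deriv i h = conv K f))"
    using conv_continuous[OF f K] conv_DERIV[OF f K] h real_differentiable_def by blast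
qed (use K in blast)

lemma pds_conv:
  assumes f: "loc_int f" and K: "test_function U K"
  shows "pds js (conv K f) = conv (pds js K) f"
proof (induction js)
  case (Cons j js)
  show ?case
    by (simp add: Cons) (intro ext partial_derivI conv_DERIV[OF f test_function_pds[OF K]])
qed simp

lemma lborel_integral_diag:
  fixes g :: "'n::finite rvec \<Rightarrow> real"
  assumes [measurable]: "g \<in> borel_measurable borel" and c: "\<And>i. c i \<noteq> 0"
  shows "(\<integral>y. g y \<partial>lborel) = (\<Prod>i\<in>UNIV. \<bar>c i\<bar>) * (\<integral>z. g (t + diag_mult c z) \<partial>lborel)"
    and "(\<integral>\<^sup>+y. ennreal (g y) \<partial>lborel) = ennreal (\<Prod>i\<in>UNIV. \<bar>c i\<bar>) * (\<integral>\<^sup>+z. ennreal (g (t + diag_mult c z)) \<partial>lborel)"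
proof -
  define c' :: "'n rvec \<Rightarrow> real" where "c' b = c (axis_index b)" for b
  have inj: "inj (\<lambda>i::'n. axis i (1::real))" by (auto simp: inj_on_def axis_eq_axis)
  have B: "(Basis :: 'n rvec set) = (\<lambda>i. axis i 1) ` UNIV" by (auto simp: Basis_vec_def)
  have c'a: "c' (axis i 1) = c i" for i by (simp add: c'_def axis_index_axis)
  have p: "(\<Prod>j\<in>Basis. \<bar>c' j\<bar>) = (\<Prod>i\<in>UNIV. \<bar>c i\<bar>)"
    unfolding B by (subst prod.reindex) (auto simp: inj c'a)
  have T: "t + (\<Sum>j\<in>Basis. (c' j * (x \<bullet> j)) *\<^sub>R j) = t + diag_mult c x" for x
  proof -
    have "(\<Sum>j\<in>Basis. (c' j * (x \<bullet> j)) *\<^sub>R j) = (\<Sum>i\<in>UNIV. (c i * x $ i) *\<^sub>R axis i 1)"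
      unfolding B by (subst sum.reindex) (auto simp: inj c'a inner_axis)
    then show ?thesis
      by (auto simp: diag_mult_def vec_eq_iff axis_def if_distrib sum.If_cases cong: if_cong)
  qed
  have c0: "c' j \<noteq> 0" for j using c by (simp add: c'_def)
  have eq: "lborel = density (distr lborel borel (\<lambda>x. t + diag_mult c x)) (\<lambda>_. (\<Prod>i\<in>UNIV. \<bar>c i\<bar>))"
    using lborel_affine_euclidean[of c' t] c0 unfolding T p by auto
  have [measurable]: "(\<lambda>x. t + diag_mult c x) \<in> borel_measurable borel"
    by (intro borel_measurable_continuous_onI continuous_intros linear_continuous_on bounded_linear_diag_mult)
  have p0: "(\<Prod>i\<in>UNIV. \<bar>c i\<bar>) \<ge> 0" by (intro prod_nonneg) auto
  show "(\<integral>y. g y \<partial>lborel) = (\<Prod>i\<in>UNIV. \<bar>c i\<bar>) * (\<integral>z. g (t + diag_mult c z) \<partial>lborel)"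
    by (subst eq, subst integral_density) (auto simp: p0 integral_distr)
  show "(\<integral>\<^sup>+y. ennreal (g y) \<partial>lborel) = ennreal (\<Prod>i\<in>UNIV. \<bar>c i\<bar>) * (\<integral>\<^sup>+z. ennreal (g (t + diag_mult c z)) \<partial>lborel)"
    by (subst eq, subst nn_integral_density) (auto simp: p0 nn_integral_distr nn_integral_cmult)
qed

lemma lborel_integral_reflect:
  fixes g :: "'n::finite rvec \<Rightarrow> real"
  assumes [measurable]: "g \<in> borel_measurable borel"
  shows "(\<integral>y. g y \<partial>lborel) = (\<integral>z. g (t - z) \<partial>lborel)"
proof -
  have "diag_mult (\<lambda>_. -1) z = - z" for z :: "'n rvec" by (simp add: diag_mult_def vec_eq_iff)
  then show ?thesis using lborel_integral_diag(1)[OF assms, of "\<lambda>_. -1" t] by simp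
qed

text \<open>The convolution of \<open>K\<close> with the constant 1 is constant, and its derivative is the convolution
  of the derivative of \<open>K\<close> with 1.\<close>
lemma integral_pds_eq_0:
  fixes K :: "'n::finite rvec \<Rightarrow> real"
  assumes K: "test_function U K"
  shows "(\<integral>x. partial_deriv i K x \<partial>lborel) = 0"
proof -
  have "loc_int (\<lambda>x::'n rvec. 1::real)"
    by (rule loc_int_const)
  note conv_DERIV[OF this K, of 0 i]
  moreover have [measurable]: "K \<in> borel_measurable borel" "partial_deriv i K \<in> borel_measurable borel"
    using test_function_measurable[OF K] test_function_measurable[OF test_function_pds[OF K, of "[i]"]] by auto
  have "conv K (\<lambda>x. 1) x = (\<integral>y. K y \<partial>lborel)" for x
    using lborel_integral_reflect[of K x] by (simp add: conv_def)
  ultimately have "((\<lambda>t. (\<integral>y. K y \<partial>lborel)) has_real_derivative conv (partial_deriv i K) (\<lambda>x. 1) 0) (at 0)"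
    by simp
  then have "conv (partial_deriv i K) (\<lambda>x. 1) 0 = 0" using DERIV_unique DERIV_const by blast
  then show ?thesis using lborel_integral_reflect[of "partial_deriv i K" 0] by (simp add: conv_def)
qed

lemma test_function_mult:
  assumes "smooth F" "test_function U \<eta>"
  shows "test_function U (\<lambda>x. F x * \<eta> x)"
proof -
  have "supp (\<lambda>x. F x * \<eta> x) \<subseteq> supp \<eta>" unfolding supp_def by (intro closure_mono) auto
  then show ?thesis using assms unfolding test_function_def
    by (auto simp: smooth_mult supp_def compact_eq_bounded_closed intro: bounded_subset)
qed

lemma test_function_integrable:
  assumes "test_function U \<eta>" shows "integrable lborel \<eta>"
proof -
  have "loc_int (\<lambda>x::'a rvec. 1::real)"
    by (rule loc_int_const)
  moreover obtain B R where "\<And>x. \<bar>\<eta> x\<bar> \<le> B" "\<And>x. norm x > R \<Longrightarrow> \<eta> x = 0"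
    using test_function_bounds[OF assms, of "[]"] by (metis foldr.simps(1) id_apply)
  ultimately have "integrable lborel (\<lambda>y. 1 * \<eta> y)"
    by (intro loc_int_mult_bounded) (auto simp: test_function_measurable[OF assms])
  then show ?thesis by simp
qed

lemma integration_by_parts:
  assumes "smooth F" "test_function U \<eta>"
  shows "(\<integral>x. F x * pds js \<eta> x \<partial>lborel) = (-1) ^ length js * (\<integral>x. pds js F x * \<eta> x \<partial>lborel)"
  using assms
proof (induction js arbitrary: F)
  case (Cons j js)
  have t: "test_function U (pds js \<eta>)" by (rule test_function_pds[OF Cons.prems(2)])
  have s: "smooth (pds js \<eta>)" using t by (simp add: test_function_def)
  have "partial_deriv j (\<lambda>x. F x * pds js \<eta> x) = (\<lambda>x. F x * partial_deriv j (pds js \<eta>) x + partial_deriv j F x * pds js \<eta> x)"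
    by (intro ext partial_derivI DERIV_cong[OF DERIV_mult[OF smooth_DERIV0[OF Cons.prems(1)] smooth_DERIV0[OF s]]]) simp
  moreover have "(\<integral>x. partial_deriv j (\<lambda>x. F x * pds js \<eta> x) x \<partial>lborel) = 0"
    by (rule integral_pds_eq_0[OF test_function_mult[OF Cons.prems(1) t]])
  moreover have "integrable lborel (\<lambda>x. F x * partial_deriv j (pds js \<eta>) x)"
    using test_function_integrable[OF test_function_mult[OF Cons.prems(1) test_function_pds[OF t, of "[j]"]]] by simp
  moreover have "integrable lborel (\<lambda>x. partial_deriv j F x * pds js \<eta> x)"
    by (rule test_function_integrable[OF test_function_mult[OF smooth_partial_deriv[OF Cons.prems(1)] t]])
  ultimately have "(\<integral>x. F x * partial_deriv j (pds js \<eta>) x \<partial>lborel) = - (\<integral>x. partial_deriv j F x * pds js \<eta> x \<partial>lborel)"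
    by simp
  also have "\<dots> = - ((-1) ^ length js * (\<integral>x. pds js (partial_deriv j F) x * \<eta> x \<partial>lborel))"
    using Cons.IH[OF smooth_partial_deriv[OF Cons.prems(1)]] Cons.prems(2) by simp
  also have "pds js (partial_deriv j F) = pds (j # js) F"
    using pds_move[OF Cons.prems(1), of js j "[]"] by simp
  finally show ?case by simp
qed simp

text \<open>A version of Jensen's inequality with a crude constant. It follows from
  \<open>u \<le> a + a\<^bsup>1-p\<^esup> u\<^sup>p\<close> for a suitable level \<open>a\<close>, and it holds for non-integrable \<open>u w\<close> as well, since
  the integral is then 0.\<close>
lemma power_integral_le:
  fixes u w :: "'a \<Rightarrow> real"
  assumes [measurable]: "u \<in> borel_measurable M" "w \<in> borel_measurable M"
    and "1 \<le> p" "1 \<le> W" "(\<integral>\<^sup>+x. ennreal \<bar>w x\<bar> \<partial>M) \<le> ennreal W"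
  shows "ennreal (\<bar>\<integral>x. u x * w x \<partial>M\<bar> powr p) \<le> ennreal ((2 * W) powr p) * (\<integral>\<^sup>+x. ennreal (\<bar>u x\<bar> powr p * \<bar>w x\<bar>) \<partial>M)"
proof (cases "integrable M (\<lambda>x. u x * w x)")
  case int: True
  define I where "I = (\<integral>\<^sup>+x. ennreal (\<bar>u x\<bar> powr p * \<bar>w x\<bar>) \<partial>M)"
  consider "I = \<infinity>" | "I = 0" | "0 < I" "I < \<infinity>"
    using less_top not_gr_zero by (metis infinity_ennreal_def)
  then show ?thesis
  proof cases
    case 1
    have "(2 * W) powr p > 0" using assms by simp
    then show ?thesis using 1 unfolding I_def by (simp add: ennreal_mult_top)
  next
    case 2
    then have "AE x in M. ennreal (\<bar>u x\<bar> powr p * \<bar>w x\<bar>) = 0"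
      unfolding I_def by (subst (asm) nn_integral_0_iff_AE) auto
    then have "AE x in M. u x * w x = 0"
      by eventually_elim (auto simp: ennreal_eq_0_iff mult_le_0_iff)
    then have "(\<integral>x. u x * w x \<partial>M) = (\<integral>x. 0 \<partial>M)" by (intro integral_cong_AE) auto
    then show ?thesis by simp
  next
    case 3
    then obtain J where J: "I = ennreal J" "J > 0"
      by (cases I) (auto simp: ennreal_less_iff)
    \<comment> \<open>the level at which both terms of the pointwise bound have the same size\<close>
    define a where "a = J powr (1/p)"
    have a: "a > 0" "a powr p = J" using J assms by (auto simp: a_def powr_powr)
    have pt: "\<bar>u x * w x\<bar> \<le> a * \<bar>w x\<bar> + a powr (1 - p) * (\<bar>u x\<bar> powr p * \<bar>w x\<bar>)" for x
    proof (cases "\<bar>u x\<bar> \<le> a")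
      case True
      then have "\<bar>u x\<bar> * \<bar>w x\<bar> \<le> a * \<bar>w x\<bar>" by (intro mult_right_mono) auto
      then show ?thesis by (simp add: abs_mult add_increasing2)
    next
      case False
      then have "a powr (p - 1) \<le> \<bar>u x\<bar> powr (p - 1)"
        using a assms by (intro powr_mono2) auto
      moreover have "a powr (1 - p) * a powr (p - 1) = 1"
        using a by (simp add: powr_add[symmetric])
      ultimately have "1 \<le> a powr (1 - p) * \<bar>u x\<bar> powr (p - 1)"
        by (metis mult_left_mono powr_ge_zero)
      then have "\<bar>u x\<bar> * 1 \<le> \<bar>u x\<bar> * (a powr (1 - p) * \<bar>u x\<bar> powr (p - 1))"
        by (intro mult_left_mono) auto
      also have "\<dots> = a powr (1 - p) * \<bar>u x\<bar> powr p"
        using False a by (simp add: powr_diff field_simps)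
      finally have "\<bar>u x\<bar> * \<bar>w x\<bar> \<le> a powr (1 - p) * \<bar>u x\<bar> powr p * \<bar>w x\<bar>"
        by (intro mult_right_mono) auto
      then show ?thesis using a by (simp add: abs_mult add_increasing mult_ac)
    qed
    have "ennreal \<bar>\<integral>x. u x * w x \<partial>M\<bar> \<le> (\<integral>\<^sup>+x. ennreal \<bar>u x * w x\<bar> \<partial>M)"
      using integral_norm_bound_ennreal[OF int] by simp
    also have "\<dots> \<le> (\<integral>\<^sup>+x. ennreal a * ennreal \<bar>w x\<bar> + ennreal (a powr (1 - p)) * ennreal (\<bar>u x\<bar> powr p * \<bar>w x\<bar>) \<partial>M)"
    proof (rule nn_integral_mono)
      fix x
      have "ennreal a * ennreal \<bar>w x\<bar> + ennreal (a powr (1 - p)) * ennreal (\<bar>u x\<bar> powr p * \<bar>w x\<bar>)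
        = ennreal (a * \<bar>w x\<bar> + a powr (1 - p) * (\<bar>u x\<bar> powr p * \<bar>w x\<bar>))"
        using a by (simp add: ennreal_mult[symmetric] ennreal_plus[symmetric] del: ennreal_plus)
      then show "ennreal \<bar>u x * w x\<bar> \<le> ennreal a * ennreal \<bar>w x\<bar> + ennreal (a powr (1 - p)) * ennreal (\<bar>u x\<bar> powr p * \<bar>w x\<bar>)"
        using pt[of x] by (simp add: ennreal_leI)
    qed
    also have "\<dots> = ennreal a * (\<integral>\<^sup>+x. ennreal \<bar>w x\<bar> \<partial>M) + ennreal (a powr (1 - p)) * I"
      unfolding I_def by (simp add: nn_integral_add nn_integral_cmult)
    also have "\<dots> \<le> ennreal a * ennreal W + ennreal (a powr (1 - p)) * ennreal J"
      using assms(5) J by (intro add_mono mult_left_mono) auto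
    also have "\<dots> = ennreal (a * W + a powr (1 - p) * J)"
      using a assms J by (simp add: ennreal_mult[symmetric] ennreal_plus[symmetric] del: ennreal_plus)
    also have "a powr (1 - p) * J = a"
      using a by (simp add: a(2)[symmetric] powr_add[symmetric])
    finally have "\<bar>\<integral>x. u x * w x \<partial>M\<bar> \<le> a * W + a" using a assms by (subst (asm) ennreal_le_iff) auto
    also have "\<dots> \<le> 2 * W * a" using a assms by (simp add: algebra_simps)
    finally have "\<bar>\<integral>x. u x * w x \<partial>M\<bar> powr p \<le> (2 * W * a) powr p"
      using assms by (intro powr_mono2) auto
    also have "\<dots> = (2 * W) powr p * J" using a assms by (simp add: powr_mult)
    finally show ?thesis unfolding I_def[symmetric] J(1)
      using J by (simp add: ennreal_mult[symmetric] ennreal_leI)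
  qed
qed (simp add: not_integrable_integral_eq)

section \<open>Anisotropic mollification\<close>

text \<open>Only the last coordinate is stretched; with \<open>A = 16 (M + 1)\<close> the shift of the extension operator at
  scale \<open>2\<^sup>-\<^sup>k\<close> is \<open>2\<^sup>-\<^sup>k\<close> times this map.\<close>
definition stretch :: "real \<Rightarrow> 'n::{finite,linorder} rvec \<Rightarrow> 'n rvec" where
  "stretch A = diag_mult (\<lambda>i. if i = last_ix then A else 1)"

lemma linear_stretch: "linear (stretch A)"
  unfolding stretch_def by (rule linear_diag_mult)

lemma stretch_continuous [continuous_intros]:
  "continuous_on S f \<Longrightarrow> continuous_on S (\<lambda>x. stretch A (f x))"
  by (rule continuous_on_compose2[of UNIV "stretch A"])
    (auto intro!: linear_continuous_on linear_stretch[THEN linear_conv_bounded_linear[THEN iffD1]])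

lemma stretch_measurable [measurable]: "stretch A \<in> borel_measurable borel"
  by (intro borel_measurable_continuous_onI stretch_continuous continuous_on_id)

lemma norm_stretch_le: "A \<ge> 0 \<Longrightarrow> norm (stretch A z) \<le> (1 + A) * norm z"
proof -
  assume A: "A \<ge> 0"
  have "norm (stretch A z) \<le> norm ((1 + A) *\<^sub>R z)"
  proof (rule norm_le_componentwise_cart)
    fix i
    have "A * \<bar>z $ i\<bar> \<le> (1 + A) * \<bar>z $ i\<bar>" "1 * \<bar>z $ i\<bar> \<le> (1 + A) * \<bar>z $ i\<bar>"
      using A by (intro mult_right_mono; simp)+
    then show "norm (stretch A z $ i) \<le> norm (((1 + A) *\<^sub>R z) $ i)"
      using A by (auto simp: stretch_def diag_mult_def abs_mult)
  qed
  then show ?thesis using A by simp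
qed

definition av :: "('n::{finite,linorder} rvec \<Rightarrow> real) \<Rightarrow> real \<Rightarrow> real \<Rightarrow> ('n rvec \<Rightarrow> real) \<Rightarrow> 'n rvec \<Rightarrow> real" where
  "av \<omega> A s f x = (\<integral>z. f (x - s *\<^sub>R stretch A z) * \<omega> z \<partial>lborel)"

text \<open>The kernel of \<open>av\<close> as a convolution operator: \<open>\<omega>\<close> composed with the inverse of the scaled stretch,
  divided by its determinant.\<close>
definition kern :: "('n::{finite,linorder} rvec \<Rightarrow> real) \<Rightarrow> real \<Rightarrow> real \<Rightarrow> 'n rvec \<Rightarrow> real" where
  "kern \<omega> A s x = inverse (\<Prod>i::'n\<in>UNIV. \<bar>s * (if i = last_ix then A else 1)\<bar>) *
     \<omega> (0 + diag_mult (\<lambda>i. inverse (s * (if i = last_ix then A else 1))) x)"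

lemma kern_stretch:
  fixes \<omega> :: "'n::{finite,linorder} rvec \<Rightarrow> real"
  assumes "s > 0" "A > 0"
  shows "kern \<omega> A s (s *\<^sub>R stretch A z) = inverse (\<Prod>i::'n\<in>UNIV. \<bar>s * (if i = last_ix then A else 1)\<bar>) * \<omega> z"
proof -
  have "diag_mult (\<lambda>i. inverse (s * (if i = last_ix then A else 1))) (s *\<^sub>R stretch A z) = z"
    using assms by (auto simp: stretch_def diag_mult_def vec_eq_iff field_simps)
  then show ?thesis by (simp add: kern_def)
qed

lemma kern_nonzero:
  assumes "s > 0" "A > 0" "kern \<omega> A s x \<noteq> 0"
  obtains z where "\<omega> z \<noteq> 0" "x = s *\<^sub>R stretch A z"
proof
  let ?z = "diag_mult (\<lambda>i. inverse (s * (if i = last_ix then A else 1))) x"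
  show "\<omega> ?z \<noteq> 0" using assms(3) by (auto simp: kern_def)
  show "x = s *\<^sub>R stretch A ?z"
    using assms by (auto simp: stretch_def diag_mult_def vec_eq_iff field_simps)
qed

lemma test_functionI:
  assumes "smooth K" "\<And>x. K x \<noteq> 0 \<Longrightarrow> x \<in> C" "compact C" "C \<subseteq> U"
  shows "test_function U K"
proof -
  have "supp K \<subseteq> C" unfolding supp_def
    using assms by (intro closure_minimal) (auto simp: compact_imp_closed)
  moreover have "compact (supp K)"
    using compact_Int_closed[OF assms(3), of "supp K"] \<open>supp K \<subseteq> C\<close> by (simp add: supp_def inf.absorb2)
  ultimately show ?thesis using assms unfolding test_function_def by blast
qed

lemma in_suppI: "f x \<noteq> 0 \<Longrightarrow> x \<in> supp f"
  using closure_subset[of "{x. f x \<noteq> 0}"] by (auto simp: supp_def)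

lemma compact_affine_stretch:
  assumes "compact C" shows "compact ((\<lambda>z. a + s *\<^sub>R stretch A z) ` C)"
  using assms by (intro compact_continuous_image continuous_intros)

lemma test_function_kern:
  assumes w: "test_function UNIV \<omega>" and "s > 0" "A > 0"
  shows "test_function UNIV (kern \<omega> A s)"
proof (rule test_functionI)
  show "smooth (kern \<omega> A s)" unfolding kern_def
    using w by (intro smooth_affine) (auto simp: test_function_def)
  show "compact ((\<lambda>z. 0 + s *\<^sub>R stretch A z) ` supp \<omega>)"
    using w by (intro compact_affine_stretch) (auto simp: test_function_def)
  show "x \<in> (\<lambda>z. 0 + s *\<^sub>R stretch A z) ` supp \<omega>" if nz: "kern \<omega> A s x \<noteq> 0" for x
  proof -
    obtain z where "\<omega> z \<noteq> 0" "x = s *\<^sub>R stretch A z"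
      using kern_nonzero[OF assms(2,3) nz] .
    then show ?thesis using in_suppI[of \<omega> z] by auto
  qed
qed auto

lemma kern_subst:
  fixes g :: "'n::{finite,linorder} rvec \<Rightarrow> real"
  assumes "s > 0" "A > 0" "g \<in> borel_measurable borel" and w: "\<omega> \<in> borel_measurable borel"
  shows "(\<integral>y. g y * kern \<omega> A s (x - y) \<partial>lborel) = (\<integral>z. g (x - s *\<^sub>R stretch A z) * \<omega> z \<partial>lborel)"
    and "(\<integral>y. g y * kern \<omega> A s (y - x) \<partial>lborel) = (\<integral>z. g (x + s *\<^sub>R stretch A z) * \<omega> z \<partial>lborel)"
proof -
  have [measurable]: "g \<in> borel_measurable borel" "\<omega> \<in> borel_measurable borel" by fact+
  have [measurable]: "kern \<omega> A s \<in> borel_measurable borel" unfolding kern_def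
    by (intro borel_measurable_times borel_measurable_const measurable_compose[OF _ w]
       borel_measurable_continuous_onI continuous_intros linear_continuous_on bounded_linear_diag_mult)
  define b where "b = (\<Prod>i::'n\<in>UNIV. \<bar>s * (if i = last_ix then A else 1)\<bar>)"
  have b: "b > 0" unfolding b_def using assms by (intro prod_pos) auto
  have d: "diag_mult (\<lambda>i. - (s * (if i = last_ix then A else 1))) z = - (s *\<^sub>R stretch A z)"
     "diag_mult (\<lambda>i. (s * (if i = last_ix then A else 1))) z = (s *\<^sub>R stretch A z)" for z :: "'n rvec"
    by (auto simp: stretch_def diag_mult_def vec_eq_iff)
  have "(\<integral>y. g y * kern \<omega> A s (x - y) \<partial>lborel) = b * (\<integral>z. g (x - s *\<^sub>R stretch A z) * kern \<omega> A s (s *\<^sub>R stretch A z) \<partial>lborel)"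
    using assms(1,2) by (subst lborel_integral_diag(1)[where c="\<lambda>i. - (s * (if i = last_ix then A else 1))" and t=x])
      (auto simp: d b_def abs_minus_cancel)
  also have "\<dots> = (\<integral>z. g (x - s *\<^sub>R stretch A z) * \<omega> z \<partial>lborel)"
    using b unfolding kern_stretch[OF assms(1,2)] b_def[symmetric]
    by (subst integral_mult_right_zero[symmetric]) (simp add: field_simps)
  finally show "(\<integral>y. g y * kern \<omega> A s (x - y) \<partial>lborel) = (\<integral>z. g (x - s *\<^sub>R stretch A z) * \<omega> z \<partial>lborel)" .
  have "(\<integral>y. g y * kern \<omega> A s (y - x) \<partial>lborel) = b * (\<integral>z. g (x + s *\<^sub>R stretch A z) * kern \<omega> A s (s *\<^sub>R stretch A z) \<partial>lborel)"
    using assms(1,2) by (subst lborel_integral_diag(1)[where c="\<lambda>i. (s * (if i = last_ix then A else 1))" and t=x])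
      (auto simp: d b_def)
  also have "\<dots> = (\<integral>z. g (x + s *\<^sub>R stretch A z) * \<omega> z \<partial>lborel)"
    using b unfolding kern_stretch[OF assms(1,2)] b_def[symmetric]
    by (subst integral_mult_right_zero[symmetric]) (simp add: field_simps)
  finally show "(\<integral>y. g y * kern \<omega> A s (y - x) \<partial>lborel) = (\<integral>z. g (x + s *\<^sub>R stretch A z) * \<omega> z \<partial>lborel)" .
qed

lemma av_eq_conv:
  assumes "test_function UNIV \<omega>" "s > 0" "A > 0" "f \<in> borel_measurable borel"
  shows "av \<omega> A s f = conv (kern \<omega> A s) f"
  unfolding av_def conv_def fun_eq_iff
  using kern_subst(1)[OF assms(2-4) test_function_measurable[OF assms(1)]] by simp

lemma smooth_av:
  assumes "test_function UNIV \<omega>" "s > 0" "A > 0" "loc_int f"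
  shows "smooth (av \<omega> A s f)"
  using smooth_conv[OF assms(4) test_function_kern[OF assms(1-3)]] av_eq_conv[OF assms(1-3)] assms(4)
  by (simp add: loc_int_def)

text \<open>Weak derivatives of Borel functions that vanish outside \<open>U\<close>, along a list of coordinates;
  local integrability is required separately where it is used.\<close>
definition weakly :: "'n::{finite,linorder} rvec set \<Rightarrow> 'n list \<Rightarrow> ('n rvec \<Rightarrow> real) \<Rightarrow> ('n rvec \<Rightarrow> real) \<Rightarrow> bool" where
  "weakly U js f g \<longleftrightarrow> (\<forall>\<eta>. test_function U \<eta> \<longrightarrow>
     (\<integral>x. f x * pds js \<eta> x \<partial>lborel) = (-1) ^ length js * (\<integral>x. g x * \<eta> x \<partial>lborel))"

text \<open>Inside \<open>U\<close> mollification commutes with weak derivatives: the reflected kernel centred at \<open>x\<close> is a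
  test function on \<open>U\<close>, and moving the derivatives onto it is the definition of the weak derivative.\<close>
lemma pds_av:
  fixes f g :: "'n::{finite,linorder} rvec \<Rightarrow> real"
  assumes w: "test_function UNIV \<omega>" and sA: "s > 0" "A > 0" and fg: "loc_int f" "loc_int g"
    and wk: "weakly U js f g" and sub: "\<And>z. z \<in> supp \<omega> \<Longrightarrow> x - s *\<^sub>R stretch A z \<in> U"
  shows "pds js (av \<omega> A s f) x = av \<omega> A s g x"
proof -
  let ?k = "kern \<omega> A s"
  have k: "test_function UNIV ?k" by (rule test_function_kern[OF w sA])
  then have sk: "smooth ?k" by (simp add: test_function_def)
  have m: "diag_mult (\<lambda>_. -1) y = - y" for y :: "'n rvec" by (simp add: diag_mult_def vec_eq_iff)
  define \<eta> where "\<eta> y = 1 * ?k (x + diag_mult (\<lambda>_. -1) y)" for y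
  have t: "test_function U \<eta>"
  proof (rule test_functionI)
    show "smooth \<eta>" unfolding \<eta>_def by (rule smooth_affine[OF sk])
    show "compact ((\<lambda>z. x + (- s) *\<^sub>R stretch A z) ` supp \<omega>)"
      using w by (intro compact_affine_stretch) (auto simp: test_function_def)
    show "(\<lambda>z. x + (- s) *\<^sub>R stretch A z) ` supp \<omega> \<subseteq> U" using sub by auto
    show "y \<in> (\<lambda>z. x + (- s) *\<^sub>R stretch A z) ` supp \<omega>" if "\<eta> y \<noteq> 0" for y
    proof -
      from that have "?k (x - y) \<noteq> 0" by (simp add: \<eta>_def m)
      from kern_nonzero[OF sA this] obtain z where z: "\<omega> z \<noteq> 0" "x - y = s *\<^sub>R stretch A z" .
      then have "z \<in> supp \<omega>" by (intro in_suppI)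
      moreover have "y = x + (- s) *\<^sub>R stretch A z" using z(2) by (simp add: algebra_simps)
      ultimately show ?thesis by blast
    qed
  qed
  have p: "prod_list (map (\<lambda>_. -1) js) = (-1 :: real) ^ length js"
    by (induction js) auto
  have pp: "(-1 :: real) ^ length js * (-1) ^ length js = 1"
    by (simp flip: power_mult_distrib)
  have e: "pds js \<eta> y = (-1) ^ length js * pds js ?k (x - y)" for y
    unfolding \<eta>_def using pds_affine[OF sk, of js 1 x "\<lambda>_. -1"] by (simp add: m p)
  have "pds js (av \<omega> A s f) x = (\<integral>y. f y * pds js ?k (x - y) \<partial>lborel)"
    using pds_conv[OF fg(1) k, of js] av_eq_conv[OF w sA, of f] fg by (simp add: loc_int_def conv_def)
  also have "\<dots> = (\<integral>y. (-1) ^ length js * (f y * pds js \<eta> y) \<partial>lborel)"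
  proof (rule Bochner_Integration.integral_cong[OF refl])
    fix y
    have "(-1) ^ length js * (f y * pds js \<eta> y) = ((-1) ^ length js * (-1) ^ length js) * (f y * pds js ?k (x - y))"
      unfolding e by (simp only: mult_ac)
    then show "f y * pds js ?k (x - y) = (-1) ^ length js * (f y * pds js \<eta> y)"
      by (simp only: pp mult_1_left)
  qed
  also have "\<dots> = (-1) ^ length js * ((-1) ^ length js * (\<integral>y. g y * \<eta> y \<partial>lborel))"
    using wk t by (simp add: weakly_def)
  also have "\<dots> = (\<integral>y. g y * ?k (x - y) \<partial>lborel)"
    by (simp add: \<eta>_def m mult.assoc[symmetric] pp)
  also have "\<dots> = av \<omega> A s g x"
    using av_eq_conv[OF w sA, of g] fg by (simp add: loc_int_def conv_def)
  finally show ?thesis .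
qed

lemma mollify_tendsto:
  fixes \<omega> \<zeta> :: "'n::{finite,linorder} rvec \<Rightarrow> real"
  assumes w: "test_function UNIV \<omega>" "(\<integral>z. \<omega> z \<partial>lborel) = 1"
    and z: "\<zeta> \<in> borel_measurable borel" "\<And>x. \<bar>\<zeta> x\<bar> \<le> B" "isCont \<zeta> y"
  shows "((\<lambda>s. \<integral>z. \<zeta> (y + (c * s) *\<^sub>R stretch A z) * \<omega> z \<partial>lborel) \<longlongrightarrow> \<zeta> y) (at_right 0)"
proof -
  have [measurable]: "\<zeta> \<in> borel_measurable borel" "\<omega> \<in> borel_measurable borel"
    using z w test_function_measurable by auto
  have "((\<lambda>s. \<integral>z. \<zeta> (y + (c * s) *\<^sub>R stretch A z) * \<omega> z \<partial>lborel) \<longlongrightarrow> (\<integral>z. \<zeta> y * \<omega> z \<partial>lborel)) (at_right 0)"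
  proof (rule dominated_convergence_at[where G="\<lambda>z. B * \<bar>\<omega> z\<bar>"])
    show "integrable lborel (\<lambda>z. B * \<bar>\<omega> z\<bar>)" using test_function_integrable[OF w(1)] by auto
    show "AE z in lborel. \<bar>\<zeta> (y + (c * t) *\<^sub>R stretch A z) * \<omega> z\<bar> \<le> B * \<bar>\<omega> z\<bar>" for t
      using z by (auto simp: abs_mult intro!: mult_right_mono)
    have "((\<lambda>s. \<zeta> (y + (c * s) *\<^sub>R stretch A z) * \<omega> z) \<longlongrightarrow> \<zeta> y * \<omega> z) (at_right 0)" for z
    proof (intro tendsto_intros isCont_tendsto_compose[OF z(3)])
      have "((\<lambda>s. y + (c * s) *\<^sub>R stretch A z) \<longlongrightarrow> y + (c * 0) *\<^sub>R stretch A z) (at_right 0)"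
        by (intro tendsto_intros)
      then show "((\<lambda>s. y + (c * s) *\<^sub>R stretch A z) \<longlongrightarrow> y) (at_right 0)" by simp
    qed
    then show "AE z in lborel. ((\<lambda>s. \<zeta> (y + (c * s) *\<^sub>R stretch A z) * \<omega> z) \<longlongrightarrow> \<zeta> y * \<omega> z) (at_right 0)" by simp
  qed auto
  then show ?thesis using w(2) by simp
qed

lemma av_tendsto:
  fixes \<omega> \<zeta> :: "'n::{finite,linorder} rvec \<Rightarrow> real"
  assumes w: "test_function UNIV \<omega>" "(\<integral>z. \<omega> z \<partial>lborel) = 1"
    and z: "\<zeta> \<in> borel_measurable borel" "\<And>x. \<bar>\<zeta> x\<bar> \<le> B" "isCont \<zeta> y"
  shows "((\<lambda>s. av \<omega> A s \<zeta> y) \<longlongrightarrow> \<zeta> y) (at_right 0)"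
  using mollify_tendsto[OF assms, where c="-1"] by (simp add: av_def)

lemma mollify_bound:
  assumes w: "test_function UNIV \<omega>" and z: "\<And>x. \<bar>\<zeta> x\<bar> \<le> B"
  shows "\<bar>\<integral>z. \<zeta> (h z) * \<omega> z \<partial>lborel\<bar> \<le> B * (\<integral>z. \<bar>\<omega> z\<bar> \<partial>lborel)"
proof (cases "integrable lborel (\<lambda>z. \<zeta> (h z) * \<omega> z)")
  case True
  have "\<bar>\<integral>z. \<zeta> (h z) * \<omega> z \<partial>lborel\<bar> \<le> (\<integral>z. \<bar>\<zeta> (h z) * \<omega> z\<bar> \<partial>lborel)"
    using integral_norm_bound[of lborel "\<lambda>z. \<zeta> (h z) * \<omega> z"] by simp
  also have "\<dots> \<le> (\<integral>z. B * \<bar>\<omega> z\<bar> \<partial>lborel)"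
    using integrable_abs[OF True] test_function_integrable[OF w] z
    by (intro integral_mono) (auto simp: abs_mult intro!: mult_right_mono)
  finally show ?thesis by simp
next
  case False
  have "B \<ge> 0" using z[of undefined] by linarith
  then show ?thesis using False by (simp add: not_integrable_integral_eq)
qed

text \<open>By Fubini's theorem the mollification can be moved to \<open>\<zeta>\<close>, which is then approximated pointwise at
  its points of continuity. So weak convergence needs neither density of continuous functions nor
  convergence in \<open>L\<^sup>1\<close>, and \<open>\<zeta>\<close> may jump where \<open>v\<close> vanishes.\<close>
lemma av_weak_tendsto:
  fixes \<omega> \<zeta> v :: "'n::{finite,linorder} rvec \<Rightarrow> real"
  assumes w: "test_function UNIV \<omega>" "(\<integral>z. \<omega> z \<partial>lborel) = 1" and A: "A > 0"
    and z: "\<zeta> \<in> borel_measurable borel" "\<And>x. \<bar>\<zeta> x\<bar> \<le> B" "\<And>x. norm x > R \<Longrightarrow> \<zeta> x = 0"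
    and v: "loc_int v" "\<And>y. v y \<noteq> 0 \<Longrightarrow> isCont \<zeta> y"
  shows "((\<lambda>s. \<integral>x. av \<omega> A s v x * \<zeta> x \<partial>lborel) \<longlongrightarrow> (\<integral>x. v x * \<zeta> x \<partial>lborel)) (at_right 0)"
proof -
  have [measurable]: "\<zeta> \<in> borel_measurable borel" "\<omega> \<in> borel_measurable borel" "v \<in> borel_measurable borel"
    using z w test_function_measurable v by (auto simp: loc_int_def)
  obtain R0 where R0: "\<And>x. x \<in> supp \<omega> \<Longrightarrow> norm x \<le> R0" "R0 > 0"
    using w(1) compact_imp_bounded[of "supp \<omega>"] unfolding bounded_pos test_function_def by auto
  define \<zeta>' where "\<zeta>' s y = (\<integral>z. \<zeta> (y + s *\<^sub>R stretch A z) * \<omega> z \<partial>lborel)" for s y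
  have swap: "(\<integral>x. av \<omega> A s v x * \<zeta> x \<partial>lborel) = (\<integral>y. v y * \<zeta>' s y \<partial>lborel)" if s: "s > 0" for s
  proof -
    let ?k = "kern \<omega> A s"
    have k: "test_function UNIV ?k" by (rule test_function_kern[OF w(1) s A])
    note [measurable] = test_function_measurable[OF k]
    obtain Bk Rk where Bk: "Bk \<ge> 0" "\<And>x. \<bar>?k x\<bar> \<le> Bk" and Rk: "\<And>x. norm x > Rk \<Longrightarrow> ?k x = 0"
      using test_function_bounds[OF k, of "[]"] by (metis foldr.simps(1) id_apply)
    define V where "V y = \<bar>v y\<bar> * indicator (cball 0 (R + Rk)) y" for y
    have [measurable]: "V \<in> borel_measurable borel"
      unfolding V_def by (intro borel_measurable_times borel_measurable_abs borel_measurable_indicator) auto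
    have iV: "integrable lborel V"
    proof -
      have "integrable lborel (\<lambda>y. v y * indicator (cball 0 (R + Rk)) y)"
        by (rule loc_int_mult_bounded[OF v(1), of _ 1 "R + Rk"]) (auto simp: indicator_def)
      from integrable_abs[OF this] show ?thesis by (simp add: V_def[abs_def] abs_mult)
    qed
    have iz: "integrable lborel \<zeta>"
      using loc_int_mult_bounded[OF loc_int_const[of 1] z(1-3)] by simp
    have "integrable (lborel \<Otimes>\<^sub>M lborel) (\<lambda>(x, y). v y * ?k (x - y) * \<zeta> x)"
    proof (rule Bochner_Integration.integrable_bound)
      show "integrable (lborel \<Otimes>\<^sub>M lborel) (\<lambda>(x, y). Bk * (\<zeta> x * V y))"
      proof (subst lborel_pair.integrable_product_swap_iff[symmetric], intro lborel_pair.Fubini_integrable)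
        show "integrable lborel (\<lambda>x. \<integral>y. norm (case (x, y) of (x, y) \<Rightarrow> (case (y, x) of (x, y) \<Rightarrow> Bk * (\<zeta> x * V y))) \<partial>lborel)"
          using iV by (simp add: abs_mult)
      qed (use iz iV in auto)
      have "norm (v y * ?k (x - y) * \<zeta> x) \<le> norm (Bk * (\<zeta> x * V y))" for x y
      proof (cases "norm x \<le> R \<and> norm (x - y) \<le> Rk")
        case True
        then have "norm y \<le> R + Rk" using norm_triangle_ineq4[of x "x - y"] by simp
        moreover have "\<bar>v y\<bar> * \<bar>?k (x - y)\<bar> * \<bar>\<zeta> x\<bar> \<le> \<bar>v y\<bar> * Bk * \<bar>\<zeta> x\<bar>"
          using Bk(2) by (intro mult_right_mono mult_left_mono) auto
        ultimately show ?thesis using Bk(1) by (simp add: V_def abs_mult mult_ac)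
      qed (use z Rk in \<open>auto simp: not_le\<close>)
      then show "AE x in lborel \<Otimes>\<^sub>M lborel. norm (case x of (x, y) \<Rightarrow> v y * ?k (x - y) * \<zeta> x)
        \<le> norm (case x of (x, y) \<Rightarrow> Bk * (\<zeta> x * V y))" by auto
    qed auto
    from lborel_pair.Fubini_integral[OF this]
    have 1: "(\<integral>y. \<integral>x. v y * ?k (x - y) * \<zeta> x \<partial>lborel \<partial>lborel) = (\<integral>x. \<integral>y. v y * ?k (x - y) * \<zeta> x \<partial>lborel \<partial>lborel)"
      by simp
    have 2: "(\<integral>x. v y * ?k (x - y) * \<zeta> x \<partial>lborel) = v y * \<zeta>' s y" for y
      unfolding \<zeta>'_def kern_subst(2)[OF s A z(1) test_function_measurable[OF w(1)], symmetric]
      by (simp add: mult_ac flip: integral_mult_right_zero)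
    have 3: "(\<integral>y. v y * ?k (x - y) * \<zeta> x \<partial>lborel) = av \<omega> A s v x * \<zeta> x" for x
      unfolding av_eq_conv[OF w(1) s A \<open>v \<in> borel_measurable borel\<close>] conv_def by simp
    show ?thesis using 1 unfolding 2 3 by simp
  qed
  let ?W = "\<integral>z. \<bar>\<omega> z\<bar> \<partial>lborel"
  have W: "?W \<ge> 0" by simp
  let ?R = "R + (1 + A) * R0"
  have B0: "B \<ge> 0" using z(2)[of undefined] by linarith
  have "((\<lambda>s. \<integral>y. v y * \<zeta>' s y \<partial>lborel) \<longlongrightarrow> (\<integral>y. v y * \<zeta> y \<partial>lborel)) (at 0 within {0..1})"
  proof (rule dominated_convergence_at[where G="\<lambda>y. \<bar>v y * (B * ?W * indicator (cball 0 ?R) y)\<bar>"])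
    show "integrable lborel (\<lambda>y. \<bar>v y * (B * ?W * indicator (cball 0 ?R) y)\<bar>)"
      using B0 W by (intro integrable_abs loc_int_mult_bounded[OF v(1), where B="B * ?W" and R="?R"])
         (auto simp: indicator_def)
    fix s :: real assume s: "s \<in> {0..1}"
    show "(\<lambda>y. v y * \<zeta>' s y) \<in> borel_measurable lborel" unfolding \<zeta>'_def by measurable
    have "\<bar>v y * \<zeta>' s y\<bar> \<le> \<bar>v y * (B * ?W * indicator (cball 0 ?R) y)\<bar>" for y
    proof (cases "norm y \<le> ?R")
      case True
      have "\<bar>\<zeta>' s y\<bar> \<le> B * ?W" unfolding \<zeta>'_def by (rule mollify_bound[OF w(1) z(2)])
      then show ?thesis using True B0 W by (auto simp: abs_mult intro!: mult_left_mono)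
    next
      case False
      have "\<zeta> (y + s *\<^sub>R stretch A z) * \<omega> z = 0" for z
      proof (cases "\<omega> z = 0")
        case nz: False
        then have "norm z \<le> R0" using R0 in_suppI by blast
        then have "(1 + A) * norm z \<le> (1 + A) * R0" using A by (intro mult_left_mono) auto
        then have "norm (stretch A z) \<le> (1 + A) * R0" using norm_stretch_le[of A z] A by linarith
        moreover have "s * norm (stretch A z) \<le> 1 * norm (stretch A z)"
          using s by (intro mult_right_mono) auto
        ultimately have "norm (s *\<^sub>R stretch A z) \<le> (1 + A) * R0" using s by simp
        then have "norm (y + s *\<^sub>R stretch A z) > R"
          using False norm_triangle_ineq4[of "y + s *\<^sub>R stretch A z" "s *\<^sub>R stretch A z"] by simp
        then show ?thesis using z(3) by simp
      qed simp
      then have "\<zeta>' s y = 0" unfolding \<zeta>'_def by (simp only: Bochner_Integration.integral_zero)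
      then show ?thesis by simp
    qed
    then show "AE y in lborel. \<bar>v y * \<zeta>' s y\<bar> \<le> \<bar>v y * (B * ?W * indicator (cball 0 ?R) y)\<bar>" by simp
  next
    have "((\<lambda>s. v y * \<zeta>' s y) \<longlongrightarrow> v y * \<zeta> y) (at 0 within {0..1})" for y
    proof (cases "v y = 0")
      case False
      have "((\<lambda>s. \<zeta>' s y) \<longlongrightarrow> \<zeta> y) (at_right 0)"
        using mollify_tendsto[OF w z(1,2) v(2)[OF False], where c=1 and A=A] by (simp add: \<zeta>'_def)
      then have "((\<lambda>s. \<zeta>' s y) \<longlongrightarrow> \<zeta> y) (at 0 within {0..1})"
        by (simp add: at_within_Icc_at_right)
      then show ?thesis by (intro tendsto_intros)
    qed simp
    then show "AE y in lborel. ((\<lambda>s. v y * \<zeta>' s y) \<longlongrightarrow> v y * \<zeta> y) (at 0 within {0..1})" by simp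
  qed auto
  then have "((\<lambda>s. \<integral>y. v y * \<zeta>' s y \<partial>lborel) \<longlongrightarrow> (\<integral>y. v y * \<zeta> y \<partial>lborel)) (at_right 0)"
    by (simp add: at_within_Icc_at_right)
  moreover have "\<forall>\<^sub>F s in at_right 0. (\<integral>y. v y * \<zeta>' s y \<partial>lborel) = (\<integral>x. av \<omega> A s v x * \<zeta> x \<partial>lborel)"
    using swap by (auto simp: eventually_at_filter)
  ultimately show ?thesis by (rule Lim_transform_eventually)
qed

section \<open>Uniqueness of weak derivatives\<close>

lemma loc_int_bounded:
  assumes m: "\<zeta> \<in> borel_measurable borel" and b: "\<And>x. \<bar>\<zeta> x\<bar> \<le> B"
  shows "loc_int \<zeta>"
  unfolding loc_int_def set_integrable_def
proof (intro conjI allI)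
  fix R
  have "B \<ge> 0" using b[of undefined] by linarith
  then have "\<bar>indicator (cball 0 R) x * \<zeta> x\<bar> \<le> B" for x using b[of x] by (auto simp: indicator_def)
  then have "integrable lborel (\<lambda>x. 1 * (indicator (cball 0 R) x * \<zeta> x))"
    by (intro loc_int_mult_bounded[OF loc_int_const, where B=B and R=R] borel_measurable_times borel_measurable_indicator m)
       (auto simp: indicator_def)
  then show "integrable lborel (\<lambda>x. indicat_real (cball 0 R) x *\<^sub>R \<zeta> x)" by simp
qed (rule m)

text \<open>The indicator of \<open>C\<close> is a limit of continuous functions with support near \<open>C\<close>, and each of
  these is a limit of its mollifications, which are test functions on \<open>U\<close>.\<close>
lemma integral_compact_eq_0:
  fixes \<omega> g :: "'n::{finite,linorder} rvec \<Rightarrow> real"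
  assumes w: "test_function UNIV \<omega>" "(\<integral>z. \<omega> z \<partial>lborel) = 1"
    and U: "open U" and C: "compact C" "C \<subseteq> U" "C \<noteq> {}"
    and g: "locally_integrable U g"
    and eq: "\<And>\<eta>. test_function U \<eta> \<Longrightarrow> (LINT x:U|lebesgue. g x * \<eta> x) = 0"
  shows "(LINT x:C|lebesgue. g x) = 0"
proof -
  have [measurable]: "\<omega> \<in> borel_measurable borel" using w test_function_measurable by auto
  obtain e where e: "e > 0" "(\<Union>x\<in>C. cball x e) \<subseteq> U"
    using compact_subset_open_imp_cball_epsilon_subset[OF C(1) U C(2)] by blast
  define K where "K = {x. infdist x C \<le> e}"
  have KU: "K \<subseteq> U"
  proof
    fix x assume "x \<in> K"
    obtain c where "c \<in> C" "infdist x C = dist x c"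
      using infdist_attains_inf[of C x] C compact_imp_closed by auto
    then have "x \<in> cball c e" using \<open>x \<in> K\<close> by (simp add: K_def dist_commute)
    then show "x \<in> U" using \<open>c \<in> C\<close> e(2) by blast
  qed
  have KC: "compact K"
  proof -
    obtain b where b: "\<And>c. c \<in> C \<Longrightarrow> norm c \<le> b" using compact_imp_bounded[OF C(1)] by (auto simp: bounded_iff)
    have "norm x \<le> b + e" if x: "x \<in> K" for x
    proof -
      obtain c where "c \<in> C" "infdist x C = dist x c"
        using infdist_attains_inf[of C x] C compact_imp_closed by auto
      then show ?thesis using x b[of c] norm_triangle_ineq2[of x c] by (auto simp: K_def dist_norm)
    qed
    then have "bounded K" by (auto simp: bounded_iff)
    moreover have "closed K" unfolding K_def
      by (intro closed_Collect_le continuous_intros)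
    ultimately show ?thesis by (simp add: compact_eq_bounded_closed)
  qed
  have gK: "integrable lebesgue (\<lambda>x. indicator K x * g x)"
    using g KC KU unfolding locally_integrable_def set_integrable_def by auto
  then have gKm[measurable]: "(\<lambda>x. indicator K x * g x) \<in> borel_measurable lebesgue" by auto
  have test0: "(\<integral>x. (indicator K x * g x) * \<eta> x \<partial>lebesgue) = 0" if t: "test_function U \<eta>" and s: "\<And>x. \<eta> x \<noteq> 0 \<Longrightarrow> x \<in> K" for \<eta>
  proof -
    have "(LINT x:U|lebesgue. g x * \<eta> x) = (\<integral>x. (indicator K x * g x) * \<eta> x \<partial>lebesgue)"
      unfolding set_lebesgue_integral_def
      using s KU by (intro Bochner_Integration.integral_cong) (auto simp: indicator_def)
    then show ?thesis using eq[OF t] by simp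
  qed
  have cont0: "(\<integral>x. (indicator K x * g x) * \<zeta> x \<partial>lebesgue) = 0"
    if zc: "continuous_on UNIV \<zeta>" and zb: "\<And>x. \<bar>\<zeta> x\<bar> \<le> B" and zs: "\<And>x. \<zeta> x \<noteq> 0 \<Longrightarrow> infdist x C \<le> e / 2" for \<zeta> B
  proof -
    obtain R0 where R0: "\<And>x. x \<in> supp \<omega> \<Longrightarrow> norm x \<le> R0" "R0 > 0"
      using w(1) compact_imp_bounded[of "supp \<omega>"] unfolding bounded_pos test_function_def by auto
    have zm[measurable]: "\<zeta> \<in> borel_measurable borel" using zc by (rule borel_measurable_continuous_onI)
    have nz: "infdist x C \<le> 3/4 * e" if s: "0 < s" "s < e / (8 * R0)" and x: "av \<omega> 1 s \<zeta> x \<noteq> 0" for s x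
    proof -
      have "\<exists>z. \<zeta> (x - s *\<^sub>R stretch 1 z) * \<omega> z \<noteq> 0"
        using x unfolding av_def by (metis (no_types, lifting) Bochner_Integration.integral_cong Bochner_Integration.integral_zero)
      then obtain z where z: "\<zeta> (x - s *\<^sub>R stretch 1 z) \<noteq> 0" "\<omega> z \<noteq> 0" by auto
      have "infdist x C \<le> infdist (x - s *\<^sub>R stretch 1 z) C + s * norm (stretch 1 z)"
        using infdist_triangle[of x C "x - s *\<^sub>R stretch 1 z"] s by (simp add: dist_norm)
      moreover have "norm (stretch 1 z) \<le> 2 * R0"
        using norm_stretch_le[of 1 z] R0(1)[of z] in_suppI[of \<omega> z] z(2) by simp
      then have "s * norm (stretch 1 z) \<le> s * (2 * R0)" using s by (intro mult_left_mono) auto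
      moreover have "s * (2 * R0) \<le> e / 4" using s R0(2) by (simp add: field_simps)
      ultimately show ?thesis using zs[OF z(1)] by linarith
    qed
    have "((\<lambda>s. \<integral>x. (indicator K x * g x) * av \<omega> 1 s \<zeta> x \<partial>lebesgue) \<longlongrightarrow> (\<integral>x. (indicator K x * g x) * \<zeta> x \<partial>lebesgue)) (at_right 0)"
    proof (rule dominated_convergence_at[where G="\<lambda>x. \<bar>indicator K x * g x\<bar> * (B * (\<integral>z. \<bar>\<omega> z\<bar> \<partial>lborel))"])
      show "integrable lebesgue (\<lambda>x. \<bar>indicator K x * g x\<bar> * (B * (\<integral>z. \<bar>\<omega> z\<bar> \<partial>lborel)))"
        using integrable_abs[OF gK] by simp
      have "(\<lambda>x. av \<omega> 1 s \<zeta> x) \<in> borel_measurable lborel" for s unfolding av_def by measurable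
      then have [measurable]: "av \<omega> 1 s \<zeta> \<in> borel_measurable lebesgue" for s
        by (simp add: measurable_completion)
      show "(\<lambda>x. (indicator K x * g x) * av \<omega> 1 s \<zeta> x) \<in> borel_measurable lebesgue" for s
        by measurable
      have "\<zeta> \<in> borel_measurable lebesgue" using zm by (simp add: measurable_completion)
      then show "(\<lambda>x. (indicator K x * g x) * \<zeta> x) \<in> borel_measurable lebesgue" by measurable
      show "AE x in lebesgue. \<bar>indicator K x * g x * av \<omega> 1 s \<zeta> x\<bar> \<le> \<bar>indicator K x * g x\<bar> * (B * (\<integral>z. \<bar>\<omega> z\<bar> \<partial>lborel))" for s
      proof (rule AE_I2)
        fix x
        have "\<bar>av \<omega> 1 s \<zeta> x\<bar> \<le> B * (\<integral>z. \<bar>\<omega> z\<bar> \<partial>lborel)"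
          unfolding av_def by (rule mollify_bound[OF w(1) zb])
        then show "\<bar>indicator K x * g x * av \<omega> 1 s \<zeta> x\<bar> \<le> \<bar>indicator K x * g x\<bar> * (B * (\<integral>z. \<bar>\<omega> z\<bar> \<partial>lborel))"
          unfolding abs_mult[of "indicator K x * g x"] by (intro mult_left_mono) auto
      qed
      have "((\<lambda>s. av \<omega> 1 s \<zeta> x) \<longlongrightarrow> \<zeta> x) (at_right 0)" for x
        using zc by (intro av_tendsto[OF w zm zb]) (simp add: continuous_on_eq_continuous_at)
      then show "AE x in lebesgue. ((\<lambda>s. indicator K x * g x * av \<omega> 1 s \<zeta> x) \<longlongrightarrow> indicator K x * g x * \<zeta> x) (at_right 0)"
        by (intro AE_I2 tendsto_intros) auto
    qed
    moreover have "\<forall>\<^sub>F s in at_right 0. (\<integral>x. (indicator K x * g x) * av \<omega> 1 s \<zeta> x \<partial>lebesgue) = 0"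
    proof -
      have "loc_int \<zeta>"
        by (rule loc_int_bounded[OF zm zb])
      have "(\<integral>x. (indicator K x * g x) * av \<omega> 1 s \<zeta> x \<partial>lebesgue) = 0" if s: "0 < s" "s < e / (8 * R0)" for s
      proof (rule test0)
        have "compact ({x. infdist x C \<le> 3/4 * e} \<inter> K)"
          using KC by (intro closed_Int_compact closed_Collect_le continuous_intros)
        moreover have "{x. infdist x C \<le> 3/4 * e} \<inter> K \<subseteq> U" using KU by auto
        ultimately show "test_function U (av \<omega> 1 s \<zeta>)"
        proof (rule test_functionI[rotated 2])
          show "smooth (av \<omega> 1 s \<zeta>)" by (rule smooth_av[OF w(1) s(1) _ \<open>loc_int \<zeta>\<close>]) simp
          fix x assume "av \<omega> 1 s \<zeta> x \<noteq> 0"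
          from nz[OF s this] show "x \<in> {x. infdist x C \<le> 3/4 * e} \<inter> K" using e(1) by (simp add: K_def)
        qed
        show "x \<in> K" if "av \<omega> 1 s \<zeta> x \<noteq> 0" for x using nz[OF s that] e(1) by (simp add: K_def)
      qed
      moreover have "e / (8 * R0) > 0" using e(1) R0(2) by simp
      ultimately show ?thesis by (auto simp: eventually_at_right)
    qed
    ultimately have "((\<lambda>s. 0) \<longlongrightarrow> (\<integral>x. (indicator K x * g x) * \<zeta> x \<partial>lebesgue)) (at_right (0::real))"
      by (rule Lim_transform_eventually)
    then show ?thesis by (metis tendsto_const_iff trivial_limit_at_right_real)
  qed
  define \<zeta> where "\<zeta> n x = max 0 (1 - (real n + 1) * (2 / e * infdist x C))" for n x
  have zc: "continuous_on UNIV (\<zeta> n)" for n unfolding \<zeta>_def by (intro continuous_intros)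
  have z0: "(\<integral>x. (indicator K x * g x) * \<zeta> n x \<partial>lebesgue) = 0" for n
  proof (rule cont0[OF zc])
    show "\<bar>\<zeta> n x\<bar> \<le> 1" for x using e(1) infdist_nonneg[of x C] by (auto simp: \<zeta>_def)
    show "infdist x C \<le> e / 2" if "\<zeta> n x \<noteq> 0" for x
    proof -
      have "(real n + 1) * (2 / e * infdist x C) < 1"
      proof -
        have "max 0 (1 - a) \<noteq> 0 \<Longrightarrow> a < 1" for a :: real by linarith
        from this[OF that[unfolded \<zeta>_def]] show ?thesis .
      qed
      moreover have "1 * (2 / e * infdist x C) \<le> (real n + 1) * (2 / e * infdist x C)"
        using e(1) infdist_nonneg[of x C] by (intro mult_right_mono) auto
      ultimately have "2 / e * infdist x C < 1" by linarith
      then show ?thesis using e(1) by (simp add: field_simps)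
    qed
  qed
  have "(\<lambda>n. \<integral>x. (indicator K x * g x) * \<zeta> n x \<partial>lebesgue) \<longlonglongrightarrow> (\<integral>x. (indicator K x * g x) * indicator C x \<partial>lebesgue)"
  proof (rule integral_dominated_convergence[where w="\<lambda>x. \<bar>indicator K x * g x\<bar>"])
    have "\<zeta> n \<in> borel_measurable lebesgue" for n
      using borel_measurable_continuous_onI[OF zc[of n]] by (simp add: measurable_completion)
    then show "(\<lambda>x. (indicator K x * g x) * \<zeta> n x) \<in> borel_measurable lebesgue" for n by measurable
    have "C \<in> sets lebesgue" using C(1) by (intro fmeasurableD lmeasurable_compact)
    then show "(\<lambda>x. (indicator K x * g x) * indicator C x) \<in> borel_measurable lebesgue" by measurable
    show "integrable lebesgue (\<lambda>x. \<bar>indicator K x * g x\<bar>)" by (rule integrable_abs[OF gK])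
    have b: "\<bar>\<zeta> n x\<bar> \<le> 1" for n x using e(1) infdist_nonneg[of x C] by (auto simp: \<zeta>_def)
    have "\<bar>a * \<zeta> n x\<bar> \<le> \<bar>a\<bar>" for a x n
      using mult_left_mono[OF b[of n x], of "\<bar>a\<bar>"] by (simp add: abs_mult)
    then show "AE x in lebesgue. norm (indicator K x * g x * \<zeta> n x) \<le> \<bar>indicator K x * g x\<bar>" for n
      unfolding real_norm_def by (intro AE_I2) blast
    have "(\<lambda>n. \<zeta> n x) \<longlonglongrightarrow> indicator C x" for x
    proof (cases "x \<in> C")
      case True
      then show ?thesis by (simp add: \<zeta>_def)
    next
      case False
      then have d: "infdist x C > 0"
        using C compact_imp_closed in_closed_iff_infdist_zero[of C x] infdist_nonneg[of x C] by force
      obtain N :: nat where N: "real N > 1 / (2 / e * infdist x C)" using reals_Archimedean2 by blast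
      have "\<zeta> n x = 0" if "n \<ge> N" for n
      proof -
        have "1 / (2 / e * infdist x C) < real n + 1" using N that by linarith
        then have "1 < (real n + 1) * (2 / e * infdist x C)"
          using d e(1) by (simp add: pos_divide_less_eq)
        then show ?thesis by (simp add: \<zeta>_def mult.assoc)
      qed
      then have "\<forall>\<^sub>F n in sequentially. \<zeta> n x = 0" by (auto simp: eventually_sequentially)
      then show ?thesis using False by (simp add: tendsto_eventually)
    qed
    then show "AE x in lebesgue. (\<lambda>n. indicator K x * g x * \<zeta> n x) \<longlonglongrightarrow> indicator K x * g x * indicator C x"
      by (intro AE_I2 tendsto_intros)
  qed
  then have "(\<integral>x. (indicator K x * g x) * indicator C x \<partial>lebesgue) = 0"
    unfolding z0 by (simp add: LIMSEQ_const_iff)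
  moreover have "(indicator K x * g x) * indicator C x = indicator C x *\<^sub>R g x" for x
    using e(1) by (auto simp: K_def indicator_def)
  ultimately show ?thesis unfolding set_lebesgue_integral_def by simp
qed

text \<open>If the set where \<open>g > 0\<close> were not null it would contain a compact set of
  positive measure, by inner regularity.\<close>
lemma AE_nonpos_of_compact_integrals:
  fixes g :: "'n::{finite,linorder} rvec \<Rightarrow> real"
  assumes K: "compact K" and gK: "set_integrable lebesgue K g"
    and eq: "\<And>C. compact C \<Longrightarrow> C \<subseteq> K \<Longrightarrow> C \<noteq> {} \<Longrightarrow> (LINT x:C|lebesgue. g x) = 0"
  shows "AE x in lebesgue. x \<in> K \<longrightarrow> g x \<le> 0"
proof -
  define h where "h x = indicator K x * g x" for x
  have h: "integrable lebesgue h" using gK by (simp add: h_def[abs_def] set_integrable_def)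
  define P where "P = {x. h x > 0}"
  have hm[measurable]: "h \<in> borel_measurable lebesgue" using h by auto
  have P: "P \<in> sets lebesgue" unfolding P_def using measurable_sets[OF hm, of "{0<..}"] by (simp add: vimage_def)
  have PK: "P \<subseteq> K" by (auto simp: P_def h_def indicator_def)
  have "P \<in> null_sets lebesgue"
  proof (rule ccontr)
    assume "P \<notin> null_sets lebesgue"
    then have pos: "emeasure lebesgue P > 0" using P by (auto simp: null_sets_def zero_less_iff_neq_zero)
    have fin: "P \<in> lmeasurable" using P PK K
      by (meson bounded_set_imp_lmeasurable bounded_subset compact_imp_bounded)
    have em: "emeasure lebesgue P = ennreal (measure lebesgue P)"
      using fin by (intro emeasure_eq_ennreal_measure) (metis (lifting) fmeasurableD2 infinity_ennreal_def)
    have pos': "measure lebesgue P > 0" using pos unfolding em by simp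
    from sets_lebesgue_inner_closed[OF P pos'] obtain T where T: "closed T" "T \<subseteq> P" "P - T \<in> lmeasurable"
      "emeasure lebesgue (P - T) < ennreal (measure lebesgue P)" .
    have Tc: "compact T" using T(1,2) PK K
      using compact_Int_closed[of K T] by (simp add: inf.absorb2 subset_trans)
    have "T \<notin> null_sets lebesgue"
    proof
      assume "T \<in> null_sets lebesgue"
      then have "emeasure lebesgue (P - T) = emeasure lebesgue P" by (intro emeasure_Diff_null_set P)
      then show False using T(4) em by simp
    qed
    then have Tne: "T \<noteq> {}" by auto
    have TK: "T \<subseteq> K" using T(2) PK by blast
    have hT: "indicator T x * h x = indicator T x *\<^sub>R g x" for x
      using subsetD[OF TK, of x] by (cases "x \<in> T") (auto simp: h_def)
    have 0: "(\<integral>x. indicator T x * h x \<partial>lebesgue) = 0"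
      using eq[OF Tc TK Tne] unfolding set_lebesgue_integral_def hT .
    have Tm: "T \<in> sets lebesgue" using Tc by (intro fmeasurableD lmeasurable_compact)
    have int: "integrable lebesgue (\<lambda>x. indicator T x * h x)"
      using integrable_mult_indicator[OF Tm h] by simp
    have "AE x in lebesgue. indicator T x * h x = 0"
    proof -
      have "0 \<le> indicator T x * h x" for x
        using subsetD[OF T(2), of x] by (cases "x \<in> T") (auto simp: P_def)
      then show ?thesis using integral_nonneg_eq_0_iff_AE[OF int] 0 by simp
    qed
    then have "AE x in lebesgue. x \<notin> T" by eventually_elim (use T(2) in \<open>auto simp: P_def\<close>)
    then have "T \<in> null_sets lebesgue" using Tm by (simp add: AE_iff_null_sets)
    then show False using \<open>T \<notin> null_sets lebesgue\<close> by simp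
  qed
  then have "AE x in lebesgue. x \<notin> P" using P by (simp add: AE_iff_null_sets)
  then show ?thesis by eventually_elim (auto simp: P_def h_def)
qed

lemma locally_integrable_diff:
  assumes "locally_integrable U f" "locally_integrable U g"
  shows "locally_integrable U (\<lambda>x. f x - g x)"
  using assms unfolding locally_integrable_def by (auto intro: set_integral_diff(1))

lemma test_function_locally_integrable_mult:
  assumes g: "locally_integrable U g" and t: "test_function U \<eta>"
  shows "set_integrable lebesgue U (\<lambda>x. g x * \<eta> x)"
proof -
  obtain B R where B: "\<And>x. \<bar>\<eta> x\<bar> \<le> B"
    using test_function_bounds[OF t, of "[]"] by (metis foldr.simps(1) id_apply)
  have S: "compact (supp \<eta>)" "supp \<eta> \<subseteq> U" using t by (auto simp: test_function_def)
  then have gs: "integrable lebesgue (\<lambda>x. indicator (supp \<eta>) x *\<^sub>R g x)"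
    using g by (auto simp: locally_integrable_def set_integrable_def)
  have em: "\<eta> \<in> borel_measurable lebesgue"
    using test_function_measurable[OF t] by (simp add: measurable_completion)
  have i: "integrable lebesgue (\<lambda>x. \<eta> x * (indicator (supp \<eta>) x *\<^sub>R g x))"
  proof (rule Bochner_Integration.integrable_bound[OF integrable_mult_right[OF gs, of B], rotated])
    have "norm (\<eta> x * a) \<le> norm (B * a)" for x a
      using mult_right_mono[OF B[of x], of "\<bar>a\<bar>"] mult_right_mono[OF abs_ge_self[of B], of "\<bar>a\<bar>"]
      by (simp add: abs_mult)
    then show "AE x in lebesgue. norm (\<eta> x * (indicator (supp \<eta>) x *\<^sub>R g x)) \<le> norm (B * (indicator (supp \<eta>) x *\<^sub>R g x))"
      by (intro AE_I2)
  qed (intro borel_measurable_times borel_measurable_integrable[OF gs] em)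
  have e: "\<eta> x * (indicator (supp \<eta>) x *\<^sub>R g x) = indicator U x *\<^sub>R (g x * \<eta> x)" for x
    using S(2) in_suppI[of \<eta> x] by (auto simp: indicator_def)
  show ?thesis using i unfolding set_integrable_def e .
qed

lemma weak_deriv_AE_unique:
  fixes \<omega> f g h :: "'n::{finite,linorder} rvec \<Rightarrow> real"
  assumes w: "test_function UNIV \<omega>" "(\<integral>z. \<omega> z \<partial>lborel) = 1"
    and U: "open U" and g: "has_weak_deriv U \<alpha> f g" "has_weak_deriv U \<alpha> f h"
  shows "AE x in lebesgue. x \<in> U \<longrightarrow> g x = h x"
proof -
  have L: "locally_integrable U g" "locally_integrable U h" using g by (auto simp: has_weak_deriv_def)
  have C0: "(LINT x:C|lebesgue. g x - h x) = 0" if "compact C" "C \<subseteq> U" "C \<noteq> {}" for C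
  proof (rule integral_compact_eq_0[OF w U that locally_integrable_diff[OF L]])
    fix \<eta> assume t: "test_function U \<eta>"
    have "(LINT x:U|lebesgue. g x * \<eta> x) = (LINT x:U|lebesgue. h x * \<eta> x)"
      using g t by (auto simp: has_weak_deriv_def)
    then show "(LINT x:U|lebesgue. (g x - h x) * \<eta> x) = 0"
      using test_function_locally_integrable_mult[OF L(1) t] test_function_locally_integrable_mult[OF L(2) t]
      by (simp add: left_diff_distrib set_integral_diff)
  qed
  have K0: "AE x in lebesgue. x \<in> K \<longrightarrow> g x = h x" if K: "compact K" "K \<subseteq> U" for K
  proof -
    have i: "set_integrable lebesgue K (\<lambda>x. g x - h x)" "set_integrable lebesgue K (\<lambda>x. h x - g x)"
      using locally_integrable_diff[OF L] locally_integrable_diff[OF L(2,1)] K by (auto simp: locally_integrable_def)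
    have C0': "(LINT x:C|lebesgue. h x - g x) = 0" if "compact C" "C \<subseteq> U" "C \<noteq> {}" for C
    proof -
      have "(\<integral>x. - (indicator C x *\<^sub>R (g x - h x)) \<partial>lebesgue) = 0"
        using C0[OF that] unfolding set_lebesgue_integral_def by simp
      then show ?thesis unfolding set_lebesgue_integral_def by (simp add: algebra_simps)
    qed
    have "AE x in lebesgue. x \<in> K \<longrightarrow> g x - h x \<le> 0"
      by (rule AE_nonpos_of_compact_integrals[OF K(1) i(1)]) (use C0 K in blast)
    moreover have "AE x in lebesgue. x \<in> K \<longrightarrow> h x - g x \<le> 0"
      by (rule AE_nonpos_of_compact_integrals[OF K(1) i(2)]) (use C0' K in blast)
    ultimately show ?thesis by eventually_elim auto
  qed
  obtain F :: "nat \<Rightarrow> 'n rvec set" where F: "\<And>n. compact (F n)" "\<And>n. F n \<subseteq> U" "\<Union>(range F) = U"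
  proof (rule open_Union_compact_subsets[OF U])
    fix C :: "nat \<Rightarrow> 'n rvec set"
    assume "\<And>n. compact (C n)" "\<And>n. C n \<subseteq> U" "\<Union>(range C) = U"
    then show thesis by (rule that)
  qed
  have "AE x in lebesgue. \<forall>n. x \<in> F n \<longrightarrow> g x = h x"
    unfolding AE_all_countable using K0 F by blast
  then show ?thesis by eventually_elim (use F(3) in auto)
qed

section \<open>Taylor expansion of averages\<close>

abbreviation lp_int :: "real \<Rightarrow> 'n::finite rvec set \<Rightarrow> ('n rvec \<Rightarrow> real) \<Rightarrow> ennreal" where
  "lp_int p E f \<equiv> \<integral>\<^sup>+x\<in>E. ennreal (\<bar>f x\<bar> powr p) \<partial>lborel"

text \<open>The monomial of a list of coordinates, in accordance with derivatives along lists.\<close>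
definition monom_at :: "'n list \<Rightarrow> 'n::finite rvec \<Rightarrow> real" where
  "monom_at js h = prod_list (map (\<lambda>j. h $ j) js)"

lemma finite_lists_of_length: "finite {js :: 'a::finite list. length js = m}"
  using finite_lists_length_eq[of "UNIV :: 'a set" m] by simp

lemma sum_lists_Suc:
  fixes F :: "'n::finite list \<Rightarrow> 'b::comm_monoid_add"
  shows "(\<Sum>js | length js = Suc m. F js) = (\<Sum>js | length js = m. \<Sum>k\<in>UNIV. F (k # js))"
proof -
  have e: "{js :: 'n list. length js = Suc m} = (\<lambda>(js, k). k # js) ` ({js. length js = m} \<times> UNIV)"
    by (auto simp: length_Suc_conv image_iff)
  have inj: "inj_on (\<lambda>(js, k). k # js) ({js :: 'n list. length js = m} \<times> UNIV)"
    by (auto simp: inj_on_def)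
  show ?thesis unfolding e sum.reindex[OF inj] by (simp add: o_def case_prod_unfold sum.cartesian_product)
qed

lemma smooth_line_derivative:
  fixes u :: "'n::finite rvec \<Rightarrow> real"
  assumes "smooth u"
  shows "((\<lambda>t. u (y + t *\<^sub>R h)) has_vector_derivative (\<Sum>i\<in>UNIV. h $ i * partial_deriv i u (y + t *\<^sub>R h))) (at t within S)"
proof -
  have "((\<lambda>t. y + t *\<^sub>R h) has_vector_derivative h) (at t)"
    by (auto intro!: derivative_eq_intros)
  from vector_derivative_diff_chain_within[OF this has_derivative_at_withinI[OF smooth_has_derivative[OF assms]]]
  have "(u \<circ> (\<lambda>t. y + t *\<^sub>R h) has_vector_derivative (\<Sum>i\<in>UNIV. h $ i * partial_deriv i u (y + t *\<^sub>R h))) (at t)" .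
  then show ?thesis by (simp add: o_def has_vector_derivative_at_within)
qed

text \<open>Taylor's formula on the segment from \<open>y\<close> to \<open>y + h\<close> with integral remainder. Summing over all lists of
  a given length, in which each multi-index occurs with its multinomial multiplicity, makes the
  derivative of the sum of order \<open>i\<close> the sum of order \<open>i + 1\<close>.\<close>
lemma taylor_line:
  fixes u :: "'n::finite rvec \<Rightarrow> real"
  assumes u: "smooth u" and m: "m > 0"
  shows "u (y + h) = (\<Sum>i<m. (\<Sum>js | length js = i. pds js u y * monom_at js h) / fact i)
    + (\<Sum>js | length js = m. monom_at js h *
        (\<integral>t. pds js u (y + t *\<^sub>R h) * (indicator {0..1} t * ((1 - t) ^ (m - 1) / fact (m - 1))) \<partial>lborel))"
proof -
  define Df where "Df i t = (\<Sum>js | length js = i. pds js u (y + t *\<^sub>R h) * monom_at js h)" for i t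
  have D: "(Df i has_vector_derivative Df (Suc i) t) (at t within {0..1})" for i t
  proof -
    have "(Df i has_vector_derivative (\<Sum>js | length js = i. (\<Sum>k\<in>UNIV. h $ k * partial_deriv k (pds js u) (y + t *\<^sub>R h)) * monom_at js h)) (at t within {0..1})"
      unfolding Df_def
      by (intro has_vector_derivative_sum has_vector_derivative_mult_left smooth_line_derivative smooth_pds u)
    also have "(\<Sum>js | length js = i. (\<Sum>k\<in>UNIV. h $ k * partial_deriv k (pds js u) (y + t *\<^sub>R h)) * monom_at js h) = Df (Suc i) t"
      unfolding Df_def sum_lists_Suc by (intro sum.cong refl) (simp add: monom_at_def sum_distrib_left mult_ac)
    finally show ?thesis .
  qed
  let ?i = "\<lambda>t. ((1 - t) ^ (m - 1) / fact (m - 1)) *\<^sub>R Df m t"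
  have "Df 0 1 = (\<Sum>i<m. ((1 - 0) ^ i / fact i) *\<^sub>R Df i 0) + integral {0..1} ?i"
    by (rule Taylor_integral[OF m refl]) (use D in auto)
  also have "Df 0 1 = u (y + h)" by (simp add: Df_def monom_at_def)
  also have "(\<Sum>i<m. ((1 - 0) ^ i / fact i) *\<^sub>R Df i 0) = (\<Sum>i<m. (\<Sum>js | length js = i. pds js u y * monom_at js h) / fact i)"
    by (simp add: Df_def)
  also have "integral {0..1} ?i = (\<Sum>js | length js = m. monom_at js h *
        (\<integral>t. pds js u (y + t *\<^sub>R h) * (indicator {0..1} t * ((1 - t) ^ (m - 1) / fact (m - 1))) \<partial>lborel))"
  proof -
    let ?w = "\<lambda>t::real. ((1 - t) ^ (m - 1) / fact (m - 1))"
    have c: "continuous_on {0..1} (\<lambda>t. ?w t * pds js u (y + t *\<^sub>R h))" for js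
      by (intro continuous_intros continuous_on_compose2[OF smooth_continuous[OF smooth_pds[OF u]]]) auto
    have i: "integrable lborel (\<lambda>t. pds js u (y + t *\<^sub>R h) * (indicator {0..1} t * ?w t))" for js
      using borel_integrable_compact[OF compact_Icc c[of js]] by (simp add: mult_ac)
    have "continuous_on {0..1} ?i" unfolding Df_def
      by (intro continuous_intros continuous_on_compose2[OF smooth_continuous[OF smooth_pds[OF u]]]) auto
    then have "integral {0..1} ?i = (LINT t:{0..1}|lborel. ?i t)"
      by (intro set_borel_integral_eq_integral(2)[symmetric])
        (unfold set_integrable_def, rule borel_integrable_compact[OF compact_Icc])
    also have "\<dots> = (\<integral>t. (\<Sum>js | length js = m. monom_at js h * (pds js u (y + t *\<^sub>R h) * (indicator {0..1} t * ?w t))) \<partial>lborel)"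
      unfolding set_lebesgue_integral_def Df_def
      by (intro Bochner_Integration.integral_cong refl) (simp add: sum_distrib_left mult_ac)
    also have "\<dots> = (\<Sum>js | length js = m. monom_at js h * (\<integral>t. pds js u (y + t *\<^sub>R h) * (indicator {0..1} t * ?w t) \<partial>lborel))"
      by (subst Bochner_Integration.integral_sum[OF integrable_mult_right[OF i]]) (intro sum.cong refl integral_mult_right_zero)
    finally show ?thesis .
  qed
  finally show ?thesis .
qed

lemma loc_int_continuous:
  assumes "continuous_on UNIV g" shows "loc_int g"
  unfolding loc_int_def set_integrable_def
  using assms borel_integrable_compact[OF compact_cball continuous_on_subset[OF assms subset_UNIV]]
  by (auto intro: borel_measurable_continuous_onI)

lemma continuous_test_integrable:
  assumes "continuous_on UNIV g" "test_function U \<omega>"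
  shows "integrable lborel (\<lambda>z. g z * \<omega> z)"
proof -
  obtain B R where "\<And>x. \<bar>\<omega> x\<bar> \<le> B" "\<And>x. norm x > R \<Longrightarrow> \<omega> x = 0"
    using test_function_bounds[OF assms(2), of "[]"] by (metis foldr.simps(1) id_apply)
  then show ?thesis
    by (intro loc_int_mult_bounded[OF loc_int_continuous[OF assms(1)] test_function_measurable[OF assms(2)]])
qed

lemma monom_at_continuous [continuous_intros]:
  "continuous_on S f \<Longrightarrow> continuous_on S (\<lambda>x. monom_at js (f x))"
  by (induction js) (auto simp: monom_at_def intro!: continuous_intros)

lemma abs_monom_at_le: "\<bar>monom_at js h\<bar> \<le> norm h ^ length js"
proof (induction js)
  case (Cons j js)
  have "\<bar>h $ j\<bar> * \<bar>monom_at js h\<bar> \<le> norm h * norm h ^ length js"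
    using Cons component_le_norm_cart[of h j] by (intro mult_mono) auto
  then show ?case by (simp add: monom_at_def abs_mult)
qed (simp add: monom_at_def)

lemma power_sum_le:
  fixes a :: "'i \<Rightarrow> real"
  assumes "finite I" "p \<ge> 1"
  shows "\<bar>\<Sum>i\<in>I. a i\<bar> powr p \<le> real (card I) powr p * (\<Sum>i\<in>I. \<bar>a i\<bar> powr p)"
proof (cases "I = {}")
  case False
  define m where "m = Max ((\<lambda>i. \<bar>a i\<bar>) ` I)"
  have "m \<in> (\<lambda>i. \<bar>a i\<bar>) ` I" unfolding m_def using False assms by (intro Max_in) auto
  then obtain i0 where i0: "i0 \<in> I" "m = \<bar>a i0\<bar>" by auto
  have le: "\<bar>a i\<bar> \<le> m" if "i \<in> I" for i unfolding m_def using that assms by (intro Max_ge) auto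
  then have "\<bar>\<Sum>i\<in>I. a i\<bar> \<le> real (card I) * m"
    using sum_abs[of a I] sum_bounded_above[of I "\<lambda>i. \<bar>a i\<bar>" m, OF le] by linarith
  then have "\<bar>\<Sum>i\<in>I. a i\<bar> powr p \<le> (real (card I) * m) powr p"
    using assms by (intro powr_mono2) auto
  also have "\<dots> = real (card I) powr p * m powr p" using i0 by (simp add: powr_mult)
  also have "m powr p \<le> (\<Sum>i\<in>I. \<bar>a i\<bar> powr p)"
    unfolding i0(2) using i0(1) assms by (intro member_le_sum) auto
  finally show ?thesis by (simp add: mult_left_mono)
qed simp

lemma ennreal_power_sum_le:
  fixes a :: "'i \<Rightarrow> real"
  assumes "finite I" "p \<ge> 1"
  shows "ennreal (\<bar>\<Sum>i\<in>I. a i\<bar> powr p) \<le> ennreal (real (card I) powr p) * (\<Sum>i\<in>I. ennreal (\<bar>a i\<bar> powr p))"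
  using ennreal_leI[OF power_sum_le[OF assms, of a]]
  by (simp add: ennreal_mult sum_nonneg flip: sum_ennreal)

lemma ennreal_power_diff_le:
  fixes a b :: real assumes "p \<ge> 1"
  shows "ennreal (\<bar>a - b\<bar> powr p) \<le> ennreal (2 powr p) * (ennreal (\<bar>a\<bar> powr p) + ennreal (\<bar>b\<bar> powr p))"
  using ennreal_power_sum_le[of "{True, False}" p "\<lambda>i. if i then a else - b"] assms by simp

text \<open>The kernel has vanishing moments of orders \<open>1,\<dots>,l\<close>, expressed by lists of coordinates. The exponent
  \<open>p\<close> and the factor \<open>A\<close> are fixed here because the constants below depend on them.\<close>
locale mollifier =
  fixes \<omega> :: "'n::{finite,linorder} rvec \<Rightarrow> real" and A p :: real and l :: nat
  assumes test: "test_function UNIV \<omega>"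
    and supp_w: "supp \<omega> \<subseteq> {x \<in> cball 0 1. 1 / 2 \<le> x $ last_ix}"
    and int1: "(\<integral>z. \<omega> z \<partial>lborel) = 1"
    and moments: "\<And>js. 0 < length js \<Longrightarrow> length js \<le> l \<Longrightarrow> (\<integral>z. monom_at js z * \<omega> z \<partial>lborel) = 0"
    and A: "A > 0" and p: "p \<ge> 1"
begin

lemma w_measurable [measurable]: "\<omega> \<in> borel_measurable borel"
  by (rule test_function_measurable[OF test])

lemma w_nz: assumes "\<omega> z \<noteq> 0" shows "z \<in> supp \<omega>" "norm z \<le> 1" "1/2 \<le> z $ last_ix"
  using in_suppI[of \<omega> z] assms supp_w by auto

text \<open>The bound is kept above 1 so that powers of it can be estimated without case distinctions.\<close>
definition "W = max 1 (\<integral>z. \<bar>\<omega> z\<bar> \<partial>lborel)"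

lemma W: "W \<ge> 1" "(\<integral>\<^sup>+z. ennreal \<bar>\<omega> z\<bar> \<partial>lborel) \<le> ennreal W"
proof -
  have "(\<integral>\<^sup>+z. ennreal \<bar>\<omega> z\<bar> \<partial>lborel) = ennreal (\<integral>z. \<bar>\<omega> z\<bar> \<partial>lborel)"
    using test_function_integrable[OF test] by (intro nn_integral_eq_integral) auto
  then show "(\<integral>\<^sup>+z. ennreal \<bar>\<omega> z\<bar> \<partial>lborel) \<le> ennreal W" by (simp add: W_def ennreal_leI)
qed (simp add: W_def)

text \<open>Expanding the second monomial one factor at a time, every power of \<open>z\<close> is annihilated and only
  the constant term survives: a polynomial of degree at most \<open>l\<close> is reproduced by averaging. The first
  monomial collects the powers of \<open>z\<close> split off so far.\<close>
lemma moments_shift: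
  assumes "length is + length js \<le> l"
  shows "(\<integral>z. (monom_at is z * monom_at js (\<chi> j. a j - b j * z $ j)) * \<omega> z \<partial>lborel)
    = (if is = [] then monom_at js (\<chi> j. a j) else 0)"
  using assms
proof (induction js arbitrary: "is")
  case Nil
  then show ?case using moments[of "is"] int1 by (auto simp: monom_at_def)
next
  case (Cons j js)
  let ?v = "\<lambda>z. (\<chi> j. a j - b j * z $ j) :: 'n rvec"
  have i: "integrable lborel (\<lambda>z. (monom_at is z * monom_at js (?v z)) * \<omega> z)" for "is"
    by (intro continuous_test_integrable[OF _ test] continuous_intros)
  have e: "(monom_at is z * monom_at (j # js) (?v z)) * \<omega> z =
      a j * ((monom_at is z * monom_at js (?v z)) * \<omega> z) - b j * ((monom_at (j # is) z * monom_at js (?v z)) * \<omega> z)" for z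
    by (simp add: monom_at_def algebra_simps)
  have "(\<integral>z. (monom_at is z * monom_at (j # js) (?v z)) * \<omega> z \<partial>lborel) =
      a j * (\<integral>z. (monom_at is z * monom_at js (?v z)) * \<omega> z \<partial>lborel)
      - b j * (\<integral>z. (monom_at (j # is) z * monom_at js (?v z)) * \<omega> z \<partial>lborel)"
    unfolding e using i by (simp add: Bochner_Integration.integral_diff)
  also have "\<dots> = (if is = [] then monom_at (j # js) (\<chi> j. a j) else 0)"
    using Cons.IH[of "is"] Cons.IH[of "j # is"] Cons.prems by (simp add: monom_at_def)
  finally show ?case .
qed

text \<open>The shifts that occur, in units of the scale. \<open>Z0\<close> is convex and contains \<open>\<sigma> z\<close> for
  \<open>1 \<le> \<sigma> \<le> 4\<close> and \<open>z\<close> in the support of \<open>\<omega>\<close>; \<open>Z\<close> leaves room for one further mollification at a scale that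
  is not larger.\<close>
definition "Z0 = {\<zeta> :: 'n rvec. norm \<zeta> \<le> 4 \<and> 1/2 \<le> \<zeta> $ last_ix}"
definition "Z = {\<zeta> :: 'n rvec. norm \<zeta> \<le> 5 \<and> 1/2 \<le> \<zeta> $ last_ix}"

text \<open>Averages inherit any \<open>L\<^sup>p\<close> bound on \<open>E\<close> that holds for all translates in the support of the kernel.\<close>
lemma av_bound:
  assumes h[measurable]: "h \<in> borel_measurable borel" and E[measurable]: "E \<in> sets borel"
    and B: "\<And>z. \<omega> z \<noteq> 0 \<Longrightarrow> lp_int p E (\<lambda>x. h (x - a - s *\<^sub>R stretch A z)) \<le> B"
  shows "lp_int p E (\<lambda>x. av \<omega> A s h (x - a)) \<le> ennreal ((2 * W) powr p * W) * B"
proof -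
  have "lp_int p E (\<lambda>x. av \<omega> A s h (x - a)) \<le>
    (\<integral>\<^sup>+x. ennreal ((2 * W) powr p) * (\<integral>\<^sup>+z. ennreal (\<bar>h (x - a - s *\<^sub>R stretch A z)\<bar> powr p * \<bar>\<omega> z\<bar>) \<partial>lborel) * indicator E x \<partial>lborel)"
    unfolding av_def by (intro nn_integral_mono mult_right_mono power_integral_le W p) auto
  also have "\<dots> = ennreal ((2 * W) powr p) * (\<integral>\<^sup>+x. \<integral>\<^sup>+z. ennreal (\<bar>h (x - a - s *\<^sub>R stretch A z)\<bar> powr p * \<bar>\<omega> z\<bar>) * indicator E x \<partial>lborel \<partial>lborel)"
    by (simp add: mult.assoc nn_integral_cmult flip: nn_integral_multc)
  also have "(\<integral>\<^sup>+x. \<integral>\<^sup>+z. ennreal (\<bar>h (x - a - s *\<^sub>R stretch A z)\<bar> powr p * \<bar>\<omega> z\<bar>) * indicator E x \<partial>lborel \<partial>lborel)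
      = (\<integral>\<^sup>+z. \<integral>\<^sup>+x. ennreal (\<bar>h (x - a - s *\<^sub>R stretch A z)\<bar> powr p * \<bar>\<omega> z\<bar>) * indicator E x \<partial>lborel \<partial>lborel)"
    by (rule lborel_pair.Fubini') measurable
  also have "\<dots> = (\<integral>\<^sup>+z. ennreal \<bar>\<omega> z\<bar> * lp_int p E (\<lambda>x. h (x - a - s *\<^sub>R stretch A z)) \<partial>lborel)"
    by (intro nn_integral_cong, subst nn_integral_cmult[symmetric]) (auto simp: ennreal_mult mult_ac intro!: nn_integral_cong)
  also have "\<dots> \<le> (\<integral>\<^sup>+z. ennreal \<bar>\<omega> z\<bar> * B \<partial>lborel)"
  proof (rule nn_integral_mono)
    fix z show "ennreal \<bar>\<omega> z\<bar> * lp_int p E (\<lambda>x. h (x - a - s *\<^sub>R stretch A z)) \<le> ennreal \<bar>\<omega> z\<bar> * B"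
      using B[of z] by (cases "\<omega> z = 0") (auto intro: mult_left_mono)
  qed
  also have "\<dots> = (\<integral>\<^sup>+z. ennreal \<bar>\<omega> z\<bar> \<partial>lborel) * B" by (rule nn_integral_multc) measurable
  also have "\<dots> \<le> ennreal W * B" by (intro mult_right_mono W) auto
  finally show ?thesis using W(1) by (simp add: ennreal_mult mult_left_mono mult.assoc)
qed

text \<open>The constant for the Taylor remainder of order \<open>m\<close>: the number of lists of length \<open>m\<close>, the
  length \<open>5 (1 + A)\<close> of the segments, and Jensen's constants for the integrals over \<open>z\<close> and over the
  parameter of the segment.\<close>
definition remainder_bound :: "nat \<Rightarrow> real" where
  "remainder_bound m = real (card {js :: 'n list. length js = m}) powr p * (((5 * (1 + A)) ^ m) powr p * ((2 * W) powr p * (2 powr p * W)))"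

text \<open>The base point \<open>x - s stretch A e\<close> does not depend on \<open>\<sigma>\<close>, and by the moment conditions the average of
  the Taylor polynomial is its value at \<open>x\<close>. So the first summand is common to all scales \<open>s \<sigma>\<close>.\<close>
lemma taylor_average:
  assumes u: "smooth u" and m: "0 < m" "m \<le> l" and s: "s > 0"
  defines "e \<equiv> axis last_ix 1 :: 'n rvec"
  shows "av \<omega> A (s * \<sigma>) u x = (\<Sum>i<m. (\<Sum>js | length js = i. pds js u (x - s *\<^sub>R stretch A e) * monom_at js (s *\<^sub>R stretch A e)) / fact i)
    + (\<integral>z. (\<Sum>js | length js = m. monom_at js (s *\<^sub>R stretch A (e - \<sigma> *\<^sub>R z)) *
        (\<integral>t. pds js u (x - s *\<^sub>R stretch A (e + t *\<^sub>R (\<sigma> *\<^sub>R z - e))) * (indicator {0..1} t * ((1 - t) ^ (m - 1) / fact (m - 1))) \<partial>lborel)) * \<omega> z \<partial>lborel)"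
    (is "_ = ?P + (\<integral>z. ?R z * \<omega> z \<partial>lborel)")
proof -
  let ?y = "x - s *\<^sub>R stretch A e" and ?h = "\<lambda>z. s *\<^sub>R stretch A (e - \<sigma> *\<^sub>R z)"
  note lin = linear_add[OF linear_stretch] linear_diff[OF linear_stretch] linear_scale[OF linear_stretch]
  define Q where "Q z = (\<Sum>i<m. (\<Sum>js | length js = i. pds js u ?y * monom_at js (?h z)) / fact i)" for z
  have eq: "u (x - (s * \<sigma>) *\<^sub>R stretch A z) = Q z + ?R z" for z
  proof -
    have 1: "?y + ?h z = x - (s * \<sigma>) *\<^sub>R stretch A z" by (simp add: lin algebra_simps)
    have 2: "?y + t *\<^sub>R ?h z = x - s *\<^sub>R stretch A (e + t *\<^sub>R (\<sigma> *\<^sub>R z - e))" for t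
      by (simp add: lin algebra_simps)
    show ?thesis using taylor_line[OF u m(1), of ?y "?h z"] unfolding 1 2 Q_def .
  qed
  have ih: "integrable lborel (\<lambda>z. monom_at js (?h z) * \<omega> z)" for js
    by (intro continuous_test_integrable[OF _ test] continuous_intros)
  have Qe: "Q z * \<omega> z = (\<Sum>i<m. \<Sum>js | length js = i. (pds js u ?y / fact i) * (monom_at js (?h z) * \<omega> z))" for z
    unfolding Q_def by (simp add: sum_distrib_left sum_distrib_right sum_divide_distrib mult_ac)
  have iQ: "integrable lborel (\<lambda>z. Q z * \<omega> z)"
    unfolding Qe using ih by (intro Bochner_Integration.integrable_sum integrable_mult_right)
  have mom: "(\<integral>z. monom_at js (?h z) * \<omega> z \<partial>lborel) = monom_at js (s *\<^sub>R stretch A e)" if "length js \<le> l" for js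
  proof -
    let ?L = "\<lambda>j. if j = last_ix then A else 1"
    have 1: "(\<chi> j. s * ?L j * e $ j - s * \<sigma> * ?L j * z $ j) = ?h z" for z
      by (auto simp: vec_eq_iff stretch_def diag_mult_def algebra_simps)
    have 2: "(\<chi> j. s * ?L j * e $ j) = s *\<^sub>R stretch A e"
      by (auto simp: vec_eq_iff stretch_def diag_mult_def)
    have "(\<integral>z. (monom_at [] z * monom_at js (?h z)) * \<omega> z \<partial>lborel) = monom_at js (s *\<^sub>R stretch A e)"
      using moments_shift[of "[]" js "\<lambda>j. s * ?L j * e $ j" "\<lambda>j. s * \<sigma> * ?L j"] that
      unfolding 1 2 by simp
    then show ?thesis by (simp add: monom_at_def)
  qed
  have "(\<integral>z. Q z * \<omega> z \<partial>lborel) = (\<Sum>i<m. \<Sum>js | length js = i. (pds js u ?y / fact i) * (\<integral>z. monom_at js (?h z) * \<omega> z \<partial>lborel))"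
    unfolding Qe using ih by (simp add: Bochner_Integration.integral_sum)
  also have "\<dots> = ?P"
    unfolding sum_divide_distrib using m(2) by (intro sum.cong refl) (auto simp: mom)
  finally have P: "(\<integral>z. Q z * \<omega> z \<partial>lborel) = ?P" .
  have iu: "integrable lborel (\<lambda>z. u (x - (s * \<sigma>) *\<^sub>R stretch A z) * \<omega> z)"
    by (intro continuous_test_integrable[OF _ test] continuous_on_compose2[OF smooth_continuous[OF u]] continuous_intros) auto
  have "?R z * \<omega> z = u (x - (s * \<sigma>) *\<^sub>R stretch A z) * \<omega> z - Q z * \<omega> z" for z
    unfolding eq by (simp add: algebra_simps)
  then have "(\<integral>z. ?R z * \<omega> z \<partial>lborel) = av \<omega> A (s * \<sigma>) u x - ?P"
    using iu iQ P by (simp add: av_def Bochner_Integration.integral_diff)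
  then show ?thesis by simp
qed

end

lemma ennreal_double: "0 \<le> c \<Longrightarrow> ennreal (2 * c) = ennreal c + ennreal c"
  using ennreal_plus[of c c] by simp

text \<open>Exchanging the integrals reduces a bound for a parameter integral to a bound that is uniform
  in the parameter; this replaces any change of variables in the Taylor remainder.\<close>
lemma nn_integral_weighted_sup:
  fixes F :: "'a::euclidean_space \<Rightarrow> 'b::euclidean_space \<Rightarrow> ennreal"
  assumes [measurable]: "(\<lambda>(x, z). F x z) \<in> borel_measurable (borel \<Otimes>\<^sub>M borel)" "w \<in> borel_measurable borel"
    and B: "\<And>z. w z \<noteq> 0 \<Longrightarrow> (\<integral>\<^sup>+x. F x z \<partial>lborel) \<le> B"
  shows "(\<integral>\<^sup>+x. \<integral>\<^sup>+z. w z * F x z \<partial>lborel \<partial>lborel) \<le> (\<integral>\<^sup>+z. w z \<partial>lborel) * B"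
proof -
  have "(\<integral>\<^sup>+x. \<integral>\<^sup>+z. w z * F x z \<partial>lborel \<partial>lborel) = (\<integral>\<^sup>+z. \<integral>\<^sup>+x. w z * F x z \<partial>lborel \<partial>lborel)"
    by (rule lborel_pair.Fubini') measurable
  also have "\<dots> = (\<integral>\<^sup>+z. w z * (\<integral>\<^sup>+x. F x z \<partial>lborel) \<partial>lborel)"
    by (intro nn_integral_cong nn_integral_cmult) measurable
  also have "\<dots> \<le> (\<integral>\<^sup>+z. w z * B \<partial>lborel)"
  proof (rule nn_integral_mono)
    fix z show "w z * (\<integral>\<^sup>+x. F x z \<partial>lborel) \<le> w z * B"
      using B[of z] by (cases "w z = 0") (auto intro: mult_left_mono)
  qed
  also have "\<dots> = (\<integral>\<^sup>+z. w z \<partial>lborel) * B" by (rule nn_integral_multc) measurable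
  finally show ?thesis .
qed

context mollifier
begin

lemma segment_Z0:
  assumes "\<omega> z \<noteq> 0" "0 \<le> t" "t \<le> 1" "1 \<le> \<sigma>" "\<sigma> \<le> 4"
  defines "e \<equiv> axis last_ix 1 :: 'n rvec"
  shows "e + t *\<^sub>R (\<sigma> *\<^sub>R z - e) \<in> Z0" "norm (e - \<sigma> *\<^sub>R z) \<le> 5"
proof -
  note z = w_nz[OF assms(1)]
  have eq: "e + t *\<^sub>R (\<sigma> *\<^sub>R z - e) = (1 - t) *\<^sub>R e + t *\<^sub>R (\<sigma> *\<^sub>R z)" by (simp add: algebra_simps)
  have ne: "norm e = 1" by (simp add: e_def norm_axis_1)
  have "\<sigma> * norm z \<le> 4 * 1" using assms z by (intro mult_mono) auto
  then have nz: "norm (\<sigma> *\<^sub>R z) \<le> 4" using assms by simp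
  then show "norm (e - \<sigma> *\<^sub>R z) \<le> 5" using norm_triangle_ineq4[of e "\<sigma> *\<^sub>R z"] ne by simp
  have "norm ((1 - t) *\<^sub>R e + t *\<^sub>R (\<sigma> *\<^sub>R z)) \<le> (1 - t) * norm e + t * norm (\<sigma> *\<^sub>R z)"
    using assms norm_triangle_ineq[of "(1 - t) *\<^sub>R e" "t *\<^sub>R (\<sigma> *\<^sub>R z)"] by simp
  also have "\<dots> \<le> (1 - t) * 4 + t * 4" using assms ne nz by (intro add_mono mult_left_mono) auto
  finally have 1: "norm (e + t *\<^sub>R (\<sigma> *\<^sub>R z - e)) \<le> 4" unfolding eq by simp
  have "1 * (1/2) \<le> \<sigma> * z $ last_ix" using z assms by (intro mult_mono) auto
  then have "(1 - t) * (1/2) + t * (1/2) \<le> (1 - t) * 1 + t * (\<sigma> * z $ last_ix)"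
    using assms by (intro add_mono mult_left_mono) auto
  moreover have "(e + t *\<^sub>R (\<sigma> *\<^sub>R z - e)) $ last_ix = (1 - t) * 1 + t * (\<sigma> * z $ last_ix)"
    unfolding eq by (simp add: e_def axis_def)
  moreover have "(1 - t) * (1/2) + t * (1/2) = 1/2" by (simp add: field_simps)
  ultimately have "1/2 \<le> (e + t *\<^sub>R (\<sigma> *\<^sub>R z - e)) $ last_ix" by linarith
  with 1 show "e + t *\<^sub>R (\<sigma> *\<^sub>R z - e) \<in> Z0" by (simp add: Z0_def)
qed

text \<open>The second summand of \<open>taylor_average\<close>.\<close>
definition taylor_rem :: "('n rvec \<Rightarrow> real) \<Rightarrow> nat \<Rightarrow> real \<Rightarrow> real \<Rightarrow> 'n rvec \<Rightarrow> real" where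
  "taylor_rem u m s \<sigma> x = (\<integral>z. (\<Sum>js | length js = m. monom_at js (s *\<^sub>R stretch A (axis last_ix 1 - \<sigma> *\<^sub>R z)) *
        (\<integral>t. pds js u (x - s *\<^sub>R stretch A (axis last_ix 1 + t *\<^sub>R (\<sigma> *\<^sub>R z - axis last_ix 1))) * (indicator {0..1} t * ((1 - t) ^ (m - 1) / fact (m - 1))) \<partial>lborel)) * \<omega> z \<partial>lborel)"

text \<open>All segments run through points \<open>x - s stretch A \<zeta>\<close> with \<open>\<zeta>\<close> in the convex set \<open>Z0\<close>, so the
  remainder is an average of the derivatives of order \<open>m\<close> over such translates, times \<open>s\<^sup>m\<close>.\<close>
lemma taylor_rem_bound:
  assumes u: "smooth u" and s: "s > 0" and \<sigma>: "1 \<le> \<sigma>" "\<sigma> \<le> 4"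
    and E[measurable]: "E \<in> sets borel"
    and B: "\<And>js \<zeta>. length js = m \<Longrightarrow> \<zeta> \<in> Z0 \<Longrightarrow>
      lp_int p E (\<lambda>x. pds js u (x - s *\<^sub>R stretch A \<zeta>)) \<le> B js"
  shows "lp_int p E (taylor_rem u m s \<sigma>)
    \<le> ennreal (remainder_bound m * (s ^ m) powr p) * (\<Sum>js | length js = m. B js)"
proof -
  let ?e = "axis last_ix 1 :: 'n rvec"
  define \<zeta> where "\<zeta> z t = ?e + t *\<^sub>R (\<sigma> *\<^sub>R z - ?e)" for z t
  define c where "c t = indicator {0..1} t * ((1 - t) ^ (m - 1) / fact (m - 1))" for t :: real
  define I where "I js x z = (\<integral>t. pds js u (x - s *\<^sub>R stretch A (\<zeta> z t)) * c t \<partial>lborel)" for js x z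
  define N where "N = card {js :: 'n list. length js = m}"
  define H where "H = ((5 * (1 + A)) ^ m * s ^ m) powr p"
  have [measurable]: "pds js u \<in> borel_measurable borel" for js by (intro smooth_measurable smooth_pds u)
  have [measurable]: "c \<in> borel_measurable borel" unfolding c_def[abs_def] by measurable
  have c: "\<bar>c t\<bar> \<le> indicator {0..1} t" for t
  proof (cases "t \<in> {0..1}")
    case True
    then have "(1 - t) ^ (m - 1) \<le> 1" "(1 - t) ^ (m - 1) \<ge> 0" by (auto intro: power_le_one)
    moreover have "(1 - t) ^ (m - 1) \<le> fact (m - 1)"
      by (rule order_trans[OF calculation(1) fact_ge_1])
    ultimately show ?thesis using True by (simp add: c_def)
  qed (simp add: c_def)
  have [measurable]: "(\<lambda>(x, z, t). pds js u (x - s *\<^sub>R stretch A (\<zeta> z t))) \<in> borel_measurable (borel \<Otimes>\<^sub>M borel \<Otimes>\<^sub>M borel)" for js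
    unfolding \<zeta>_def by measurable
  define J where "J js x z = (\<integral>\<^sup>+t. indicator {0..1} t * ennreal (\<bar>pds js u (x - s *\<^sub>R stretch A (\<zeta> z t))\<bar> powr p) \<partial>lborel)" for js x z
  have IJ: "ennreal (\<bar>I js x z\<bar> powr p) \<le> ennreal (2 powr p) * J js x z" for js x z
  proof -
    have "(\<integral>\<^sup>+t. ennreal \<bar>c t\<bar> \<partial>lborel) \<le> (\<integral>\<^sup>+t. indicator {0..1} t \<partial>(lborel :: real measure))"
      using c by (intro nn_integral_mono) (metis ennreal_indicator ennreal_leI)
    then have "ennreal (\<bar>I js x z\<bar> powr p) \<le> ennreal ((2 * 1) powr p) * (\<integral>\<^sup>+t. ennreal (\<bar>pds js u (x - s *\<^sub>R stretch A (\<zeta> z t))\<bar> powr p * \<bar>c t\<bar>) \<partial>lborel)"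
      unfolding I_def using p by (intro power_integral_le) (auto simp: \<zeta>_def)
    also have "\<dots> \<le> ennreal (2 powr p) * J js x z"
      unfolding J_def mult_1_right
    proof (intro mult_left_mono nn_integral_mono)
      fix t
      have "ennreal (\<bar>pds js u (x - s *\<^sub>R stretch A (\<zeta> z t))\<bar> powr p * \<bar>c t\<bar>) \<le> ennreal (\<bar>pds js u (x - s *\<^sub>R stretch A (\<zeta> z t))\<bar> powr p * indicator {0..1} t)"
        using c[of t] by (intro ennreal_leI mult_left_mono) auto
      then show "ennreal (\<bar>pds js u (x - s *\<^sub>R stretch A (\<zeta> z t))\<bar> powr p * \<bar>c t\<bar>) \<le> indicator {0..1} t * ennreal (\<bar>pds js u (x - s *\<^sub>R stretch A (\<zeta> z t))\<bar> powr p)"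
        by (simp add: ennreal_mult ennreal_indicator mult.commute)
    qed simp
    finally show ?thesis .
  qed
  define S where "S x z = (\<Sum>js | length js = m. monom_at js (s *\<^sub>R stretch A (?e - \<sigma> *\<^sub>R z)) * I js x z)" for x z
  have SJ: "ennreal (\<bar>S x z\<bar> powr p) \<le> ennreal (real N powr p * H * 2 powr p) * (\<Sum>js | length js = m. J js x z)" if z: "\<omega> z \<noteq> 0" for x z
  proof -
    have "ennreal (\<bar>S x z\<bar> powr p) \<le> ennreal (real N powr p) * (\<Sum>js | length js = m. ennreal (\<bar>monom_at js (s *\<^sub>R stretch A (?e - \<sigma> *\<^sub>R z)) * I js x z\<bar> powr p))"
      unfolding S_def N_def by (intro ennreal_power_sum_le finite_lists_of_length p)
    also have "\<dots> \<le> ennreal (real N powr p) * (\<Sum>js | length js = m. ennreal (H * 2 powr p) * J js x z)"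
    proof (intro mult_left_mono sum_mono)
      fix js :: "'n list" assume js: "js \<in> {js. length js = m}"
      have "norm (s *\<^sub>R stretch A (?e - \<sigma> *\<^sub>R z)) \<le> s * ((1 + A) * 5)"
      proof -
        have "(1 + A) * norm (?e - \<sigma> *\<^sub>R z) \<le> (1 + A) * 5"
          using segment_Z0(2)[OF z, of 1 \<sigma>] \<sigma> A by (intro mult_left_mono) auto
        then have "norm (stretch A (?e - \<sigma> *\<^sub>R z)) \<le> (1 + A) * 5"
          using norm_stretch_le[of A "?e - \<sigma> *\<^sub>R z"] A by linarith
        then show ?thesis using s by (simp add: mult_left_mono)
      qed
      then have "norm (s *\<^sub>R stretch A (?e - \<sigma> *\<^sub>R z)) ^ m \<le> (s * ((1 + A) * 5)) ^ m"
        by (intro power_mono) auto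
      also have "\<dots> = (5 * (1 + A)) ^ m * s ^ m" by (simp add: power_mult_distrib mult_ac)
      finally have "\<bar>monom_at js (s *\<^sub>R stretch A (?e - \<sigma> *\<^sub>R z))\<bar> \<le> (5 * (1 + A)) ^ m * s ^ m"
        using abs_monom_at_le[of js "s *\<^sub>R stretch A (?e - \<sigma> *\<^sub>R z)"] js by (simp del: norm_scaleR)
      then have "\<bar>monom_at js (s *\<^sub>R stretch A (?e - \<sigma> *\<^sub>R z))\<bar> powr p \<le> H"
        unfolding H_def using p by (intro powr_mono2) auto
      then have "ennreal (\<bar>monom_at js (s *\<^sub>R stretch A (?e - \<sigma> *\<^sub>R z)) * I js x z\<bar> powr p) \<le> ennreal (H * \<bar>I js x z\<bar> powr p)"
        by (intro ennreal_leI) (simp add: abs_mult powr_mult mult_right_mono)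
      also have "\<dots> = ennreal H * ennreal (\<bar>I js x z\<bar> powr p)" by (simp add: H_def ennreal_mult)
      also have "\<dots> \<le> ennreal H * (ennreal (2 powr p) * J js x z)" by (intro mult_left_mono IJ) auto
      finally show "ennreal (\<bar>monom_at js (s *\<^sub>R stretch A (?e - \<sigma> *\<^sub>R z)) * I js x z\<bar> powr p) \<le> ennreal (H * 2 powr p) * J js x z"
        by (simp add: H_def ennreal_mult mult.assoc)
    qed simp
    finally show ?thesis by (simp add: sum_distrib_left[symmetric] ennreal_mult mult.assoc H_def)
  qed
  have [measurable]: "(\<lambda>(x, z). I js x z) \<in> borel_measurable (borel \<Otimes>\<^sub>M borel)" for js
    unfolding I_def \<zeta>_def c_def by measurable
  have [measurable]: "(\<lambda>(x, z). J js x z) \<in> borel_measurable (borel \<Otimes>\<^sub>M borel)" for js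
    unfolding J_def \<zeta>_def by measurable
  have [measurable]: "monom_at js \<in> borel_measurable borel" for js
    by (intro borel_measurable_continuous_onI monom_at_continuous continuous_on_id)
  have [measurable]: "(\<lambda>(x, z). S x z) \<in> borel_measurable (borel \<Otimes>\<^sub>M borel)"
    unfolding S_def by measurable
  define K where "K = (2 * W) powr p * (real N powr p * H * 2 powr p)"
  have K0: "K \<ge> 0" by (simp add: K_def H_def)
  have pt: "ennreal (\<bar>taylor_rem u m s \<sigma> x\<bar> powr p) \<le> ennreal K * (\<integral>\<^sup>+z. ennreal \<bar>\<omega> z\<bar> * (\<Sum>js | length js = m. J js x z) \<partial>lborel)" for x
  proof -
    have "ennreal (\<bar>\<integral>z. S x z * \<omega> z \<partial>lborel\<bar> powr p) \<le> ennreal ((2 * W) powr p) * (\<integral>\<^sup>+z. ennreal (\<bar>S x z\<bar> powr p * \<bar>\<omega> z\<bar>) \<partial>lborel)"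
      by (intro power_integral_le p W) auto
    also have "\<dots> \<le> ennreal ((2 * W) powr p) * (\<integral>\<^sup>+z. ennreal (real N powr p * H * 2 powr p) * (ennreal \<bar>\<omega> z\<bar> * (\<Sum>js | length js = m. J js x z)) \<partial>lborel)"
    proof (intro mult_left_mono nn_integral_mono)
      fix z
      show "ennreal (\<bar>S x z\<bar> powr p * \<bar>\<omega> z\<bar>) \<le> ennreal (real N powr p * H * 2 powr p) * (ennreal \<bar>\<omega> z\<bar> * (\<Sum>js | length js = m. J js x z))"
      proof (cases "\<omega> z = 0")
        case False
        from mult_right_mono[OF SJ[OF False, of x], of "ennreal \<bar>\<omega> z\<bar>"]
        show ?thesis by (simp add: ennreal_mult mult_ac)
      qed simp
    qed simp
    also have "\<dots> = ennreal K * (\<integral>\<^sup>+z. ennreal \<bar>\<omega> z\<bar> * (\<Sum>js | length js = m. J js x z) \<partial>lborel)"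
      by (subst nn_integral_cmult) (auto simp: K_def ennreal_mult H_def mult.assoc)
    finally show ?thesis unfolding taylor_rem_def S_def I_def c_def \<zeta>_def .
  qed
  have JB: "(\<integral>\<^sup>+x. indicator E x * J js x z \<partial>lborel) \<le> B js" if z: "\<omega> z \<noteq> 0" and js: "length js = m" for z js
  proof -
    have "(\<integral>\<^sup>+x. indicator E x * J js x z \<partial>lborel) = (\<integral>\<^sup>+x. \<integral>\<^sup>+t. indicator {0..1} t * (indicator E x * ennreal (\<bar>pds js u (x - s *\<^sub>R stretch A (\<zeta> z t))\<bar> powr p)) \<partial>lborel \<partial>lborel)"
      unfolding J_def by (subst nn_integral_cmult[symmetric]) (auto simp: mult_ac \<zeta>_def)
    also have "\<dots> \<le> (\<integral>\<^sup>+t. indicator {0..1} t \<partial>(lborel :: real measure)) * B js"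
    proof (rule nn_integral_weighted_sup)
      fix t :: real assume "indicator {0..1} t \<noteq> (0 :: ennreal)"
      then have t: "0 \<le> t" "t \<le> 1" by (auto simp: indicator_def split: if_splits)
      have "\<zeta> z t \<in> Z0" unfolding \<zeta>_def by (rule segment_Z0(1)[OF z t \<sigma>])
      from B[OF js this] show "(\<integral>\<^sup>+x. indicator E x * ennreal (\<bar>pds js u (x - s *\<^sub>R stretch A (\<zeta> z t))\<bar> powr p) \<partial>lborel) \<le> B js"
        by (simp add: mult.commute)
    qed (auto simp: \<zeta>_def)
    finally show ?thesis by simp
  qed
  have "lp_int p E (taylor_rem u m s \<sigma>)
    \<le> (\<integral>\<^sup>+x. ennreal K * (\<integral>\<^sup>+z. ennreal \<bar>\<omega> z\<bar> * (indicator E x * (\<Sum>js | length js = m. J js x z)) \<partial>lborel) \<partial>lborel)"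
  proof (rule nn_integral_mono)
    fix x
    have "(\<integral>\<^sup>+z. ennreal \<bar>\<omega> z\<bar> * (indicator E x * (\<Sum>js | length js = m. J js x z)) \<partial>lborel)
       = indicator E x * (\<integral>\<^sup>+z. ennreal \<bar>\<omega> z\<bar> * (\<Sum>js | length js = m. J js x z) \<partial>lborel)"
      by (subst nn_integral_cmult[symmetric]) (auto simp: mult_ac)
    then show "ennreal (\<bar>taylor_rem u m s \<sigma> x\<bar> powr p) * indicator E x \<le> ennreal K * (\<integral>\<^sup>+z. ennreal \<bar>\<omega> z\<bar> * (indicator E x * (\<Sum>js | length js = m. J js x z)) \<partial>lborel)"
      using mult_right_mono[OF pt[of x], of "indicator E x"] by (simp add: mult_ac)
  qed
  also have "\<dots> = ennreal K * (\<integral>\<^sup>+x. \<integral>\<^sup>+z. ennreal \<bar>\<omega> z\<bar> * (indicator E x * (\<Sum>js | length js = m. J js x z)) \<partial>lborel \<partial>lborel)"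
    by (rule nn_integral_cmult) measurable
  also have "\<dots> \<le> ennreal K * ((\<integral>\<^sup>+z. ennreal \<bar>\<omega> z\<bar> \<partial>lborel) * (\<Sum>js | length js = m. B js))"
  proof (intro mult_left_mono nn_integral_weighted_sup)
    fix z assume "ennreal \<bar>\<omega> z\<bar> \<noteq> 0"
    then have z: "\<omega> z \<noteq> 0" by auto
    have "(\<integral>\<^sup>+x. indicator E x * (\<Sum>js | length js = m. J js x z) \<partial>lborel) = (\<Sum>js | length js = m. \<integral>\<^sup>+x. indicator E x * J js x z \<partial>lborel)"
      unfolding sum_distrib_left by (subst nn_integral_sum) auto
    also have "\<dots> \<le> (\<Sum>js | length js = m. B js)" by (intro sum_mono JB[OF z]) auto
    finally show "(\<integral>\<^sup>+x. indicator E x * (\<Sum>js | length js = m. J js x z) \<partial>lborel) \<le> (\<Sum>js | length js = m. B js)" .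
  qed auto
  also have "\<dots> \<le> ennreal K * (ennreal W * (\<Sum>js | length js = m. B js))"
    by (intro mult_left_mono mult_right_mono W) auto
  also have "\<dots> = ennreal (K * W) * (\<Sum>js | length js = m. B js)"
    using K0 W(1) by (simp add: ennreal_mult mult.assoc)
  also have "K * W = remainder_bound m * (s ^ m) powr p"
  proof -
    have "H = ((5 * (1 + A)) ^ m) powr p * (s ^ m) powr p" unfolding H_def using s A by (simp add: powr_mult)
    then show ?thesis unfolding K_def remainder_bound_def N_def by (simp add: mult_ac)
  qed
  finally show ?thesis .
qed

lemma poincare_smooth:
  assumes u: "smooth u" and m: "0 < m" "m \<le> l" and s: "s > 0" and \<sigma>: "1 \<le> \<sigma>" "\<sigma> \<le> 4"
    and E[measurable]: "E \<in> sets borel"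
    and B: "\<And>js \<zeta>. length js = m \<Longrightarrow> \<zeta> \<in> Z0 \<Longrightarrow>
      lp_int p E (\<lambda>x. pds js u (x - s *\<^sub>R stretch A \<zeta>)) \<le> B js"
  shows "lp_int p E (\<lambda>x. av \<omega> A (s * \<sigma>) u x - av \<omega> A s u x)
    \<le> ennreal (2 powr p * (2 * (remainder_bound m * (s ^ m) powr p))) * (\<Sum>js | length js = m. B js)"
proof -
  let ?R = "\<lambda>\<sigma> x. ennreal (\<bar>taylor_rem u m s \<sigma> x\<bar> powr p)"
  have d: "av \<omega> A (s * \<sigma>) u x - av \<omega> A s u x = taylor_rem u m s \<sigma> x - taylor_rem u m s 1 x" for x
    using taylor_average[OF u m s, of \<sigma> x] taylor_average[OF u m s, of 1 x] by (simp add: taylor_rem_def)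
  have [measurable]: "taylor_rem u m s \<sigma> \<in> borel_measurable borel" for \<sigma>
  proof -
    have [measurable]: "pds js u \<in> borel_measurable borel" "monom_at js \<in> borel_measurable borel" for js
      by (intro smooth_measurable smooth_pds u borel_measurable_continuous_onI monom_at_continuous continuous_on_id)+
    show ?thesis unfolding taylor_rem_def[abs_def] by measurable
  qed
  have "lp_int p E (\<lambda>x. av \<omega> A (s * \<sigma>) u x - av \<omega> A s u x) \<le>
      (\<integral>\<^sup>+x. ennreal (2 powr p) * (?R \<sigma> x * indicator E x + ?R 1 x * indicator E x) \<partial>lborel)"
    unfolding d
    by (intro nn_integral_mono order_trans[OF mult_right_mono[OF ennreal_power_diff_le[OF p]]])
      (auto simp: algebra_simps)
  also have "\<dots> = ennreal (2 powr p) * ((\<integral>\<^sup>+x\<in>E. ?R \<sigma> x \<partial>lborel) + (\<integral>\<^sup>+x\<in>E. ?R 1 x \<partial>lborel))"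
    by (subst nn_integral_cmult, measurable, subst nn_integral_add) auto
  also have "\<dots> \<le> ennreal (2 powr p) * (ennreal (remainder_bound m * (s ^ m) powr p) * (\<Sum>js | length js = m. B js)
      + ennreal (remainder_bound m * (s ^ m) powr p) * (\<Sum>js | length js = m. B js))"
    using s \<sigma> by (intro mult_left_mono add_mono taylor_rem_bound[OF u s _ _ E B]) auto
  also have "\<dots> = ennreal (2 powr p * (2 * (remainder_bound m * (s ^ m) powr p))) * (\<Sum>js | length js = m. B js)"
  proof -
    define c where "c = remainder_bound m * (s ^ m) powr p"
    have "c \<ge> 0" using W(1) by (simp add: c_def remainder_bound_def)
    then have "ennreal (2 powr p * (2 * c)) = ennreal (2 powr p) * (ennreal c + ennreal c)"
      using ennreal_double[of c] by (simp add: ennreal_mult)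
    then show ?thesis unfolding c_def[symmetric] by (simp only: distrib_right distrib_left mult.assoc)
  qed
  finally show ?thesis .
qed

end

section \<open>A Poincare inequality for averages at comparable scales\<close>

context mollifier
begin

definition poincare_const :: "nat \<Rightarrow> real" where
  "poincare_const m = 2 powr p * (2 * ((1 + remainder_bound m) * ((2 * W) powr p * W)))"

lemma remainder_bound_nonneg: "remainder_bound m \<ge> 0"
  using W(1) by (simp add: remainder_bound_def)

lemma scaled_w_in_Z: "\<omega> z \<noteq> 0 \<Longrightarrow> 1 \<le> \<sigma> \<Longrightarrow> \<sigma> \<le> 4 \<Longrightarrow> \<sigma> *\<^sub>R z \<in> Z0"
  using segment_Z0(1)[of z 1 \<sigma>] by simp

lemma Z0_plus_w:
  assumes "\<zeta> \<in> Z0" "z \<in> supp \<omega>" "0 \<le> r" "r \<le> 1"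
  shows "\<zeta> + r *\<^sub>R z \<in> Z"
proof -
  have z: "norm z \<le> 1" "1/2 \<le> z $ last_ix" using supp_w assms by auto
  have "r * norm z \<le> 1 * 1" using assms z by (intro mult_mono) auto
  then have "norm (\<zeta> + r *\<^sub>R z) \<le> 5"
    using assms norm_triangle_ineq[of \<zeta> "r *\<^sub>R z"] by (simp add: Z0_def)
  moreover have "0 \<le> r * z $ last_ix" using assms z by simp
  ultimately show ?thesis using assms by (simp add: Z_def Z0_def)
qed

lemma Z0_subset_Z: "Z0 \<subseteq> Z" by (auto simp: Z0_def Z_def)

lemma stretch_add: "stretch A (x + y) = stretch A x + stretch A y"
  and stretch_scale: "stretch A (c *\<^sub>R x) = c *\<^sub>R stretch A x"
  using linear_add[OF linear_stretch] linear_scale[OF linear_stretch] by blast+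

lemma av_measurable [measurable]:
  assumes [measurable]: "h \<in> borel_measurable borel" shows "av \<omega> A s h \<in> borel_measurable borel"
  unfolding av_def[abs_def] by measurable

lemma average_difference_le_sum:
  assumes [measurable]: "a \<in> borel_measurable borel" "b \<in> borel_measurable borel" "E \<in> sets borel"
  shows "lp_int p E (\<lambda>x. a x - b x) \<le>
    ennreal (2 powr p) * (lp_int p E a + lp_int p E b)"
proof -
  have "lp_int p E (\<lambda>x. a x - b x) \<le>
      (\<integral>\<^sup>+x. ennreal (2 powr p) * (ennreal (\<bar>a x\<bar> powr p) * indicator E x + ennreal (\<bar>b x\<bar> powr p) * indicator E x) \<partial>lborel)"
    by (intro nn_integral_mono order_trans[OF mult_right_mono[OF ennreal_power_diff_le[OF p]]])
      (auto simp: algebra_simps)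
  also have "\<dots> = ennreal (2 powr p) * (lp_int p E a + lp_int p E b)"
    by (subst nn_integral_cmult, measurable, subst nn_integral_add) auto
  finally show ?thesis .
qed

text \<open>The outer average is integration against a test function, so weak convergence of the inner
  averages suffices for pointwise convergence.\<close>
lemma iterated_average_tendsto:
  assumes v: "loc_int v" and s: "s > 0"
  shows "((\<lambda>\<epsilon>. av \<omega> A s (av \<omega> A \<epsilon> v) x) \<longlongrightarrow> av \<omega> A s v x) (at_right 0)"
proof -
  let ?k = "kern \<omega> A s"
  have k: "test_function UNIV ?k" by (rule test_function_kern[OF test s A])
  then have ck: "continuous_on UNIV ?k" by (simp add: test_function_def smooth_continuous)
  obtain B R where B: "\<And>x. \<bar>?k x\<bar> \<le> B" and R: "\<And>x. norm x > R \<Longrightarrow> ?k x = 0"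
    using test_function_bounds[OF k, of "[]"] by (metis foldr.simps(1) id_apply)
  have cz: "continuous_on UNIV (\<lambda>y. ?k (x - y))"
    by (intro continuous_on_compose2[OF ck] continuous_intros) auto
  have lim: "((\<lambda>\<epsilon>. \<integral>y. av \<omega> A \<epsilon> v y * ?k (x - y) \<partial>lborel) \<longlongrightarrow> (\<integral>y. v y * ?k (x - y) \<partial>lborel)) (at_right 0)"
  proof (rule av_weak_tendsto[OF test int1 A borel_measurable_continuous_onI[OF cz], of B "norm x + R"])
    show "?k (x - y) = 0" if "norm y > norm x + R" for y
      using that R[of "x - y"] norm_triangle_ineq3[of y x] by (simp add: norm_minus_commute)
    show "isCont (\<lambda>y. ?k (x - y)) y" for y using cz by (simp add: continuous_on_eq_continuous_at)
  qed (use B v in auto)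
  have e: "av \<omega> A s h x = (\<integral>y. h y * ?k (x - y) \<partial>lborel)" if "h \<in> borel_measurable borel" for h
    using av_eq_conv[OF test s A that] by (simp add: conv_def)
  have "v \<in> borel_measurable borel" using v by (simp add: loc_int_def)
  then show ?thesis using lim
    by (simp only: e[OF av_measurable[OF \<open>v \<in> borel_measurable borel\<close>]] e[OF \<open>v \<in> borel_measurable borel\<close>])
qed

text \<open>For smooth functions this is \<open>poincare_smooth\<close>. The function \<open>D []\<close> is mollified at a small scale \<open>\<epsilon>\<close>; near
  the points that occur its derivatives are mollifications of the weak derivatives, and the additional
  shift by \<open>\<epsilon>\<close> is absorbed in the passage from \<open>Z0\<close> to \<open>Z\<close>. Then \<open>\<epsilon>\<close> tends to 0 by Fatou's lemma.\<close>
lemma poincare_weak: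
  assumes D: "\<And>js. length js \<le> l \<Longrightarrow> loc_int (D js)"
    and wk: "\<And>js. length js \<le> l \<Longrightarrow> weakly U js (D []) (D js)"
    and bm: "length b + m \<le> l" and s: "s > 0" and \<sigma>: "1 \<le> \<sigma>" "\<sigma> \<le> 4"
    and E[measurable]: "E \<in> sets borel"
    and EU: "\<And>x \<zeta>. x \<in> E \<Longrightarrow> \<zeta> \<in> Z \<Longrightarrow> x - s *\<^sub>R stretch A \<zeta> \<in> U"
    and B: "\<And>js \<zeta>. length js = m \<Longrightarrow> \<zeta> \<in> Z \<Longrightarrow>
      lp_int p E (\<lambda>x. D (js @ b) (x - s *\<^sub>R stretch A \<zeta>)) \<le> B js"
  shows "lp_int p E (\<lambda>x. av \<omega> A (s * \<sigma>) (D b) x - av \<omega> A s (D b) x)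
    \<le> ennreal (poincare_const m * (s ^ m) powr p) * (\<Sum>js | length js = m. B js)"
proof (cases "m = 0")
  case True
  let ?c = "(2 * W) powr p * W"
  have Db[measurable]: "D b \<in> borel_measurable borel" using D[of b] bm by (simp add: loc_int_def)
  have avb: "lp_int p E (\<lambda>x. av \<omega> A (s * \<sigma>) (D b) x) \<le> ennreal ?c * B []"
    if \<sigma>: "1 \<le> \<sigma>" "\<sigma> \<le> 4" for \<sigma>
  proof -
    have "lp_int p E (\<lambda>x. av \<omega> A (s * \<sigma>) (D b) (x - 0)) \<le> ennreal ?c * B []"
    proof (rule av_bound[OF Db E])
      fix z assume "\<omega> z \<noteq> 0"
      then have "\<sigma> *\<^sub>R z \<in> Z" using scaled_w_in_Z[OF _ \<sigma>] Z0_subset_Z by blast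
      from B[OF _ this, of "[]"] True
      show "lp_int p E (\<lambda>x. D b (x - 0 - (s * \<sigma>) *\<^sub>R stretch A z)) \<le> B []"
        by (simp add: stretch_scale)
    qed
    then show ?thesis by simp
  qed
  have "lp_int p E (\<lambda>x. av \<omega> A (s * \<sigma>) (D b) x - av \<omega> A s (D b) x)
    \<le> ennreal (2 powr p) * (ennreal ?c * B [] + ennreal ?c * B [])"
    using avb[OF \<sigma>] avb[of 1]
    by (intro order_trans[OF average_difference_le_sum] mult_left_mono add_mono) auto
  also have "\<dots> = ennreal (2 powr p * (2 * ?c)) * B []"
  proof -
    have "ennreal (2 powr p * (2 * ?c)) = ennreal (2 powr p) * (ennreal ?c + ennreal ?c)"
      using W(1) ennreal_double[of ?c] by (simp add: ennreal_mult)
    then show ?thesis by (simp only: distrib_right distrib_left mult.assoc)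
  qed
  also have "\<dots> \<le> ennreal (poincare_const m * (s ^ m) powr p) * B []"
    unfolding poincare_const_def using True W(1) remainder_bound_nonneg[of m]
    by (intro mult_right_mono ennreal_leI) (auto intro!: mult_left_mono simp: algebra_simps)
  also have "B [] = (\<Sum>js | length js = m. B js)" using True by simp
  finally show ?thesis .
next
  case False
  let ?c = "(2 * W) powr p * W"
  have lb: "length b \<le> l" using bm by simp
  have Dj: "loc_int (D (js @ b))" "D (js @ b) \<in> borel_measurable borel" if "length js = m" for js
    using D[of "js @ b"] bm that by (auto simp: loc_int_def)
  have f0: "loc_int (D [])" using D[of "[]"] by simp
  have Db[measurable]: "D b \<in> borel_measurable borel" using D[OF lb] by (simp add: loc_int_def)
  define u where "u \<epsilon> = pds b (av \<omega> A \<epsilon> (D []))" for \<epsilon>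
  have su: "smooth (u \<epsilon>)" if "\<epsilon> > 0" for \<epsilon>
    unfolding u_def by (intro smooth_pds smooth_av[OF test that A f0])
  have region: "x - s *\<^sub>R stretch A \<zeta> - \<epsilon> *\<^sub>R stretch A z = x - s *\<^sub>R stretch A (\<zeta> + (\<epsilon> / s) *\<^sub>R z)" for x \<zeta> \<epsilon> z
    using s by (simp add: stretch_add stretch_scale algebra_simps)
  have inZ: "\<zeta> + (\<epsilon> / s) *\<^sub>R z \<in> Z" if "\<zeta> \<in> Z0" "z \<in> supp \<omega>" "0 < \<epsilon>" "\<epsilon> \<le> s" for \<zeta> \<epsilon> z
    using that s by (intro Z0_plus_w) auto
  have pu: "pds js (u \<epsilon>) (x - s *\<^sub>R stretch A \<zeta>) = av \<omega> A \<epsilon> (D (js @ b)) (x - s *\<^sub>R stretch A \<zeta>)"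
    if x: "x \<in> E" and z: "\<zeta> \<in> Z0" and e: "0 < \<epsilon>" "\<epsilon> \<le> s" and js: "length js + length b \<le> l" for js x \<zeta> \<epsilon>
  proof -
    have "pds (js @ b) (av \<omega> A \<epsilon> (D [])) (x - s *\<^sub>R stretch A \<zeta>) = av \<omega> A \<epsilon> (D (js @ b)) (x - s *\<^sub>R stretch A \<zeta>)"
    proof (rule pds_av[OF test e(1) A f0 D wk])
      fix w assume w: "w \<in> supp \<omega>"
      show "x - s *\<^sub>R stretch A \<zeta> - \<epsilon> *\<^sub>R stretch A w \<in> U"
        unfolding region by (rule EU[OF x inZ[OF z w e]])
    qed (use js in auto)
    then show ?thesis by (simp add: u_def)
  qed
  have main: "lp_int p E (\<lambda>x. av \<omega> A (s * \<sigma>) (u \<epsilon>) x - av \<omega> A s (u \<epsilon>) x)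
    \<le> ennreal (poincare_const m * (s ^ m) powr p) * (\<Sum>js | length js = m. B js)"
    if e: "0 < \<epsilon>" "\<epsilon> \<le> s" for \<epsilon>
  proof -
    have "lp_int p E (\<lambda>x. av \<omega> A (s * \<sigma>) (u \<epsilon>) x - av \<omega> A s (u \<epsilon>) x)
      \<le> ennreal (2 powr p * (2 * (remainder_bound m * (s ^ m) powr p))) * (\<Sum>js | length js = m. ennreal ?c * B js)"
    proof (rule poincare_smooth[OF su[OF e(1)] _ _ s \<sigma> E])
      show "0 < m" "m \<le> l" using False bm by auto
      fix js \<zeta> assume js: "length (js :: 'n list) = m" and z: "\<zeta> \<in> Z0"
      have "lp_int p E (\<lambda>x. pds js (u \<epsilon>) (x - s *\<^sub>R stretch A \<zeta>))
        = lp_int p E (\<lambda>x. av \<omega> A \<epsilon> (D (js @ b)) (x - s *\<^sub>R stretch A \<zeta>))"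
        using pu[OF _ z e] js bm by (intro nn_integral_cong) (auto simp: indicator_def)
      also have "\<dots> \<le> ennreal ?c * B js"
      proof (rule av_bound[OF Dj(2)[OF js] E])
        fix w assume w: "\<omega> w \<noteq> 0"
        show "lp_int p E (\<lambda>x. D (js @ b) (x - s *\<^sub>R stretch A \<zeta> - \<epsilon> *\<^sub>R stretch A w)) \<le> B js"
          unfolding region by (rule B[OF js inZ[OF z w_nz(1)[OF w] e]])
      qed
      finally show "lp_int p E (\<lambda>x. pds js (u \<epsilon>) (x - s *\<^sub>R stretch A \<zeta>)) \<le> ennreal ?c * B js" .
    qed
    also have "\<dots> = ennreal ((2 powr p * (2 * (remainder_bound m * (s ^ m) powr p))) * ?c) * (\<Sum>js | length js = m. B js)"
      using W(1) by (subst ennreal_mult) (auto simp: remainder_bound_nonneg sum_distrib_left mult.assoc)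
    also have "\<dots> \<le> ennreal (poincare_const m * (s ^ m) powr p) * (\<Sum>js | length js = m. B js)"
    proof (intro mult_right_mono ennreal_leI)
      have "2 powr p * (2 * (remainder_bound m * (s ^ m) powr p)) * ?c = 2 powr p * (2 * (remainder_bound m * ?c)) * (s ^ m) powr p"
        by (simp only: mult_ac)
      also have "\<dots> \<le> poincare_const m * (s ^ m) powr p"
        unfolding poincare_const_def using W(1) by (intro mult_right_mono mult_left_mono) auto
      finally show "2 powr p * (2 * (remainder_bound m * (s ^ m) powr p)) * ?c \<le> poincare_const m * (s ^ m) powr p" .
    qed simp
    finally show ?thesis .
  qed
  have avu: "av \<omega> A (s * \<tau>) (u \<epsilon>) x = av \<omega> A (s * \<tau>) (av \<omega> A \<epsilon> (D b)) x"
    if x: "x \<in> E" and e: "0 < \<epsilon>" "\<epsilon> \<le> s" and \<tau>: "1 \<le> \<tau>" "\<tau> \<le> 4" for x \<epsilon> \<tau>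
    unfolding av_def[of \<omega> A "s * \<tau>"]
  proof (rule Bochner_Integration.integral_cong[OF refl])
    fix z
    show "u \<epsilon> (x - (s * \<tau>) *\<^sub>R stretch A z) * \<omega> z = av \<omega> A \<epsilon> (D b) (x - (s * \<tau>) *\<^sub>R stretch A z) * \<omega> z"
    proof (cases "\<omega> z = 0")
      case False
      from pu[OF x scaled_w_in_Z[OF False \<tau>] e, of "[]"] lb show ?thesis by (simp add: stretch_scale)
    qed simp
  qed
  define \<epsilon> where "\<epsilon> n = s / real (Suc n)" for n
  have e: "0 < \<epsilon> n" "\<epsilon> n \<le> s" for n using s by (auto simp: \<epsilon>_def divide_le_eq)
  have e0: "filterlim \<epsilon> (at_right 0) sequentially"
    unfolding filterlim_at
    using LIMSEQ_Suc[OF lim_const_over_n[of s]] e by (auto simp: \<epsilon>_def[abs_def])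
  define d where "d n x = av \<omega> A (s * \<sigma>) (u (\<epsilon> n)) x - av \<omega> A s (u (\<epsilon> n)) x" for n x
  have dm[measurable]: "d n \<in> borel_measurable borel" for n
    unfolding d_def[abs_def] using smooth_measurable[OF su[OF e(1)]] by measurable
  have lim: "(\<lambda>n. ennreal (\<bar>d n x\<bar> powr p) * indicator E x) \<longlonglongrightarrow>
      ennreal (\<bar>av \<omega> A (s * \<sigma>) (D b) x - av \<omega> A s (D b) x\<bar> powr p) * indicator E x" for x
  proof (cases "x \<in> E")
    case True
    have "(\<lambda>n. av \<omega> A (s * \<tau>) (u (\<epsilon> n)) x) \<longlonglongrightarrow> av \<omega> A (s * \<tau>) (D b) x" if \<tau>: "1 \<le> \<tau>" "\<tau> \<le> 4" for \<tau>
      unfolding avu[OF True e \<tau>]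
      using s \<tau> by (intro filterlim_compose[OF iterated_average_tendsto[OF D[OF lb]] e0]) auto
    from this[OF \<sigma>] this[of 1] have "(\<lambda>n. d n x) \<longlonglongrightarrow> av \<omega> A (s * \<sigma>) (D b) x - av \<omega> A s (D b) x"
      unfolding d_def by (auto intro: tendsto_diff)
    then have "(\<lambda>n. \<bar>d n x\<bar> powr p) \<longlonglongrightarrow> \<bar>av \<omega> A (s * \<sigma>) (D b) x - av \<omega> A s (D b) x\<bar> powr p"
      using p by (intro tendsto_powr' tendsto_rabs tendsto_const) auto
    then show ?thesis using True by (auto intro: tendsto_ennrealI)
  qed simp
  have "lp_int p E (\<lambda>x. av \<omega> A (s * \<sigma>) (D b) x - av \<omega> A s (D b) x)
      = (\<integral>\<^sup>+x. liminf (\<lambda>n. ennreal (\<bar>d n x\<bar> powr p) * indicator E x) \<partial>lborel)"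
    using lim_imp_Liminf[OF sequentially_bot lim] by simp
  also have "\<dots> \<le> liminf (\<lambda>n. \<integral>\<^sup>+x\<in>E. ennreal (\<bar>d n x\<bar> powr p) \<partial>lborel)"
    by (rule nn_integral_liminf) measurable
  also have "\<dots> \<le> limsup (\<lambda>n. \<integral>\<^sup>+x\<in>E. ennreal (\<bar>d n x\<bar> powr p) \<partial>lborel)"
    by (rule Liminf_le_Limsup) simp
  also have "\<dots> \<le> ennreal (poincare_const m * (s ^ m) powr p) * (\<Sum>js | length js = m. B js)"
    using main[OF e] by (intro Limsup_bounded) (auto simp: d_def)
  finally show ?thesis .
qed

end

section \<open>Dyadic layers outside a Lipschitz graph\<close>

lemma card_int_le_of_diam:
  fixes J :: "int set"
  assumes "\<And>i j. i \<in> J \<Longrightarrow> j \<in> J \<Longrightarrow> i < j \<Longrightarrow> j - i < int N" "N > 0"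
  shows "finite J \<and> card J \<le> N"
proof (cases "J = {}")
  case False
  then obtain j0 where j0: "j0 \<in> J" by auto
  have "J \<subseteq> {j0 - int N .. j0 + int N}"
  proof
    fix j assume j: "j \<in> J"
    show "j \<in> {j0 - int N .. j0 + int N}"
      using assms(1)[OF j j0] assms(1)[OF j0 j] by (cases j j0 rule: linorder_cases) auto
  qed
  then have fin: "finite J" using finite_subset by blast
  define m where "m = Min J"
  have m: "m \<in> J" "\<And>j. j \<in> J \<Longrightarrow> m \<le> j" using fin False by (auto simp: m_def)
  have "J \<subseteq> {m..<m + int N}"
  proof
    fix j assume j: "j \<in> J"
    show "j \<in> {m..<m + int N}" using assms(1)[OF m(1) j] m(2)[OF j] assms(2) by (cases "m = j") auto
  qed
  then have "card J \<le> card {m..<m + int N}" by (intro card_mono) auto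
  then show ?thesis using fin by simp
qed auto

lemma nn_integral_lborel_translate:
  fixes h :: "'a::euclidean_space \<Rightarrow> ennreal"
  assumes [measurable]: "h \<in> borel_measurable borel"
  shows "(\<integral>\<^sup>+y. h (y - a) \<partial>lborel) = (\<integral>\<^sup>+y. h y \<partial>lborel)"
proof -
  have "(\<integral>\<^sup>+y. h y \<partial>lborel) = (\<integral>\<^sup>+y. h y \<partial>distr lborel borel ((+) (- a)))"
    by (simp add: lborel_distr_plus)
  also have "\<dots> = (\<integral>\<^sup>+y. h (y - a) \<partial>lborel)" by (subst nn_integral_distr) auto
  finally show ?thesis by simp
qed

text \<open>A ball of radius \<open>K r\<close> is covered by a fixed number of balls of radius \<open>r / 2\<close>. Such a ball either
  misses \<open>U\<close>, where nothing is integrated, or lies in a ball of radius \<open>r\<close> about one of its points in \<open>U\<close>.\<close>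
lemma nn_integral_ball_cover:
  fixes U :: "'a::euclidean_space set" and K :: real
  shows "\<exists>N::nat. \<forall>h S x r. h \<in> borel_measurable borel \<longrightarrow> (\<forall>y. y \<notin> U \<longrightarrow> h y = 0) \<longrightarrow> r > 0 \<longrightarrow>
     (\<forall>w\<in>U. (\<integral>\<^sup>+y\<in>ball w r. h y \<partial>lborel) \<le> S) \<longrightarrow> (\<integral>\<^sup>+y\<in>ball x (K * r). h y \<partial>lborel) \<le> of_nat N * S"
proof -
  obtain C :: "'a set" where C: "finite C" "cball 0 K \<subseteq> (\<Union>c\<in>C. ball c (1/2))"
    using compact_cball[of "0::'a" K] unfolding compact_eq_totally_bounded by (metis half_gt_zero zero_less_one)
  show ?thesis
  proof (intro exI[of _ "card C"] allI impI)
    fix h :: "'a \<Rightarrow> ennreal" and S x r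
    assume h[measurable]: "h \<in> borel_measurable borel" and h0: "\<forall>y. y \<notin> U \<longrightarrow> h y = 0" and r: "r > (0::real)"
      and S: "\<forall>w\<in>U. (\<integral>\<^sup>+y\<in>ball w r. h y \<partial>lborel) \<le> S"
    have cov: "indicator (ball x (K * r)) y \<le> (\<Sum>c\<in>C. indicator (ball (x + r *\<^sub>R c) (r / 2)) y :: ennreal)" for y
    proof (cases "y \<in> ball x (K * r)")
      case True
      then have "(1 / r) *\<^sub>R (y - x) \<in> cball 0 K"
      proof -
        have "norm ((1 / r) *\<^sub>R (y - x)) = norm (y - x) / r" using r by simp
        also have "\<dots> \<le> K" using True r by (simp add: dist_norm norm_minus_commute divide_le_eq)
        finally show ?thesis by (simp add: dist_norm)
      qed
      then obtain c where c: "c \<in> C" "norm (c - (1 / r) *\<^sub>R (y - x)) < 1 / 2"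
        using subsetD[OF C(2)] unfolding UN_iff mem_ball dist_norm by blast
      have "norm (x + r *\<^sub>R c - y) = norm (r *\<^sub>R (c - (1 / r) *\<^sub>R (y - x)))"
        using r by (simp add: algebra_simps)
      also have "\<dots> = r * norm (c - (1 / r) *\<^sub>R (y - x))" using r by simp
      also have "\<dots> < r * (1/2)" using c r by (intro mult_strict_left_mono) auto
      finally have "y \<in> ball (x + r *\<^sub>R c) (r / 2)" by (simp add: dist_norm)
      then have "(1 :: ennreal) = indicator (ball (x + r *\<^sub>R c) (r / 2)) y" by simp
      also have "\<dots> \<le> (\<Sum>c\<in>C. indicator (ball (x + r *\<^sub>R c) (r / 2)) y)"
        using c C(1) by (intro member_le_sum) auto
      finally show ?thesis using True by simp
    qed simp
    have each: "(\<integral>\<^sup>+y. h y * indicator (ball c (r / 2)) y \<partial>lborel) \<le> S" for c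
    proof (cases "ball c (r / 2) \<inter> U = {}")
      case True
      then have e: "h y * indicator (ball c (r / 2)) y = 0" for y
        using h0 by (cases "y \<in> U") (auto simp: indicator_def)
      show ?thesis by (simp only: e nn_integral_const mult_zero_left zero_le)
    next
      case False
      then obtain w where w: "w \<in> U" "dist c w < r / 2" by auto
      have "ball c (r / 2) \<subseteq> ball w r"
      proof
        fix y assume "y \<in> ball c (r / 2)"
        then show "y \<in> ball w r" using w(2) dist_triangle[of w y c] by (simp add: dist_commute)
      qed
      then have "(\<integral>\<^sup>+y. h y * indicator (ball c (r / 2)) y \<partial>lborel) \<le> (\<integral>\<^sup>+y\<in>ball w r. h y \<partial>lborel)"
        by (intro nn_integral_mono mult_left_mono) (auto simp: indicator_def)
      then show ?thesis using S w(1) by (meson order_trans)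
    qed
    have "(\<integral>\<^sup>+y\<in>ball x (K * r). h y \<partial>lborel) \<le> (\<integral>\<^sup>+y. (\<Sum>c\<in>C. h y * indicator (ball (x + r *\<^sub>R c) (r / 2)) y) \<partial>lborel)"
      unfolding sum_distrib_left[symmetric] by (intro nn_integral_mono mult_left_mono cov) auto
    also have "\<dots> = (\<Sum>c\<in>C. \<integral>\<^sup>+y. h y * indicator (ball (x + r *\<^sub>R c) (r / 2)) y \<partial>lborel)"
      by (rule nn_integral_sum) (simp, intro borel_measurable_times_ennreal borel_measurable_indicator h, simp)
    also have "\<dots> \<le> (\<Sum>c\<in>C. S)" by (intro sum_mono each)
    finally show "(\<integral>\<^sup>+y\<in>ball x (K * r). h y \<partial>lborel) \<le> of_nat (card C) * S" by simp
  qed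
qed

text \<open>The scale of the layer with index \<open>j\<close>.\<close>
definition sc :: "int \<Rightarrow> real" where "sc j = 2 powi (- j)"

lemma sc_pos [simp]: "sc j > 0" by (simp add: sc_def)

lemma sc_nonneg [simp]: "sc j \<ge> 0" by (simp add: sc_def)

lemma sc_diff: "i \<le> j \<Longrightarrow> sc i = 2 ^ nat (j - i) * sc j"
proof -
  assume "i \<le> j"
  then have "2 powi (- i) = (2::real) powi (int (nat (j - i)) + (- j))" by simp
  also have "\<dots> = 2 powi (int (nat (j - i))) * 2 powi (- j)" by (rule power_int_add) simp
  finally show ?thesis by (simp only: sc_def power_int_of_nat)
qed

lemma sc_mono: "i \<le> j \<Longrightarrow> sc j \<le> sc i"
  using sc_diff[of i j] mult_right_mono[of 1 "2 ^ nat (j - i)" "sc j"] by simp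

lemma sc_minus: "sc (j - int n) = 2 ^ n * sc j" using sc_diff[of "j - int n" j] by simp

lemma sc_diff_less:
  assumes "i < j" "sc i \<le> b * sc j" "b < 2 ^ N" shows "j - i < int N"
proof -
  have "2 ^ nat (j - i) * sc j \<le> b * sc j"
    using assms sc_diff[of i j] by simp
  then have "2 ^ nat (j - i) \<le> b" by simp
  then have "(2::real) ^ nat (j - i) < 2 ^ N" using assms(3) by linarith
  then have "nat (j - i) < N" using power_strict_increasing_iff[of "2::real" "nat (j - i)" N] by linarith
  then show ?thesis using assms(1) by linarith
qed

lemma sc_tendsto_0: "(\<lambda>n. sc (int n)) \<longlonglongrightarrow> 0"
proof -
  have "sc (int n) = (1/2) ^ n" for n
    by (simp add: sc_def power_int_minus power_one_over inverse_eq_divide)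
  then show ?thesis by (simp add: LIMSEQ_realpow_zero)
qed

lemma exists_sc_interval:
  assumes "t > 0" shows "\<exists>j. sc j < t \<and> t \<le> 2 * sc j"
proof -
  define j where "j = - (\<lceil>log 2 t\<rceil> - 1)"
  have s: "sc j = 2 powr (real_of_int (\<lceil>log 2 t\<rceil> - 1))" unfolding sc_def j_def by (subst powr_real_of_int') auto
  have "sc j < 2 powr (log 2 t)" unfolding s by (intro powr_less_mono) linarith+
  moreover have "2 powr (log 2 t) \<le> 2 powr (real_of_int (\<lceil>log 2 t\<rceil> - 1) + 1)"
    by (intro powr_mono) linarith+
  ultimately show ?thesis using assms by (intro exI[of _ j]) (simp add: s powr_diff powr_log_cancel)
qed

locale burenkov = mollifier \<omega> A p l
  for \<omega> :: "'n::{finite,linorder} rvec \<Rightarrow> real" and A M p l +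
  fixes vphi :: "'n rvec \<Rightarrow> real" and \<psi> :: "int \<Rightarrow> 'n rvec \<Rightarrow> real"
  assumes M: "M > 0" and A_eq: "A = 16 * (M + 1)"
    and lip: "\<And>x y. \<bar>vphi (hbar x) - vphi (hbar y)\<bar> \<le> M * norm (hbar x - hbar y)"
    and part: "burenkov_partition vphi \<psi>"
begin

abbreviation "\<rho> \<equiv> rho vphi"
abbreviation "\<Omega> \<equiv> Omega vphi"
abbreviation "G \<equiv> G_set vphi"
abbreviation "AA \<equiv> 16 * (M + 1)"

lemma norm_hbar_le: "norm (hbar x) \<le> norm x"
  by (intro norm_le_componentwise_cart) (auto simp: hbar_def)

lemma hbar_diff: "hbar x - hbar y = hbar (x - y)"
  by (auto simp: hbar_def vec_eq_iff)

lemma rho_lipschitz: "\<bar>\<rho> x - \<rho> y\<bar> \<le> (1 + M) * norm (x - y)"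
proof -
  have "\<bar>x $ last_ix - y $ last_ix\<bar> \<le> norm (x - y)"
    using component_le_norm_cart[of "x - y" last_ix] by simp
  moreover have "\<bar>vphi (hbar x) - vphi (hbar y)\<bar> \<le> M * norm (x - y)"
    using lip[of x y] norm_hbar_le[of "x - y"] M unfolding hbar_diff
    by (smt (verit) mult_left_mono)
  ultimately show ?thesis unfolding rho_def by (simp add: algebra_simps)
qed

lemma rho_continuous: "continuous_on UNIV \<rho>"
proof -
  have "(1 + M)-lipschitz_on UNIV \<rho>"
    using rho_lipschitz M by (intro lipschitz_onI) (auto simp: dist_norm)
  then show ?thesis by (rule lipschitz_on_continuous_on)
qed

lemma rho_measurable [measurable]: "\<rho> \<in> borel_measurable borel"
  by (rule borel_measurable_continuous_onI[OF rho_continuous])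

lemma Omega_eq: "\<Omega> = {x. \<rho> x < 0}" by (auto simp: Omega_def rho_def)

lemma open_Omega: "open \<Omega>" unfolding Omega_eq
  by (intro open_Collect_less rho_continuous continuous_on_const)

lemma rho_shift_last: "\<rho> (x - t *\<^sub>R axis last_ix 1) = \<rho> x - t"
proof -
  have "hbar (x - t *\<^sub>R axis last_ix 1) = hbar x" by (auto simp: hbar_def vec_eq_iff axis_def)
  then show ?thesis by (simp add: rho_def axis_def)
qed

text \<open>Points of the graph are limits of the points vertically below them.\<close>
lemma closure_Omega: "closure \<Omega> = {x. \<rho> x \<le> 0}"
proof
  have "closed {x. \<rho> x \<le> 0}" by (intro closed_Collect_le rho_continuous continuous_on_const)
  then show "closure \<Omega> \<subseteq> {x. \<rho> x \<le> 0}" unfolding Omega_eq by (intro closure_minimal) auto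
  show "{x. \<rho> x \<le> 0} \<subseteq> closure \<Omega>"
  proof
    fix x assume x: "x \<in> {x. \<rho> x \<le> 0}"
    have "(\<lambda>n. x - (1 / real (Suc n)) *\<^sub>R axis last_ix 1) \<longlonglongrightarrow> x - 0 *\<^sub>R axis last_ix 1"
      by (intro tendsto_intros LIMSEQ_Suc[OF lim_1_over_n])
    moreover have "x - (1 / real (Suc n)) *\<^sub>R axis last_ix 1 \<in> \<Omega>" for n
      using x unfolding Omega_eq mem_Collect_eq rho_shift_last by (auto intro: le_less_trans)
    ultimately show "x \<in> closure \<Omega>" unfolding closure_sequential by force
  qed
qed

lemma G_eq: "G = {x. \<rho> x > 0}" unfolding G_set_def closure_Omega by auto

text \<open>The graph is the image of a hyperplane under a Lipschitz map.\<close>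
lemma boundary_null: "{x. \<rho> x = 0} \<in> null_sets lborel"
proof -
  let ?S = "{x :: 'n rvec. axis last_ix 1 \<bullet> x = 0}"
  let ?f = "\<lambda>x :: 'n rvec. x + vphi (hbar x) *\<^sub>R axis last_ix 1"
  have "negligible (?f ` ?S)"
  proof (rule negligible_locally_Lipschitz_image)
    show "negligible ?S" by (intro negligible_hyperplane) (auto simp: axis_eq_0_iff)
    fix x :: "'n rvec"
    have "norm (?f y - ?f x) \<le> (1 + M) * norm (y - x)" for y
    proof -
      have "?f y - ?f x = (y - x) + (vphi (hbar y) - vphi (hbar x)) *\<^sub>R axis last_ix 1"
        by (simp add: algebra_simps)
      then have "norm (?f y - ?f x) \<le> norm (y - x) + \<bar>vphi (hbar y) - vphi (hbar x)\<bar>"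
        by (simp only:) (rule order_trans[OF norm_triangle_ineq], simp add: norm_axis_1)
      also have "\<bar>vphi (hbar y) - vphi (hbar x)\<bar> \<le> M * norm (y - x)"
        using lip[of y x] norm_hbar_le[of "y - x"] M unfolding hbar_diff by (smt (verit) mult_left_mono)
      finally show ?thesis by (simp add: algebra_simps)
    qed
    then show "\<exists>T B. open T \<and> x \<in> T \<and> (\<forall>y\<in>?S \<inter> T. norm (?f y - ?f x) \<le> B * norm (y - x))"
      by (intro exI[of _ UNIV] exI[of _ "1 + M"]) auto
  qed simp
  moreover have "{x. \<rho> x = 0} \<subseteq> ?f ` ?S"
  proof
    fix x assume "x \<in> {x. \<rho> x = 0}"
    then have x: "x $ last_ix = vphi (hbar x)" by (simp add: rho_def)
    have hh: "hbar (hbar x) = hbar x" by (auto simp: hbar_def vec_eq_iff)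
    have "?f (hbar x) = x" unfolding hh using x by (auto simp: hbar_def vec_eq_iff axis_def)
    moreover have "hbar x \<in> ?S" by (simp add: inner_axis' hbar_def)
    ultimately show "x \<in> ?f ` ?S" by (rule image_eqI[OF sym])
  qed
  ultimately have "negligible {x. \<rho> x = 0}" using negligible_subset by blast
  then have "{x. \<rho> x = 0} \<in> null_sets lebesgue" by (simp add: negligible_iff_null_sets)
  moreover have "{x. \<rho> x = 0} \<in> sets borel" by measurable
  ultimately show ?thesis by (simp add: null_sets_def)
qed

text \<open>The stretch by \<open>16 (M + 1)\<close> beats the Lipschitz constant: a shift by \<open>s stretch A \<zeta>\<close> lowers \<open>rho\<close> by
  at least \<open>8 (M + 1) s\<close> through the last coordinate, and raises it by at most \<open>5 M s\<close> through the others.\<close>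
lemma rho_stretch_explicit:
  assumes "\<zeta> \<in> Z" "s > 0"
  shows "\<rho> (x - s *\<^sub>R stretch AA \<zeta>) \<le> \<rho> x - (3 * M + 8) * s"
    and "\<rho> (x - s *\<^sub>R stretch AA \<zeta>) \<ge> \<rho> x - (85 * M + 80) * s"
    and "norm (s *\<^sub>R stretch AA \<zeta>) \<le> (85 * M + 85) * s"
proof -
  have z: "norm \<zeta> \<le> 5" "1/2 \<le> \<zeta> $ last_ix" "\<zeta> $ last_ix \<le> 5"
    using assms(1) component_le_norm_cart[of \<zeta> last_ix] by (auto simp: Z_def)
  have h: "hbar (x - s *\<^sub>R stretch AA \<zeta>) = hbar x - s *\<^sub>R hbar \<zeta>"
    by (auto simp: hbar_def vec_eq_iff stretch_def diag_mult_def)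
  have "\<bar>vphi (hbar (x - s *\<^sub>R stretch AA \<zeta>)) - vphi (hbar x)\<bar> \<le> M * norm (hbar (x - s *\<^sub>R stretch AA \<zeta>) - hbar x)"
    by (rule lip)
  also have "\<dots> = M * (s * norm (hbar \<zeta>))" unfolding h using assms by simp
  also have "\<dots> \<le> M * (s * 5)"
    using norm_hbar_le[of \<zeta>] z assms M by (intro mult_left_mono) auto
  finally have v: "\<bar>vphi (hbar (x - s *\<^sub>R stretch AA \<zeta>)) - vphi (hbar x)\<bar> \<le> 5 * M * s" by simp
  have l: "(x - s *\<^sub>R stretch AA \<zeta>) $ last_ix = x $ last_ix - s * (AA * \<zeta> $ last_ix)"
    by (simp add: stretch_def diag_mult_def)
  have "AA * (1/2) \<le> AA * \<zeta> $ last_ix" "AA * \<zeta> $ last_ix \<le> AA * 5"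
    using M mult_left_mono[OF z(2), of AA] mult_left_mono[OF z(3), of AA] by auto
  then have "s * (AA * (1/2)) \<le> s * (AA * \<zeta> $ last_ix)" "s * (AA * \<zeta> $ last_ix) \<le> s * (AA * 5)"
    using assms by auto
  then show "\<rho> (x - s *\<^sub>R stretch AA \<zeta>) \<le> \<rho> x - (3 * M + 8) * s"
    "\<rho> (x - s *\<^sub>R stretch AA \<zeta>) \<ge> \<rho> x - (85 * M + 80) * s"
    using v unfolding rho_def l by (auto simp: algebra_simps)
  have "(1 + AA) * norm \<zeta> \<le> (1 + AA) * 5" using z M by (intro mult_left_mono) auto
  then have "norm (stretch AA \<zeta>) \<le> (1 + AA) * 5"
    using M by (intro order_trans[OF norm_stretch_le]) auto
  then have "s * norm (stretch AA \<zeta>) \<le> s * ((1 + AA) * 5)" using assms by (intro mult_left_mono) auto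
  also have "\<dots> \<le> s * (85 * M + 85)" using assms M by (intro mult_left_mono) auto
  finally show "norm (s *\<^sub>R stretch AA \<zeta>) \<le> (85 * M + 85) * s" using assms by (simp add: mult.commute)
qed

lemmas rho_stretch = rho_stretch_explicit[folded A_eq]

lemma stretch_in_Omega:
  assumes "\<zeta> \<in> Z" "s > 0" "\<rho> x \<le> 2 * s"
  shows "x - s *\<^sub>R stretch A \<zeta> \<in> \<Omega>"
proof -
  have "\<rho> (x - s *\<^sub>R stretch A \<zeta>) \<le> 2 * s - (3 * M + 8) * s" using rho_stretch(1)[OF assms(1,2), of x] assms(3) by linarith
  also have "\<dots> = - (3 * M * s) - 6 * s" by (simp add: algebra_simps)
  also have "\<dots> < 0" using assms(2) M by (smt (verit) mult_pos_pos)
  finally show ?thesis by (simp add: Omega_eq)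
qed

text \<open>Half-open dyadic layers, which partition the complement of the closed domain.\<close>
definition "layer j = {x. sc j < \<rho> x \<and> \<rho> x \<le> 2 * sc j}"

lemma layer_borel [measurable]: "layer j \<in> sets borel" unfolding layer_def by measurable

lemma G_union_layers: "G = (\<Union>j. layer j)"
  using exists_sc_interval by (auto simp: G_eq layer_def intro: less_trans[OF sc_pos])

lemma layer_disjoint: "x \<in> layer i \<Longrightarrow> x \<in> layer j \<Longrightarrow> i = j"
proof -
  have "\<not> i < j" if "x \<in> layer i" "x \<in> layer j" for i j
  proof
    assume "i < j"
    then have "sc (j - 1) \<le> sc i" by (intro sc_mono) auto
    then show False using that sc_minus[of j 1] by (auto simp: layer_def)
  qed
  then show "x \<in> layer i \<Longrightarrow> x \<in> layer j \<Longrightarrow> i = j" by (meson linorder_neqE)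
qed

text \<open>For \<open>sc j \<le> r\<close> the shifted pieces lie in one ball of radius comparable to \<open>r\<close>, at depth comparable to
  \<open>sc j\<close>, so that they overlap at most \<open>N0\<close> times. For \<open>sc j > r\<close> the Lipschitz bound for \<open>rho\<close> leaves at
  most \<open>N0\<close> indices whose layer meets the ball, each with a translate of the ball.\<close>
lemma layer_sum_bound:
  "\<exists>N::nat. \<forall>h S x r. h \<in> borel_measurable borel \<longrightarrow> (\<forall>y. y \<notin> \<Omega> \<longrightarrow> h y = 0) \<longrightarrow> r > 0 \<longrightarrow>
     (\<forall>w\<in>\<Omega>. (\<integral>\<^sup>+y\<in>ball w r. h y \<partial>lborel) \<le> S) \<longrightarrow>
     (\<integral>\<^sup>+j. (SUP \<zeta>\<in>Z. \<integral>\<^sup>+y\<in>ball x r \<inter> layer j. h (y - sc j *\<^sub>R stretch A \<zeta>) \<partial>lborel) \<partial>count_space UNIV) \<le> of_nat N * S"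
proof -
  let ?b = "85 * M + 80" and ?L = "85 * M + 85"
  obtain N0 :: nat where N0: "?b < 2 ^ N0"
    using real_arch_pow[of 2 ?b] by auto
  have N0pos: "N0 > 0" using N0 M by (cases N0) auto
  from nn_integral_ball_cover[of \<Omega> "1 + ?L"] obtain N1 :: nat where N1: "\<forall>h S x r. h \<in> borel_measurable borel \<longrightarrow> (\<forall>y. y \<notin> \<Omega> \<longrightarrow> h y = 0) \<longrightarrow> r > 0 \<longrightarrow>
     (\<forall>w\<in>\<Omega>. (\<integral>\<^sup>+y\<in>ball w r. h y \<partial>lborel) \<le> S) \<longrightarrow> (\<integral>\<^sup>+y\<in>ball x ((1 + ?L) * r). h y \<partial>lborel) \<le> of_nat N1 * S"
    by (rule exE)
  show ?thesis
  proof (intro exI[of _ "N0 * N1 + N0 * N1"] allI impI)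
    fix h :: "'n rvec \<Rightarrow> ennreal" and S x r
    assume h[measurable]: "h \<in> borel_measurable borel" and h0: "\<forall>y. y \<notin> \<Omega> \<longrightarrow> h y = 0" and r: "r > (0::real)"
      and S: "\<forall>w\<in>\<Omega>. (\<integral>\<^sup>+y\<in>ball w r. h y \<partial>lborel) \<le> S"
    note cover = N1[THEN spec, THEN spec, THEN spec, THEN spec, THEN mp, OF h, THEN mp, OF h0, THEN mp, OF r, THEN mp, OF S]
    define Lj where "Lj j = {y. - ?b * sc j \<le> \<rho> y \<and> \<rho> y \<le> - (6 * sc j)}" for j
    have Ljm[measurable]: "Lj j \<in> sets borel" for j unfolding Lj_def by measurable
    define J where "J = {j. sc j > r \<and> ball x r \<inter> layer j \<noteq> {}}"
    have J: "finite J \<and> card J \<le> N0"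
    proof (rule card_int_le_of_diam[OF _ N0pos])
      fix i j assume ij: "i \<in> J" "j \<in> J" "i < j"
      then obtain y1 y2 where y: "y1 \<in> ball x r" "y1 \<in> layer i" "y2 \<in> ball x r" "y2 \<in> layer j" unfolding J_def by blast
      have "norm (y1 - y2) \<le> 2 * sc j"
        using y(1,3) ij(2) dist_triangle[of y1 y2 x] by (auto simp: J_def dist_norm norm_minus_commute)
      then have "(1 + M) * norm (y1 - y2) \<le> (1 + M) * (2 * sc j)" using M by (intro mult_left_mono) auto
      then have "\<rho> y1 - \<rho> y2 \<le> (1 + M) * (2 * sc j)" using rho_lipschitz[of y1 y2] by linarith
      then have "sc i \<le> 2 * sc j + (1 + M) * (2 * sc j)" using y by (auto simp: layer_def)
      also have "\<dots> \<le> ?b * sc j"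
      proof -
        have "(4 + 2 * M) * sc j \<le> ?b * sc j" using M by (intro mult_right_mono) auto
        then show ?thesis by (simp add: algebra_simps)
      qed
      finally show "j - i < int N0" by (rule sc_diff_less[OF ij(3) _ N0])
    qed
    have cardL: "finite {j. y \<in> Lj j} \<and> card {j. y \<in> Lj j} \<le> N0" for y
    proof (rule card_int_le_of_diam[OF _ N0pos])
      fix i j assume ij: "i \<in> {j. y \<in> Lj j}" "j \<in> {j. y \<in> Lj j}" "i < j"
      then have "- ?b * sc j \<le> \<rho> y" "\<rho> y \<le> - (6 * sc i)" by (simp_all add: Lj_def)
      moreover have "- ?b * sc j = - (?b * sc j)" by (simp add: algebra_simps)
      ultimately have "6 * sc i \<le> ?b * sc j" by linarith
      then have "sc i \<le> ?b * sc j" using sc_pos[of i] by linarith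
      then show "j - i < int N0" by (rule sc_diff_less[OF ij(3) _ N0])
    qed
    define c where "c j = (\<integral>\<^sup>+y. h y * indicator (ball x ((1 + ?L) * r)) y * indicator (Lj j) y \<partial>lborel)" for j
    have layer_term: "(\<integral>\<^sup>+y\<in>ball x r \<inter> layer j. h (y - sc j *\<^sub>R stretch A \<zeta>) \<partial>lborel) \<le> c j + of_nat N1 * S * indicator J j"
      if \<zeta>: "\<zeta> \<in> Z" for j \<zeta>
    proof -
      let ?v = "sc j *\<^sub>R stretch A \<zeta>"
      consider "ball x r \<inter> layer j = {}" | "sc j \<le> r" | "j \<in> J" unfolding J_def by force
      then show ?thesis
      proof cases
        case 1 then show ?thesis by simp
      next
        case 2
        have "(\<integral>\<^sup>+y\<in>ball x r \<inter> layer j. h (y - ?v) \<partial>lborel) \<le>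
          (\<integral>\<^sup>+y. h (y - ?v) * indicator (ball x ((1 + ?L) * r)) (y - ?v) * indicator (Lj j) (y - ?v) \<partial>lborel)"
        proof (rule nn_integral_mono)
          fix y
          show "h (y - ?v) * indicator (ball x r \<inter> layer j) y \<le> h (y - ?v) * indicator (ball x ((1 + ?L) * r)) (y - ?v) * indicator (Lj j) (y - ?v)"
          proof (cases "y \<in> ball x r \<inter> layer j")
            case True
            then have y: "norm (x - y) < r" "sc j < \<rho> y" "\<rho> y \<le> 2 * sc j" by (auto simp: layer_def dist_norm)
            have "norm (x - (y - ?v)) \<le> norm (x - y) + norm ?v"
              using norm_triangle_ineq[of "x - y" ?v] by (simp add: algebra_simps)
            moreover have "norm ?v \<le> ?L * r"
              using rho_stretch(3)[OF \<zeta> sc_pos, of j] 2 mult_left_mono[OF 2, of ?L] M by linarith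
            ultimately have "norm (x - (y - ?v)) < (1 + ?L) * r" using y by (simp add: algebra_simps)
            moreover have "- ?b * sc j \<le> \<rho> (y - ?v)"
              using rho_stretch(2)[OF \<zeta> sc_pos, of y j] y sc_pos[of j] by linarith
            moreover have "\<rho> (y - ?v) \<le> - (6 * sc j)"
            proof -
              have "(3 * M + 8) * sc j \<ge> 8 * sc j" using M by (intro mult_right_mono) auto
              then show ?thesis using rho_stretch(1)[OF \<zeta> sc_pos, of y j] y by linarith
            qed
            ultimately show ?thesis using True by (simp add: Lj_def dist_norm)
          qed simp
        qed
        also have "\<dots> = c j" unfolding c_def
          by (rule nn_integral_lborel_translate[of "\<lambda>y. h y * indicator (ball x ((1 + ?L) * r)) y * indicator (Lj j) y"])
            (intro borel_measurable_times_ennreal borel_measurable_indicator h Ljm borel_open open_ball)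
        finally show ?thesis by (simp add: add_increasing2)
      next
        case 3
        have "(\<integral>\<^sup>+y\<in>ball x r \<inter> layer j. h (y - ?v) \<partial>lborel) \<le> (\<integral>\<^sup>+y. h (y - ?v) * indicator (ball (x - ?v) ((1 + ?L) * r)) (y - ?v) \<partial>lborel)"
        proof (rule nn_integral_mono)
          fix y
          have "1 * r \<le> (1 + ?L) * r" using r M by (intro mult_right_mono) auto
          then show "h (y - ?v) * indicator (ball x r \<inter> layer j) y \<le> h (y - ?v) * indicator (ball (x - ?v) ((1 + ?L) * r)) (y - ?v)"
            by (auto simp: indicator_def dist_norm)
        qed
        also have "\<dots> = (\<integral>\<^sup>+y. h y * indicator (ball (x - ?v) ((1 + ?L) * r)) y \<partial>lborel)"
          by (rule nn_integral_lborel_translate[of "\<lambda>y. h y * indicator (ball (x - ?v) ((1 + ?L) * r)) y"])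
            (intro borel_measurable_times_ennreal borel_measurable_indicator h borel_open open_ball)
        also have "\<dots> \<le> of_nat N1 * S" by (rule cover)
        finally show ?thesis using 3 by (simp add: add_increasing)
      qed
    qed
    have "(\<integral>\<^sup>+j. (SUP \<zeta>\<in>Z. \<integral>\<^sup>+y\<in>ball x r \<inter> layer j. h (y - sc j *\<^sub>R stretch A \<zeta>) \<partial>lborel) \<partial>count_space UNIV)
      \<le> (\<integral>\<^sup>+j. c j + of_nat N1 * S * indicator J j \<partial>count_space UNIV)"
      by (intro nn_integral_mono SUP_least layer_term)
    also have "(\<integral>\<^sup>+j. c j + of_nat N1 * S * indicator J j \<partial>count_space UNIV) = (\<integral>\<^sup>+j. c j \<partial>count_space UNIV) + of_nat N1 * S * (\<integral>\<^sup>+j. indicator J j \<partial>count_space UNIV)"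
      by (subst nn_integral_add) (auto simp: nn_integral_cmult)
    finally have 1: "(\<integral>\<^sup>+j. (SUP \<zeta>\<in>Z. \<integral>\<^sup>+y\<in>ball x r \<inter> layer j. h (y - sc j *\<^sub>R stretch A \<zeta>) \<partial>lborel) \<partial>count_space UNIV)
      \<le> (\<integral>\<^sup>+j. c j \<partial>count_space UNIV) + of_nat N1 * S * (\<integral>\<^sup>+j. indicator J j \<partial>count_space UNIV)" .
    have 2: "(\<integral>\<^sup>+j. indicator J j \<partial>count_space UNIV) \<le> (of_nat N0 :: ennreal)"
      using J by (simp add: emeasure_count_space)
    have "(\<integral>\<^sup>+j. c j \<partial>count_space UNIV) = (\<integral>\<^sup>+y. \<integral>\<^sup>+j. h y * indicator (ball x ((1 + ?L) * r)) y * indicator (Lj j) y \<partial>count_space UNIV \<partial>lborel)"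
      unfolding c_def
      by (rule nn_integral_count_space_nn_integral[symmetric], simp, simp,
          intro borel_measurable_times_ennreal borel_measurable_indicator h Ljm borel_open open_ball)
    also have "\<dots> \<le> (\<integral>\<^sup>+y. h y * indicator (ball x ((1 + ?L) * r)) y * of_nat N0 \<partial>lborel)"
    proof (rule nn_integral_mono)
      fix y
      have "(\<integral>\<^sup>+j. indicator (Lj j) y \<partial>count_space UNIV) = (\<integral>\<^sup>+j. indicator {j. y \<in> Lj j} j \<partial>count_space UNIV)"
        by (intro nn_integral_cong) (auto simp: indicator_def)
      also have "\<dots> \<le> of_nat N0" using cardL[of y] by (simp add: emeasure_count_space)
      finally show "(\<integral>\<^sup>+j. h y * indicator (ball x ((1 + ?L) * r)) y * indicator (Lj j) y \<partial>count_space UNIV) \<le> h y * indicator (ball x ((1 + ?L) * r)) y * of_nat N0"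
        by (subst nn_integral_cmult) (auto intro: mult_left_mono)
    qed
    also have "\<dots> = (\<integral>\<^sup>+y\<in>ball x ((1 + ?L) * r). h y \<partial>lborel) * of_nat N0"
      by (rule nn_integral_multc, simp, intro borel_measurable_times_ennreal borel_measurable_indicator h borel_open open_ball)
    also have "\<dots> \<le> of_nat N1 * S * of_nat N0" by (intro mult_right_mono cover) auto
    finally have 3: "(\<integral>\<^sup>+j. c j \<partial>count_space UNIV) \<le> of_nat N1 * S * of_nat N0" .
    have "of_nat (N0 * N1 + N0 * N1) * S = of_nat N1 * S * of_nat N0 + of_nat N1 * S * of_nat N0"
      by (simp add: distrib_left distrib_right mult_ac)
    then show "(\<integral>\<^sup>+j. (SUP \<zeta>\<in>Z. \<integral>\<^sup>+y\<in>ball x r \<inter> layer j. h (y - sc j *\<^sub>R stretch A \<zeta>) \<partial>lborel) \<partial>count_space UNIV) \<le> of_nat (N0 * N1 + N0 * N1) * S"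
      using order_trans[OF 1 add_mono[OF 3 mult_left_mono[OF 2]]] by simp
  qed
qed

end

section \<open>The extension layer by layer\<close>

lemma length_splits: "length (splits js) = 2 ^ length js"
  by (induction js) auto

lemma powi_sc: "2 powi (k * int n) = inverse (sc k) ^ n"
  by (simp add: sc_def power_int_minus power_int_mult power_int_of_nat)

context mollifier
begin

lemma poincare_const_nonneg: "poincare_const m \<ge> 0"
  using W(1) remainder_bound_nonneg[of m] by (simp add: poincare_const_def)

end

context burenkov
begin

lemma psi_smooth: "smooth (\<psi> k)" using part by (simp add: burenkov_partition_def)

lemma psi_supp: assumes "x \<in> supp (\<psi> k)" shows "sc k < 4 * \<rho> x" "\<rho> x \<le> 2 * sc k" "x \<in> G"
proof -
  have L: "x \<in> G_layer vphi m \<longleftrightarrow> x \<in> G \<and> sc (m + 1) < \<rho> x \<and> \<rho> x \<le> sc m" for m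
    by (simp add: G_layer_def sc_def)
  have "x \<in> G_layer vphi (k - 1) \<union> G_layer vphi k \<union> G_layer vphi (k + 1)"
    using part assms unfolding burenkov_partition_def by blast
  then have 1: "(sc k < \<rho> x \<and> \<rho> x \<le> sc (k - 1)) \<or> (sc (k + 1) < \<rho> x \<and> \<rho> x \<le> sc k) \<or> (sc (k + 2) < \<rho> x \<and> \<rho> x \<le> sc (k + 1))"
    unfolding Un_iff L by (auto simp: add.assoc)
  have "sc (k - 1) = 2 * sc k" "sc k = 2 * sc (k + 1)" "sc k = 4 * sc (k + 2)"
    using sc_diff[of "k - 1" k] sc_diff[of k "k + 1"] sc_diff[of k "k + 2"] by simp_all
  then show "sc k < 4 * \<rho> x" "\<rho> x \<le> 2 * sc k" using 1 sc_pos[of k] by linarith+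
  then show "x \<in> G" using sc_pos[of k] unfolding G_eq mem_Collect_eq by linarith
qed

lemma psi_nz: assumes "\<psi> k x \<noteq> 0" shows "sc k < 4 * \<rho> x" "\<rho> x \<le> 2 * sc k" "x \<in> G"
  using psi_supp[OF in_suppI[of "\<psi> k", OF assms]] by auto

lemma psi_sum:
  assumes "x \<in> G" "finite K" "\<And>k. \<psi> k x \<noteq> 0 \<Longrightarrow> k \<in> K"
  shows "(\<Sum>k\<in>K. \<psi> k x) = 1"
proof -
  have "((\<lambda>k. \<psi> k x) has_sum 1) UNIV"
    using part assms(1) unfolding burenkov_partition_def by (metis (full_types))
  moreover have "((\<lambda>k. \<psi> k x) has_sum s) UNIV \<longleftrightarrow> ((\<lambda>k. \<psi> k x) has_sum s) K" for s
    by (rule has_sum_cong_neutral) (use assms(3) in auto)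
  then have "((\<lambda>k. \<psi> k x) has_sum (\<Sum>k\<in>K. \<psi> k x)) UNIV"
    using has_sum_finite[OF assms(2)] by blast
  ultimately show ?thesis using has_sum_unique by blast
qed

lemma psi_deriv_bound_exists: "\<exists>c\<ge>0. \<forall>a k x. length a \<le> l \<longrightarrow> \<bar>pds a (\<psi> k) x\<bar> \<le> c * inverse (sc k) ^ length a"
proof -
  have "\<exists>c. \<forall>x k. \<bar>pds a (\<psi> k) x\<bar> \<le> c * inverse (sc k) ^ length a" for a
    using part unfolding burenkov_partition_def pds_eq_mi_deriv[OF psi_smooth] powi_sc[symmetric]
    by (metis mi_order_count_list)
  then obtain C where C: "\<And>a x k. \<bar>pds a (\<psi> k) x\<bar> \<le> C a * inverse (sc k) ^ length a" by metis
  have fin: "finite {a :: 'n list. length a \<le> l}" using finite_lists_length_le[of "UNIV :: 'n set" l] by simp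
  define c where "c = (\<Sum>a | length a \<le> l. \<bar>C a\<bar>)"
  have "\<bar>pds a (\<psi> k) x\<bar> \<le> c * inverse (sc k) ^ length a" if "length a \<le> l" for a k x
  proof -
    have "C a \<le> \<bar>C a\<bar>" by simp
    also have "\<dots> \<le> c" unfolding c_def using fin that by (intro member_le_sum) auto
    finally show ?thesis using C[where a=a and k=k and x=x] by (smt (verit) mult_right_mono sc_pos zero_le_power inverse_nonnegative_iff_nonnegative)
  qed
  moreover have "c \<ge> 0" by (auto simp: c_def intro: sum_nonneg)
  ultimately show ?thesis by blast
qed

text \<open>One constant for the derivatives of all orders up to \<open>l\<close> of all \<open>\<psi> k\<close>.\<close>
definition "psi_bound = (SOME c. c \<ge> 0 \<and> (\<forall>a k x. length a \<le> l \<longrightarrow> \<bar>pds a (\<psi> k) x\<bar> \<le> c * inverse (sc k) ^ length a))"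

lemma psi_bound: "psi_bound \<ge> 0" "length a \<le> l \<Longrightarrow> \<bar>pds a (\<psi> k) x\<bar> \<le> psi_bound * inverse (sc k) ^ length a"
  using someI_ex[OF psi_deriv_bound_exists] unfolding psi_bound_def by blast+

definition "term_const = psi_bound powr p * (\<Sum>m\<le>l. poincare_const m)"

text \<open>At most 3 indices \<open>k\<close> and \<open>2\<^sup>l\<close> ways of distributing the derivatives enter the estimate on a layer.
  All constants are defined before \<open>f\<close> is fixed, so that they are visibly independent of it.\<close>
definition "local_const = 2 powr p * ((2 * W) powr p * W + (3 * 2 ^ l) powr p * (3 * 2 ^ l * term_const))"

lemma term_const_nonneg: "term_const \<ge> 0"
  unfolding term_const_def using psi_bound(1) by (intro mult_nonneg_nonneg sum_nonneg poincare_const_nonneg) auto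

lemma local_const_nonneg: "local_const \<ge> 0"
  unfolding local_const_def using term_const_nonneg W(1) by simp

lemma supp_w_Z: "z \<in> supp \<omega> \<Longrightarrow> z \<in> Z" using supp_w by (auto simp: Z_def)

end

text \<open>\<open>D js\<close> is a Borel representative, on the whole space, of the weak derivative of \<open>f = D []\<close> along the
  list \<open>js\<close>.\<close>
locale burenkov_family = burenkov \<omega> A M p l vphi \<psi>
  for \<omega> :: "'n::{finite,linorder} rvec \<Rightarrow> real" and A M p l vphi \<psi> +
  fixes D :: "'n list \<Rightarrow> 'n rvec \<Rightarrow> real"
  assumes D_borel: "\<And>js. length js \<le> l \<Longrightarrow> D js \<in> borel_measurable borel"
    and D_zero: "\<And>js y. length js \<le> l \<Longrightarrow> y \<notin> Omega vphi \<Longrightarrow> D js y = 0"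
    and D_Lp: "\<And>js. length js \<le> l \<Longrightarrow> (\<integral>\<^sup>+y. ennreal (\<bar>D js y\<bar> powr p) \<partial>lborel) < \<infinity>"
    and D_weak: "\<And>js. length js \<le> l \<Longrightarrow> weakly (Omega vphi) js (D []) (D js)"
begin

lemma le_one_plus_powr: "u \<ge> 0 \<Longrightarrow> u \<le> 1 + u powr p" for u :: real
proof (cases "u \<le> 1")
  case False
  then have "u powr 1 \<le> u powr p" using p by (intro powr_mono) auto
  then show ?thesis using False by simp
qed (simp add: add_increasing2)

lemma loc_int_of_powr:
  fixes h :: "'n rvec \<Rightarrow> real"
  assumes [measurable]: "h \<in> borel_measurable borel" and fin: "\<And>R. lp_int p (cball 0 R) h < \<infinity>"
  shows "loc_int h"
  unfolding loc_int_def set_integrable_def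
proof (intro conjI allI integrableI_bounded)
  fix R
  have "(\<integral>\<^sup>+y. ennreal (norm (indicat_real (cball 0 R) y *\<^sub>R h y)) \<partial>lborel) \<le> (\<integral>\<^sup>+y. indicator (cball 0 R) y + ennreal (\<bar>h y\<bar> powr p) * indicator (cball 0 R) y \<partial>lborel)"
  proof (rule nn_integral_mono)
    fix y
    have "ennreal \<bar>h y\<bar> \<le> ennreal (1 + \<bar>h y\<bar> powr p)" by (intro ennreal_leI le_one_plus_powr) auto
    then show "ennreal (norm (indicat_real (cball 0 R) y *\<^sub>R h y)) \<le> indicator (cball 0 R) y + ennreal (\<bar>h y\<bar> powr p) * indicator (cball 0 R) y"
      by (cases "y \<in> cball 0 R") (auto simp: ennreal_plus)
  qed
  also have "\<dots> = emeasure lborel (cball (0 :: 'n rvec) R) + lp_int p (cball 0 R) h"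
    by (subst nn_integral_add)
      (simp_all, (intro borel_measurable_indicator borel_measurable_times_ennreal; simp)+)
  also have "\<dots> < \<infinity>" using fin[of R] emeasure_lborel_cball_finite[of "0::'n rvec" R]
    unfolding infinity_ennreal_def ennreal_add_less_top by blast
  finally show "(\<integral>\<^sup>+y. ennreal (norm (indicat_real (cball 0 R) y *\<^sub>R h y)) \<partial>lborel) < \<infinity>" .
qed (use assms(1) in \<open>auto intro!: borel_measurable_times borel_measurable_indicator\<close>)

lemma D_loc: assumes "length js \<le> l" shows "loc_int (D js)"
proof (rule loc_int_of_powr[OF D_borel[OF assms]])
  fix R
  have "lp_int p (cball 0 R) (D js) \<le> (\<integral>\<^sup>+y. ennreal (\<bar>D js y\<bar> powr p) \<partial>lborel)"
    by (intro nn_integral_mono) (auto simp: indicator_def)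
  then show "lp_int p (cball 0 R) (D js) < \<infinity>" using D_Lp[OF assms] by (rule le_less_trans)
qed

text \<open>The averages of the extension operator; for the Borel representative they are smooth everywhere.\<close>
definition "fk k = av \<omega> A (sc k) (D [])"

lemma fk_smooth: "smooth (fk k)"
  unfolding fk_def by (intro smooth_av[OF test sc_pos A] D_loc) auto

lemma pds_fk:
  assumes "\<rho> x \<le> 2 * sc k" "length b \<le> l"
  shows "pds b (fk k) x = av \<omega> A (sc k) (D b) x"
  unfolding fk_def
  by (rule pds_av[OF test sc_pos A D_loc D_loc[OF assms(2)] D_weak[OF assms(2)]])
     (use assms stretch_in_Omega supp_w_Z in auto)

text \<open>With \<open>K\<close> containing all indices active near \<open>x\<close> this is the extension, since the \<open>\<psi> k\<close> add up to 1.
  With \<open>K = {- N..<j}\<close> it is the smooth approximation of the extension used to cross the boundary.\<close>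
definition "U j K x = fk j x + (\<Sum>k\<in>K. \<psi> k x * (fk k x - fk j x))"

lemma U_smooth: "smooth (U j K)"
  unfolding U_def[abs_def] by (intro smooth_add smooth_sum smooth_mult smooth_diff fk_smooth psi_smooth)

lemma pds_U: "pds js (U j K) x = pds js (fk j) x + (\<Sum>k\<in>K. \<Sum>(a, b)\<leftarrow>splits js. pds a (\<psi> k) x * (pds b (fk k) x - pds b (fk j) x))"
  unfolding U_def[abs_def]
  by (simp add: pds_add pds_sum pds_mult pds_diff smooth_sum smooth_mult smooth_diff fk_smooth psi_smooth)

text \<open>The right-hand sides of the estimates on a layer: the supremum over all admissible shifts.\<close>
definition "shift_sup E j a = (SUP \<zeta>\<in>Z. \<integral>\<^sup>+x\<in>E. ennreal (\<bar>D a (x - sc j *\<^sub>R stretch A \<zeta>)\<bar> powr p) \<partial>lborel)"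

lemma shift_sup_upper: "\<zeta> \<in> Z \<Longrightarrow> lp_int p E (\<lambda>x. D a (x - sc j *\<^sub>R stretch A \<zeta>)) \<le> shift_sup E j a"
  unfolding shift_sup_def by (rule SUP_upper)

text \<open>The factor \<open>sc k\<^bsup>- |a|\<^esup>\<close> of the derivative of \<open>\<psi> k\<close> cancels the factor \<open>sc j\<^bsup>|a|\<^esup>\<close> of
  the Poincare inequality, because \<open>sc j \<le> sc k\<close>.\<close>
lemma Leibniz_term_bound:
  assumes E[measurable]: "E \<in> sets borel" and Er: "\<And>x. x \<in> E \<Longrightarrow> \<rho> x \<le> 2 * sc j"
    and k: "j - 2 \<le> k" "k \<le> j" and ab: "length a + length b = l"
  shows "lp_int p E (\<lambda>x. pds a (\<psi> k) x * (pds b (fk k) x - pds b (fk j) x))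
    \<le> ennreal term_const * (\<Sum>c | length c = l. shift_sup E j c)"
proof -
  let ?m = "length a"
  have scjk: "sc j \<le> sc k" using sc_mono[OF k(2)] .
  \<comment> \<open>the ratio of the two scales lies between 1 and 4, as the Poincare inequality requires\<close>
  define \<sigma> where "\<sigma> = sc k / sc j"
  have "sc k \<le> 4 * sc j" using sc_mono[OF k(1)] sc_minus[of j 2] by simp
  then have \<sigma>: "1 \<le> \<sigma>" "\<sigma> \<le> 4" "sc j * \<sigma> = sc k" using scjk by (auto simp: \<sigma>_def divide_le_eq)
  have m: "?m \<le> l" "length b \<le> l" "length b + ?m \<le> l" using ab by auto
  have P: "lp_int p E (\<lambda>x. av \<omega> A (sc j * \<sigma>) (D b) x - av \<omega> A (sc j) (D b) x)
    \<le> ennreal (poincare_const ?m * (sc j ^ ?m) powr p) * (\<Sum>js | length js = ?m. shift_sup E j (js @ b))"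
    by (rule poincare_weak[OF D_loc D_weak m(3) sc_pos \<sigma>(1,2) E]) (auto intro: stretch_in_Omega Er shift_sup_upper)
  have S: "(\<Sum>js | length js = ?m. shift_sup E j (js @ b)) \<le> (\<Sum>c | length c = l. shift_sup E j c)"
  proof -
    have "(\<Sum>js | length js = ?m. shift_sup E j (js @ b)) = (\<Sum>c\<in>(\<lambda>js. js @ b) ` {js. length js = ?m}. shift_sup E j c)"
      by (subst sum.reindex) (auto simp: inj_on_def)
    also have "\<dots> \<le> (\<Sum>c | length c = l. shift_sup E j c)"
      using ab by (intro sum_mono2 finite_lists_of_length) auto
    finally show ?thesis .
  qed
  have [measurable]: "D b \<in> borel_measurable borel" by (rule D_borel[OF m(2)])
  let ?d = "\<lambda>x. av \<omega> A (sc j * \<sigma>) (D b) x - av \<omega> A (sc j) (D b) x"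
  let ?q = "psi_bound * inverse (sc k) ^ ?m"
  have q: "?q \<ge> 0" using psi_bound(1) by simp
  have "lp_int p E (\<lambda>x. pds a (\<psi> k) x * (pds b (fk k) x - pds b (fk j) x))
    \<le> (\<integral>\<^sup>+x. ennreal (?q powr p) * (ennreal (\<bar>?d x\<bar> powr p) * indicator E x) \<partial>lborel)"
  proof (rule nn_integral_mono)
    fix x
    show "ennreal (\<bar>pds a (\<psi> k) x * (pds b (fk k) x - pds b (fk j) x)\<bar> powr p) * indicator E x
      \<le> ennreal (?q powr p) * (ennreal (\<bar>?d x\<bar> powr p) * indicator E x)"
    proof (cases "x \<in> E")
      case True
      have "pds b (fk k) x - pds b (fk j) x = ?d x"
        using pds_fk[OF _ m(2), of x k] pds_fk[OF _ m(2), of x j] Er[OF True] scjk \<sigma>(3) by simp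
      moreover have "\<bar>pds a (\<psi> k) x\<bar> powr p \<le> ?q powr p"
        using psi_bound(2)[OF m(1), of k x] p by (intro powr_mono2) auto
      ultimately have "\<bar>pds a (\<psi> k) x * (pds b (fk k) x - pds b (fk j) x)\<bar> powr p \<le> ?q powr p * \<bar>?d x\<bar> powr p"
        by (simp add: abs_mult powr_mult mult_right_mono)
      then have "ennreal (\<bar>pds a (\<psi> k) x * (pds b (fk k) x - pds b (fk j) x)\<bar> powr p) \<le> ennreal (?q powr p) * ennreal (\<bar>?d x\<bar> powr p)"
        by (subst ennreal_mult[symmetric]) (auto intro: ennreal_leI)
      then show ?thesis using True by simp
    qed simp
  qed
  also have "\<dots> = ennreal (?q powr p) * lp_int p E ?d"
    by (rule nn_integral_cmult) measurable
  also have "\<dots> \<le> ennreal (?q powr p) * (ennreal (poincare_const ?m * (sc j ^ ?m) powr p) * (\<Sum>c | length c = l. shift_sup E j c))"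
    by (intro mult_left_mono order_trans[OF P mult_left_mono[OF S]]) auto
  also have "\<dots> = ennreal (?q powr p * (poincare_const ?m * (sc j ^ ?m) powr p)) * (\<Sum>c | length c = l. shift_sup E j c)"
    by (simp add: ennreal_mult poincare_const_nonneg mult.assoc)
  also have "\<dots> \<le> ennreal term_const * (\<Sum>c | length c = l. shift_sup E j c)"
  proof (intro mult_right_mono ennreal_leI)
    have "inverse (sc k) ^ ?m * sc j ^ ?m = (sc j / sc k) ^ ?m" by (simp add: divide_inverse power_mult_distrib mult.commute)
    also have "\<dots> \<le> 1" using scjk by (intro power_le_one) auto
    finally have r: "(inverse (sc k) ^ ?m * sc j ^ ?m) powr p \<le> 1"
      using p powr_mono2[of p "inverse (sc k) ^ ?m * sc j ^ ?m" 1] by simp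
    have "?q powr p * (poincare_const ?m * (sc j ^ ?m) powr p) = psi_bound powr p * poincare_const ?m * (inverse (sc k) ^ ?m * sc j ^ ?m) powr p"
      using psi_bound(1) by (simp add: powr_mult mult_ac)
    also have "\<dots> \<le> psi_bound powr p * poincare_const ?m * 1"
      using r poincare_const_nonneg by (intro mult_left_mono mult_nonneg_nonneg) auto
    also have "\<dots> \<le> term_const" unfolding term_const_def mult_1_right
      using m(1) poincare_const_nonneg by (intro mult_left_mono member_le_sum) auto
    finally show "?q powr p * (poincare_const ?m * (sc j ^ ?m) powr p) \<le> term_const" .
  qed simp
  finally show ?thesis .
qed

lemma pds_U_measurable: "pds js (U j K) \<in> borel_measurable borel"
  by (intro smooth_measurable smooth_pds U_smooth)

lemma local_estimate:
  assumes E[measurable]: "E \<in> sets borel" and Er: "\<And>x. x \<in> E \<Longrightarrow> \<rho> x \<le> 2 * sc j"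
    and K: "finite K" "\<And>k x. k \<in> K \<Longrightarrow> x \<in> E \<Longrightarrow> x \<in> supp (\<psi> k) \<Longrightarrow> j - 2 \<le> k" "\<And>k. k \<in> K \<Longrightarrow> k \<le> j"
    and js: "length js = l"
  shows "lp_int p E (pds js (U j K)) \<le> ennreal local_const * (\<Sum>c | length c = l. shift_sup E j c)"
proof -
  define S where "S = (\<Sum>c | length c = l. shift_sup E j c)"
  define K' where "K' = K \<inter> {j - 2..j}"
  have K': "finite K'" "card K' \<le> 3"
    using card_mono[of "{j - 2..j}" K'] by (auto simp: K'_def)
  define I where "I = K' \<times> {..<length (splits js)}"
  have cI: "finite I" "real (card I) \<le> 3 * 2 ^ l"
  proof -
    have "card I \<le> 3 * 2 ^ l" using K' js by (simp add: I_def length_splits card_cartesian_product)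
    then have "real (card I) \<le> real (3 * 2 ^ l)" by (simp only: of_nat_le_iff)
    then show "real (card I) \<le> 3 * 2 ^ l" by simp
  qed (use K' in \<open>simp add: I_def\<close>)
  define t where "t = (\<lambda>(k, i) x. pds (fst (splits js ! i)) (\<psi> k) x * (pds (snd (splits js ! i)) (fk k) x - pds (snd (splits js ! i)) (fk j) x))"
  have tm: "t i \<in> borel_measurable borel" for i unfolding t_def case_prod_unfold
    by (intro borel_measurable_times borel_measurable_diff smooth_measurable smooth_pds psi_smooth fk_smooth)
  have tb: "lp_int p E (t i) \<le> ennreal term_const * S" if "i \<in> I" for i
  proof -
    obtain k n where i: "i = (k, n)" "k \<in> K'" "n < length (splits js)" using \<open>i \<in> I\<close> by (auto simp: I_def)
    have "(fst (splits js ! n), snd (splits js ! n)) \<in> set (splits js)" using i(3) by simp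
    from splits_length[OF this] js have "length (fst (splits js ! n)) + length (snd (splits js ! n)) = l" by simp
    from Leibniz_term_bound[OF E Er _ _ this, of k] i(2) show ?thesis unfolding t_def i S_def K'_def by simp
  qed
  have eq: "pds js (U j K) x = av \<omega> A (sc j) (D js) x + (\<Sum>i\<in>I. t i x)" if x: "x \<in> E" for x
  proof -
    have "(\<Sum>k\<in>K. \<Sum>(a, b)\<leftarrow>splits js. pds a (\<psi> k) x * (pds b (fk k) x - pds b (fk j) x))
      = (\<Sum>k\<in>K'. \<Sum>(a, b)\<leftarrow>splits js. pds a (\<psi> k) x * (pds b (fk k) x - pds b (fk j) x))"
    proof (rule sum.mono_neutral_right[OF K(1)])
      show "\<forall>k\<in>K - K'. (\<Sum>(a, b)\<leftarrow>splits js. pds a (\<psi> k) x * (pds b (fk k) x - pds b (fk j) x)) = 0"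
      proof
        fix k assume k: "k \<in> K - K'"
        then have "x \<notin> supp (\<psi> k)" using K(2)[OF _ x] K(3) by (auto simp: K'_def)
        then have "pds a (\<psi> k) x = 0" for a by (rule pds_outside_supp)
        then show "(\<Sum>(a, b)\<leftarrow>splits js. pds a (\<psi> k) x * (pds b (fk k) x - pds b (fk j) x)) = 0"
          by (simp add: case_prod_unfold)
      qed
    qed (auto simp: K'_def)
    also have "\<dots> = (\<Sum>k\<in>K'. \<Sum>n<length (splits js). t (k, n) x)"
      by (intro sum.cong refl) (simp add: sum_list_sum_nth t_def case_prod_unfold atLeast0LessThan)
    also have "\<dots> = (\<Sum>i\<in>I. t i x)" unfolding I_def by (simp add: sum.cartesian_product)
    finally show ?thesis using pds_U[of js j K x] pds_fk[OF Er[OF x], of js] js by simp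
  qed
  have [measurable]: "D js \<in> borel_measurable borel" using D_borel js by simp
  let ?a = "av \<omega> A (sc j) (D js)"
  note [measurable] = tm
  have 1: "lp_int p E ?a \<le> ennreal ((2 * W) powr p * W) * S"
  proof -
    have "lp_int p E (\<lambda>x. ?a (x - 0)) \<le> ennreal ((2 * W) powr p * W) * shift_sup E j js"
    proof (rule av_bound[OF _ E])
      fix z assume "\<omega> z \<noteq> 0"
      then have "z \<in> Z" using w_nz(1) supp_w_Z by blast
      from shift_sup_upper[OF this] show "lp_int p E (\<lambda>x. D js (x - 0 - sc j *\<^sub>R stretch A z)) \<le> shift_sup E j js" by simp
    qed measurable
    also have "\<dots> \<le> ennreal ((2 * W) powr p * W) * S"
      unfolding S_def using js by (intro mult_left_mono member_le_sum finite_lists_of_length) auto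
    finally show ?thesis by simp
  qed
  have 2: "lp_int p E (\<lambda>x. \<Sum>i\<in>I. t i x) \<le> ennreal ((3 * 2 ^ l) powr p * (3 * 2 ^ l * term_const)) * S"
  proof -
    have "lp_int p E (\<lambda>x. \<Sum>i\<in>I. t i x) \<le>
      (\<integral>\<^sup>+x. ennreal (real (card I) powr p) * (\<Sum>i\<in>I. ennreal (\<bar>t i x\<bar> powr p) * indicator E x) \<partial>lborel)"
      unfolding sum_distrib_right[symmetric] mult.assoc[symmetric]
      by (intro nn_integral_mono mult_right_mono ennreal_power_sum_le cI p) auto
    also have "\<dots> = ennreal (real (card I) powr p) * (\<Sum>i\<in>I. \<integral>\<^sup>+x\<in>E. ennreal (\<bar>t i x\<bar> powr p) \<partial>lborel)"
      by (subst nn_integral_cmult, measurable, subst nn_integral_sum) auto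
    also have "\<dots> \<le> ennreal (real (card I) powr p) * (\<Sum>i\<in>I. ennreal term_const * S)"
      by (intro mult_left_mono sum_mono tb) auto
    also have "\<dots> = ennreal (real (card I) powr p * (real (card I) * term_const)) * S"
      using term_const_nonneg by (simp add: ennreal_mult mult.assoc ennreal_of_nat_eq_real_of_nat)
    also have "\<dots> \<le> ennreal ((3 * 2 ^ l) powr p * (3 * 2 ^ l * term_const)) * S"
      using cI p term_const_nonneg
      by (intro mult_right_mono ennreal_leI mult_mono powr_mono2) auto
    finally show ?thesis .
  qed
  have "lp_int p E (pds js (U j K)) = lp_int p E (\<lambda>x. ?a x - (- (\<Sum>i\<in>I. t i x)))"
    using eq by (intro nn_integral_cong) (auto simp: indicator_def)
  also have "\<dots> \<le> ennreal (2 powr p) * (lp_int p E ?a + lp_int p E (\<lambda>x. - (\<Sum>i\<in>I. t i x)))"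
    by (rule average_difference_le_sum) measurable
  also have "\<dots> \<le> ennreal (2 powr p) * (ennreal ((2 * W) powr p * W) * S + ennreal ((3 * 2 ^ l) powr p * (3 * 2 ^ l * term_const)) * S)"
    using 1 2 by (intro mult_left_mono add_mono) auto
  also have "\<dots> = ennreal local_const * S"
  proof -
    have gen: "ennreal (2 powr p * (a + b)) = ennreal (2 powr p) * (ennreal a + ennreal b)" if "a \<ge> 0" "b \<ge> 0" for a b
      using that by (simp add: ennreal_mult ennreal_plus)
    have "ennreal local_const = ennreal (2 powr p) * (ennreal ((2 * W) powr p * W) + ennreal ((3 * 2 ^ l) powr p * (3 * 2 ^ l * term_const)))"
      unfolding local_const_def using W(1) term_const_nonneg by (intro gen) auto
    then show ?thesis by (simp only: distrib_right distrib_left mult.assoc)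
  qed
  finally show ?thesis unfolding S_def .
qed

text \<open>The partial sums of the extension; they are smooth on the whole space and eventually constant
  near each point of \<open>G\<close>.\<close>
definition "V N x = (\<Sum>k\<in>{- int N..int N}. \<psi> k x * fk k x)"

lemma V_smooth: "smooth (V N)"
  unfolding V_def[abs_def] by (intro smooth_sum smooth_mult fk_smooth psi_smooth)

lemma V_eq_U:
  assumes O: "open O'" "O' \<subseteq> G" and K: "finite K" "\<And>y k. y \<in> O' \<Longrightarrow> \<psi> k y \<noteq> 0 \<Longrightarrow> k \<in> K" "K \<subseteq> {- int N..int N}" and x: "x \<in> O'"
  shows "pds js (V N) x = pds js (U j K) x"
proof (rule pds_local[OF O(1) _ x])
  fix y assume y: "y \<in> O'"
  have "V N y = (\<Sum>k\<in>K. \<psi> k y * fk k y)"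
    unfolding V_def by (rule sum.mono_neutral_right) (use K K(2)[OF y] in auto)
  also have "\<dots> = U j K y"
    using psi_sum[OF subsetD[OF O(2) y] K(1) K(2)[OF y]]
    by (simp add: U_def right_diff_distrib sum_subtractf flip: sum_distrib_right)
  finally show "V N y = U j K y" .
qed

text \<open>On a neighbourhood of the layer only the indices \<open>j - 3,\<dots>,j\<close> are active.\<close>
lemma V_eq_U_layer:
  assumes x: "x \<in> layer j" and N: "\<bar>j\<bar> + 3 \<le> int N"
  shows "pds js (V N) x = pds js (U j {j - 3..j}) x"
proof (rule V_eq_U[where O'="{y. sc j < \<rho> y} \<inter> {y. \<rho> y < 4 * sc j}"])
  show "open ({y. sc j < \<rho> y} \<inter> {y. \<rho> y < 4 * sc j})"
    by (intro open_Int open_Collect_less rho_continuous continuous_on_const)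
  show "{y. sc j < \<rho> y} \<inter> {y. \<rho> y < 4 * sc j} \<subseteq> G"
    using sc_pos[of j] by (auto simp: G_eq intro: less_trans)
  show "x \<in> {y. sc j < \<rho> y} \<inter> {y. \<rho> y < 4 * sc j}" using x sc_pos[of j] by (auto simp: layer_def)
  show "{j - 3..j} \<subseteq> {- int N..int N}" using N by auto
  fix y k assume y: "y \<in> {y. sc j < \<rho> y} \<inter> {y. \<rho> y < 4 * sc j}" and k: "\<psi> k y \<noteq> 0"
  have a: "sc k < 16 * sc j" "sc j < 2 * sc k" using psi_nz[OF k] y by auto
  have "\<not> k \<le> j - 4"
  proof
    assume "k \<le> j - 4"
    then have "sc (j - 4) \<le> sc k" by (rule sc_mono)
    then show False using a(1) sc_minus[of j 4] by simp
  qed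
  moreover have "\<not> j + 1 \<le> k"
  proof
    assume "j + 1 \<le> k"
    then have "sc k \<le> sc (j + 1)" by (rule sc_mono)
    moreover have "sc j = 2 * sc (j + 1)" using sc_diff[of j "j + 1"] by simp
    ultimately show False using a(2) by simp
  qed
  ultimately show "k \<in> {j - 3..j}" by auto
qed simp

lemma V_outside: assumes "x \<notin> G" shows "pds js (V N) x = 0"
proof -
  let ?C = "\<Union>k\<in>{- int N..int N}. supp (\<psi> k)"
  have cl: "closed ?C" by (intro closed_UN) (auto simp: supp_def)
  have "pds js (V N) x = pds js (\<lambda>_. 0) x"
  proof (rule pds_local[of "- ?C"])
    show "open (- ?C)" using cl by (rule open_Compl)
    show "x \<in> - ?C" using psi_supp(3) assms by blast
    fix y assume "y \<in> - ?C"
    then show "V N y = 0" unfolding V_def using in_suppI[of "\<psi> _" y] by (intro sum.neutral) auto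
  qed
  then show ?thesis by (simp add: pds_zero)
qed

text \<open>The classical derivative of the extension on \<open>G\<close>, and 0 elsewhere; as a limit of continuous
  functions it is measurable.\<close>
definition "gG js x = lim (\<lambda>N. pds js (V N) x)"

lemma gG_outside: "x \<notin> G \<Longrightarrow> gG js x = 0"
  unfolding gG_def by (simp add: V_outside)

lemma gG_eventually:
  assumes "\<And>N. N0 \<le> N \<Longrightarrow> pds js (V N) x = c" shows "gG js x = c" "(\<lambda>N. pds js (V N) x) \<longlonglongrightarrow> c"
proof -
  show "(\<lambda>N. pds js (V N) x) \<longlonglongrightarrow> c"
    using assms by (intro tendsto_eventually) (auto simp: eventually_sequentially)
  then show "gG js x = c" unfolding gG_def by (rule limI)
qed

lemma gG_layer: assumes x: "x \<in> layer j" shows "gG js x = pds js (U j {j - 3..j}) x"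
  by (rule gG_eventually(1)[of "nat (\<bar>j\<bar> + 3)"]) (use V_eq_U_layer[OF x] in auto)

lemma gG_lim: "(\<lambda>N. pds js (V N) x) \<longlonglongrightarrow> gG js x"
proof (cases "x \<in> G")
  case True
  then obtain j where x: "x \<in> layer j" unfolding G_union_layers by blast
  show ?thesis unfolding gG_layer[OF x]
    by (rule gG_eventually(2)[of "nat (\<bar>j\<bar> + 3)"]) (use V_eq_U_layer[OF x] in auto)
qed (simp add: gG_outside V_outside)

lemma gG_measurable [measurable]: "gG js \<in> borel_measurable borel"
  by (rule borel_measurable_LIMSEQ_real[OF gG_lim]) (intro smooth_measurable smooth_pds V_smooth)

lemma gG_morrey_layers:
  assumes js: "length js = l"
  shows "lp_int p (ball x r) (gG js)
    \<le> ennreal local_const * (\<Sum>c | length c = l. \<integral>\<^sup>+j. shift_sup (ball x r \<inter> layer j) j c \<partial>count_space UNIV)"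
proof -
  have gm: "(\<lambda>y. ennreal (\<bar>gG js y\<bar> powr p)) \<in> borel_measurable borel" by measurable
  have "lp_int p (ball x r) (gG js)
    = (\<integral>\<^sup>+y. \<integral>\<^sup>+j. ennreal (\<bar>gG js y\<bar> powr p) * indicator (ball x r \<inter> layer j) y \<partial>count_space UNIV \<partial>lborel)"
  proof (rule nn_integral_cong)
    fix y
    show "ennreal (\<bar>gG js y\<bar> powr p) * indicator (ball x r) y = (\<integral>\<^sup>+j. ennreal (\<bar>gG js y\<bar> powr p) * indicator (ball x r \<inter> layer j) y \<partial>count_space UNIV)"
    proof (cases "y \<in> G")
      case True
      then obtain j where j: "y \<in> layer j" unfolding G_union_layers by blast
      have "indicator (ball x r \<inter> layer i) y = indicator (ball x r) y * (indicator {j} i :: ennreal)" for i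
        using j layer_disjoint[OF j, of i] by (auto simp: indicator_def)
      then show ?thesis
        by (subst nn_integral_cmult) (auto simp: nn_integral_cmult)
    qed (use p in \<open>simp add: gG_outside\<close>)
  qed
  also have "\<dots> = (\<integral>\<^sup>+j. lp_int p (ball x r \<inter> layer j) (gG js) \<partial>count_space UNIV)"
    by (rule nn_integral_count_space_nn_integral, simp,
        simp,
        intro borel_measurable_times_ennreal borel_measurable_indicator sets.Int layer_borel borel_open open_ball gm)
  also have "\<dots> \<le> (\<integral>\<^sup>+j. ennreal local_const * (\<Sum>c | length c = l. shift_sup (ball x r \<inter> layer j) j c) \<partial>count_space UNIV)"
  proof (rule nn_integral_mono)
    fix j
    have "lp_int p (ball x r \<inter> layer j) (gG js) = lp_int p (ball x r \<inter> layer j) (\<lambda>y. pds js (U j {j - 3..j}) y)"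
      by (intro nn_integral_cong) (auto simp: indicator_def gG_layer)
    also have "\<dots> \<le> ennreal local_const * (\<Sum>c | length c = l. shift_sup (ball x r \<inter> layer j) j c)"
    proof (rule local_estimate[OF _ _ _ _ _ js])
      fix k y assume "y \<in> ball x r \<inter> layer j" and s: "y \<in> supp (\<psi> k)"
      then have a: "sc k < 8 * sc j" using psi_supp(1)[OF s] by (auto simp: layer_def)
      show "j - 2 \<le> k"
      proof (rule ccontr)
        assume "\<not> j - 2 \<le> k"
        then have "sc (j - 3) \<le> sc k" by (intro sc_mono) auto
        then show False using a sc_minus[of j 3] by simp
      qed
    qed (auto simp: layer_def)
    finally show "lp_int p (ball x r \<inter> layer j) (gG js) \<le> ennreal local_const * (\<Sum>c | length c = l. shift_sup (ball x r \<inter> layer j) j c)" .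
  qed
  also have "\<dots> = ennreal local_const * (\<Sum>c | length c = l. \<integral>\<^sup>+j. shift_sup (ball x r \<inter> layer j) j c \<partial>count_space UNIV)"
    by (subst nn_integral_cmult, simp, subst nn_integral_sum) auto
  finally show ?thesis .
qed

text \<open>The candidate for the weak derivative of the extension along \<open>js\<close>; \<open>D js\<close> and \<open>gG js\<close> have disjoint
  supports up to the boundary, which is a null set.\<close>
definition "g js x = D js x + gG js x"

lemma g_measurable: "length js \<le> l \<Longrightarrow> g js \<in> borel_measurable borel"
  unfolding g_def[abs_def] using D_borel by measurable

lemma g_split:
  assumes "length js \<le> l"
  shows "ennreal (\<bar>g js y\<bar> powr p) = ennreal (\<bar>D js y\<bar> powr p) + ennreal (\<bar>gG js y\<bar> powr p)"
proof (cases "y \<in> \<Omega>")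
  case True
  then have "y \<notin> G" by (auto simp: G_eq Omega_eq)
  then show ?thesis using p by (simp add: g_def gG_outside)
next
  case False
  then show ?thesis using D_zero[OF assms False] p by (simp add: g_def)
qed

end

section \<open>The Morrey estimate and gluing across the boundary\<close>

context burenkov
begin

definition "cover_const = (SOME N::nat. \<forall>h S x r. h \<in> borel_measurable borel \<longrightarrow> (\<forall>y. y \<notin> \<Omega> \<longrightarrow> h y = 0) \<longrightarrow> r > 0 \<longrightarrow>
     (\<forall>w\<in>\<Omega>. (\<integral>\<^sup>+y\<in>ball w r. h y \<partial>lborel) \<le> S) \<longrightarrow> (\<integral>\<^sup>+y\<in>ball x (1 * r). h y \<partial>lborel) \<le> of_nat N * S)"

definition "layer_const = (SOME N::nat. \<forall>h S x r. h \<in> borel_measurable borel \<longrightarrow> (\<forall>y. y \<notin> \<Omega> \<longrightarrow> h y = 0) \<longrightarrow> r > 0 \<longrightarrow>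
     (\<forall>w\<in>\<Omega>. (\<integral>\<^sup>+y\<in>ball w r. h y \<partial>lborel) \<le> S) \<longrightarrow>
     (\<integral>\<^sup>+j. (SUP \<zeta>\<in>Z. \<integral>\<^sup>+y\<in>ball x r \<inter> layer j. h (y - sc j *\<^sub>R stretch A \<zeta>) \<partial>lborel) \<partial>count_space UNIV) \<le> of_nat N * S)"

lemma cover_const:
  assumes "h \<in> borel_measurable borel" "\<forall>y. y \<notin> \<Omega> \<longrightarrow> h y = 0" "r > 0"
    "\<forall>w\<in>\<Omega>. (\<integral>\<^sup>+y\<in>ball w r. h y \<partial>lborel) \<le> S"
  shows "(\<integral>\<^sup>+y\<in>ball x r. h y \<partial>lborel) \<le> of_nat cover_const * S"
  using someI_ex[OF nn_integral_ball_cover[of \<Omega> 1], folded cover_const_def,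
      THEN spec, THEN spec, THEN spec, THEN spec, THEN mp, OF assms(1), THEN mp, OF assms(2), THEN mp, OF assms(3), THEN mp, OF assms(4)]
  by simp

lemma layer_const:
  assumes "h \<in> borel_measurable borel" "\<forall>y. y \<notin> \<Omega> \<longrightarrow> h y = 0" "r > 0"
    "\<forall>w\<in>\<Omega>. (\<integral>\<^sup>+y\<in>ball w r. h y \<partial>lborel) \<le> S"
  shows "(\<integral>\<^sup>+j. (SUP \<zeta>\<in>Z. \<integral>\<^sup>+y\<in>ball x r \<inter> layer j. h (y - sc j *\<^sub>R stretch A \<zeta>) \<partial>lborel) \<partial>count_space UNIV) \<le> of_nat layer_const * S"
  by (rule someI_ex[OF layer_sum_bound, folded layer_const_def,
      THEN spec, THEN spec, THEN spec, THEN spec, THEN mp, OF assms(1), THEN mp, OF assms(2), THEN mp, OF assms(3), THEN mp, OF assms(4)])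

definition "morrey_const = real cover_const + local_const * real layer_const"

end

context burenkov_family
begin

lemma D_power_measurable: "length c \<le> l \<Longrightarrow> (\<lambda>y. ennreal (\<bar>D c y\<bar> powr p)) \<in> borel_measurable borel"
  using D_borel[of c] by measurable

text \<open>Inside the domain the ball is replaced by balls with centres in the domain; outside, the layer
  estimates are summed. \<open>S c\<close> is an arbitrary bound, so that one statement serves both for Morrey
  norms and for local integrability.\<close>
lemma g_morrey:
  assumes js: "length js = l" and r: "r > 0"
    and S: "\<And>c w. length c = l \<Longrightarrow> w \<in> \<Omega> \<Longrightarrow> lp_int p (ball w r) (D c) \<le> S c"
  shows "lp_int p (ball x r) (g js) \<le> ennreal morrey_const * (\<Sum>c | length c = l. S c)"
proof -
  let ?S = "\<Sum>c | length c = l. S c"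
  have z: "\<forall>y. y \<notin> \<Omega> \<longrightarrow> ennreal (\<bar>D c y\<bar> powr p) = 0" if "length c = l" for c
    using D_zero[of c] that p by simp
  have 1: "lp_int p (ball x r) (D js) \<le> of_nat cover_const * ?S"
  proof -
    have "lp_int p (ball x r) (D js) \<le> of_nat cover_const * S js"
      using js by (intro cover_const D_power_measurable z r) (auto intro: S)
    also have "\<dots> \<le> of_nat cover_const * ?S"
      using js by (intro mult_left_mono member_le_sum finite_lists_of_length) auto
    finally show ?thesis .
  qed
  have 2: "lp_int p (ball x r) (gG js) \<le> ennreal local_const * (of_nat layer_const * ?S)"
  proof -
    have "(\<integral>\<^sup>+j. shift_sup (ball x r \<inter> layer j) j c \<partial>count_space UNIV) \<le> of_nat layer_const * S c" if "length c = l" for c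
      unfolding shift_sup_def
      using that by (intro layer_const[where h="\<lambda>y. ennreal (\<bar>D c y\<bar> powr p)"] D_power_measurable z r) (auto intro: S)
    then have "(\<Sum>c | length c = l. \<integral>\<^sup>+j. shift_sup (ball x r \<inter> layer j) j c \<partial>count_space UNIV) \<le> of_nat layer_const * ?S"
      unfolding sum_distrib_left by (intro sum_mono) auto
    then show ?thesis by (intro order_trans[OF gG_morrey_layers[OF js]] mult_left_mono) auto
  qed
  have "lp_int p (ball x r) (g js)
    = lp_int p (ball x r) (D js) + lp_int p (ball x r) (gG js)"
  proof -
    have m: "(\<lambda>y. ennreal (\<bar>D js y\<bar> powr p)) \<in> borel_measurable borel" "(\<lambda>y. ennreal (\<bar>gG js y\<bar> powr p)) \<in> borel_measurable borel"
      using D_power_measurable js by auto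
    have m': "(\<lambda>y. ennreal (\<bar>D js y\<bar> powr p) * indicator (ball x r) y) \<in> borel_measurable lborel"
      "(\<lambda>y. ennreal (\<bar>gG js y\<bar> powr p) * indicator (ball x r) y) \<in> borel_measurable lborel"
      by (simp, intro borel_measurable_times_ennreal borel_measurable_indicator m borel_open open_ball)+
    show ?thesis
      unfolding g_split[OF eq_refl[OF js]] distrib_right by (rule nn_integral_add[OF m'])
  qed
  also have "\<dots> \<le> of_nat cover_const * ?S + ennreal local_const * (of_nat layer_const * ?S)"
    by (intro add_mono 1 2)
  also have "\<dots> = ennreal morrey_const * ?S"
    unfolding morrey_const_def using local_const_nonneg
    by (simp add: ennreal_plus ennreal_mult distrib_right mult.assoc ennreal_of_nat_eq_real_of_nat)
  finally show ?thesis .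
qed

lemma g_loc_int: assumes js: "length js = l" shows "loc_int (g js)"
proof (rule loc_int_of_powr[OF g_measurable[OF eq_refl[OF js]]])
  fix R
  have "lp_int p (cball 0 R) (g js) \<le> lp_int p (ball 0 (\<bar>R\<bar> + 1)) (g js)"
    by (intro nn_integral_mono mult_left_mono) (auto simp: indicator_def)
  also have "\<dots> \<le> ennreal morrey_const * (\<Sum>c | length c = l. \<integral>\<^sup>+y. ennreal (\<bar>D c y\<bar> powr p) \<partial>lborel)"
    by (rule g_morrey[OF js]) (auto intro!: nn_integral_mono simp: indicator_def)
  also have "\<dots> < \<infinity>"
  proof -
    have fin: "(\<Sum>c\<in>S. F c) < top" if "finite S" "\<And>c. c \<in> S \<Longrightarrow> F c < top" for S and F :: "'n list \<Rightarrow> ennreal"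
      using that by (induction S rule: finite_induct) auto
    have "(\<Sum>c | length c = l. \<integral>\<^sup>+y. ennreal (\<bar>D c y\<bar> powr p) \<partial>lborel) < top"
      using D_Lp by (intro fin finite_lists_of_length) auto
    then show ?thesis by (simp add: ennreal_mult_less_top)
  qed
  finally show "lp_int p (cball 0 R) (g js) < \<infinity>" .
qed

lemma gG_loc_int: assumes js: "length js = l" shows "loc_int (gG js)"
proof -
  have "set_integrable lborel (cball 0 R) (\<lambda>x. g js x - D js x)" for R
    using g_loc_int[OF js] D_loc[OF eq_refl[OF js]] by (intro set_integral_diff(1)) (auto simp: loc_int_def)
  moreover have "(\<lambda>x. g js x - D js x) = gG js" by (auto simp: g_def)
  ultimately show ?thesis using gG_measurable by (simp add: loc_int_def)
qed

text \<open>The integrand is bounded by \<open>B (1 + |u|\<^sup>p)\<close> on the layer. The measure of the layer tends to 0, and by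
  the local estimate so does the integral of \<open>|u|\<^sup>p\<close>, since the shifted layers lie in a strip in the
  domain that shrinks to the boundary.\<close>
lemma thin_layer_vanishes:
  assumes js: "length js = l" and B: "B \<ge> 0" "\<And>x. \<bar>\<zeta> x\<bar> \<le> B" and R: "\<And>x. norm x > R \<Longrightarrow> \<zeta> x = 0" and \<zeta>[measurable]: "\<zeta> \<in> borel_measurable borel"
  shows "(\<lambda>j. \<integral>x. pds js (U (int j) {- int N..<int j}) x * (indicator {x. 0 < \<rho> x \<and> \<rho> x \<le> 2 * sc (int j)} x * \<zeta> x) \<partial>lborel) \<longlonglongrightarrow> 0"
proof -
  define E where "E j = {x. 0 < \<rho> x \<and> \<rho> x \<le> 2 * sc (int j)} \<inter> cball 0 R" for j :: nat
  define T where "T j = {x. - ((85 * M + 80) * sc (int j)) \<le> \<rho> x \<and> \<rho> x < 0}" for j :: nat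
  have "{x. 0 < \<rho> x \<and> \<rho> x \<le> 2 * sc (int j)} \<in> sets borel" for j by measurable
  then have Em: "E j \<in> sets borel" for j unfolding E_def by (rule sets.Int[OF _ borel_closed[OF closed_cball]])
  have Tm: "T j \<in> sets borel" for j unfolding T_def by measurable
  define e where "e j = (\<integral>\<^sup>+x. indicator (E j) x \<partial>lborel) + ennreal local_const * (\<Sum>c | length c = l. \<integral>\<^sup>+y\<in>T j. ennreal (\<bar>D c y\<bar> powr p) \<partial>lborel)" for j
  let ?u = "\<lambda>j. pds js (U (int j) {- int N..<int j})"
  let ?b = "\<lambda>j x. ?u j x * (indicator {x. 0 < \<rho> x \<and> \<rho> x \<le> 2 * sc (int j)} x * \<zeta> x)"
  have sc0: "\<forall>\<^sub>F j in sequentially. c * sc (int j) < t" if "t > 0" for t c :: real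
  proof -
    have "(\<lambda>j. c * sc (int j)) \<longlonglongrightarrow> c * 0" by (intro tendsto_mult tendsto_const sc_tendsto_0)
    from order_tendstoD(2)[OF this, of t] that show ?thesis by simp
  qed
  have bound: "ennreal \<bar>\<integral>x. ?b j x \<partial>lborel\<bar> \<le> ennreal B * e j" for j
  proof -
    have um: "?u j \<in> borel_measurable borel" by (rule pds_U_measurable)
    have ss: "shift_sup (E j) (int j) c \<le> lp_int p (T j) (D c)" if c: "length c = l" for c
      unfolding shift_sup_def
    proof (rule SUP_least)
      fix z assume z: "z \<in> Z"
      let ?v = "sc (int j) *\<^sub>R stretch A z"
      have "lp_int p (E j) (\<lambda>x. D c (x - ?v)) \<le> (\<integral>\<^sup>+x. ennreal (\<bar>D c (x - ?v)\<bar> powr p) * indicator (T j) (x - ?v) \<partial>lborel)"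
      proof (rule nn_integral_mono)
        fix x
        show "ennreal (\<bar>D c (x - ?v)\<bar> powr p) * indicator (E j) x \<le> ennreal (\<bar>D c (x - ?v)\<bar> powr p) * indicator (T j) (x - ?v)"
        proof (cases "x \<in> E j")
          case True
          then have x: "0 < \<rho> x" "\<rho> x \<le> 2 * sc (int j)" by (auto simp: E_def)
          have "x - ?v \<in> \<Omega>" by (rule stretch_in_Omega[OF z sc_pos x(2)])
          moreover have "- ((85 * M + 80) * sc (int j)) \<le> \<rho> (x - ?v)"
            using rho_stretch(2)[OF z sc_pos, of x "int j"] x(1) by linarith
          ultimately show ?thesis using True by (simp add: T_def Omega_eq)
        qed simp
      qed
      also have "\<dots> = lp_int p (T j) (D c)"
        using c by (intro nn_integral_lborel_translate[of "\<lambda>y. ennreal (\<bar>D c y\<bar> powr p) * indicator (T j) y"]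
          borel_measurable_times_ennreal borel_measurable_indicator D_power_measurable Tm) auto
      finally show "lp_int p (E j) (\<lambda>x. D c (x - ?v)) \<le> lp_int p (T j) (D c)" .
    qed
    have le: "lp_int p (E j) (?u j) \<le> ennreal local_const * (\<Sum>c | length c = l. shift_sup (E j) (int j) c)"
    proof (rule local_estimate[OF Em _ _ _ _ js])
      fix k x assume "x \<in> E j" and s: "x \<in> supp (\<psi> k)"
      then have a: "sc k < 8 * sc (int j)" using psi_supp(1)[OF s] by (auto simp: E_def)
      show "int j - 2 \<le> k"
      proof (rule ccontr)
        assume "\<not> int j - 2 \<le> k"
        then have "sc (int j - 3) \<le> sc k" by (intro sc_mono) auto
        then show False using a sc_minus[of "int j" 3] by simp
      qed
    qed (auto simp: E_def)
    have "ennreal \<bar>\<integral>x. ?b j x \<partial>lborel\<bar> \<le> (\<integral>\<^sup>+x. ennreal \<bar>?b j x\<bar> \<partial>lborel)"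
    proof (cases "integrable lborel (?b j)")
      case True
      from integral_norm_bound_ennreal[OF this] show ?thesis by simp
    qed (simp add: not_integrable_integral_eq)
    also have "\<dots> \<le> (\<integral>\<^sup>+x. ennreal B * (indicator (E j) x + ennreal (\<bar>?u j x\<bar> powr p) * indicator (E j) x) \<partial>lborel)"
    proof (rule nn_integral_mono)
      fix x
      show "ennreal \<bar>?b j x\<bar> \<le> ennreal B * (indicator (E j) x + ennreal (\<bar>?u j x\<bar> powr p) * indicator (E j) x)"
      proof (cases "x \<in> E j")
        case True
        then have i: "indicator {x. 0 < \<rho> x \<and> \<rho> x \<le> 2 * sc (int j)} x = (1 :: real)" by (auto simp: E_def)
        have "\<bar>?u j x\<bar> * \<bar>\<zeta> x\<bar> \<le> (1 + \<bar>?u j x\<bar> powr p) * B"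
          using B by (intro mult_mono le_one_plus_powr) auto
        then have "ennreal \<bar>?b j x\<bar> \<le> ennreal (B * (1 + \<bar>?u j x\<bar> powr p))"
          unfolding i by (intro ennreal_leI) (simp add: abs_mult mult.commute)
        also have "\<dots> = ennreal B * (1 + ennreal (\<bar>?u j x\<bar> powr p))" using B(1) by (simp add: ennreal_mult ennreal_plus)
        finally show ?thesis using True by simp
      next
        case False
        then have "?b j x = 0" using R[of x] by (cases "norm x \<le> R") (auto simp: E_def indicator_def)
        then show ?thesis by (simp only:) simp
      qed
    qed
    also have "\<dots> = ennreal B * ((\<integral>\<^sup>+x. indicator (E j) x \<partial>lborel) + lp_int p (E j) (?u j))"
    proof -
      have m1: "(\<lambda>x. ennreal (\<bar>?u j x\<bar> powr p) * indicator (E j) x) \<in> borel_measurable lborel"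
        using um Em[of j] by simp
      have m2: "indicator (E j) \<in> borel_measurable (lborel :: 'n rvec measure)" using Em[of j] by simp
      show ?thesis
        by (subst nn_integral_cmult[OF borel_measurable_add[OF m2 m1]], subst nn_integral_add[OF m2 m1]) simp
    qed
    also have "\<dots> \<le> ennreal B * e j"
      unfolding e_def
      by (intro mult_left_mono add_left_mono order_trans[OF le] sum_mono ss) auto
    finally show ?thesis .
  qed
  have "e \<longlonglongrightarrow> (\<integral>\<^sup>+x. 0 \<partial>(lborel :: 'n rvec measure)) + ennreal local_const * (\<Sum>c :: 'n list | length c = l. \<integral>\<^sup>+y. 0 \<partial>(lborel :: 'n rvec measure))"
    unfolding e_def
  proof (intro tendsto_add ennreal_tendsto_cmult tendsto_sum)
    show "(\<lambda>j. \<integral>\<^sup>+x. indicator (E j) x \<partial>lborel) \<longlonglongrightarrow> (\<integral>\<^sup>+x. 0 \<partial>(lborel :: 'n rvec measure))"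
    proof (rule nn_integral_dominated_convergence[where w="indicator (cball 0 R)"])
      show "indicator (cball 0 R) \<in> borel_measurable (lborel :: 'n rvec measure)"
        by (simp add: borel_measurable_indicator)
      show "(\<integral>\<^sup>+x. indicator (cball 0 R) (x :: 'n rvec) \<partial>lborel) < \<infinity>" using emeasure_lborel_cball_finite[of "0 :: 'n rvec" R] by simp
      show "AE x in lborel. (\<lambda>j. indicator (E j) x :: ennreal) \<longlonglongrightarrow> 0"
      proof (rule AE_I2)
        fix x
        have "\<forall>\<^sub>F j in sequentially. indicator (E j) x = (0 :: ennreal)"
        proof (cases "\<rho> x > 0")
          case True
          show ?thesis using sc0[OF True, of 2] by eventually_elim (auto simp: E_def)
        qed (auto simp: E_def)
        then show "(\<lambda>j. indicator (E j) x :: ennreal) \<longlonglongrightarrow> 0" by (rule tendsto_eventually)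
      qed
    qed (use Em in \<open>auto simp: E_def indicator_def\<close>)
    fix c :: "'n list" assume "c \<in> {c. length c = l}"
    then have c: "length c \<le> l" by simp
    show "(\<lambda>j. \<integral>\<^sup>+y\<in>T j. ennreal (\<bar>D c y\<bar> powr p) \<partial>lborel) \<longlonglongrightarrow> (\<integral>\<^sup>+y. 0 \<partial>(lborel :: 'n rvec measure))"
    proof (rule nn_integral_dominated_convergence[where w="\<lambda>y. ennreal (\<bar>D c y\<bar> powr p)"])
      show "(\<lambda>y. ennreal (\<bar>D c y\<bar> powr p) * indicator (T j) y) \<in> borel_measurable lborel" for j
        using D_power_measurable[OF c] Tm[of j] by simp
      show "(\<lambda>y. ennreal (\<bar>D c y\<bar> powr p)) \<in> borel_measurable lborel" using D_power_measurable[OF c] by simp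
      show "(\<integral>\<^sup>+y. ennreal (\<bar>D c y\<bar> powr p) \<partial>lborel) < \<infinity>" by (rule D_Lp[OF c])
      show "AE y in lborel. (\<lambda>j. ennreal (\<bar>D c y\<bar> powr p) * indicator (T j) y) \<longlonglongrightarrow> 0"
      proof (rule AE_I2)
        fix y
        have "\<forall>\<^sub>F j in sequentially. ennreal (\<bar>D c y\<bar> powr p) * indicator (T j) y = 0"
        proof (cases "\<rho> y < 0")
          case True
          then have "- \<rho> y > 0" by simp
          from sc0[OF this, of "85 * M + 80"] show ?thesis by eventually_elim (auto simp: T_def)
        qed (auto simp: T_def)
        then show "(\<lambda>j. ennreal (\<bar>D c y\<bar> powr p) * indicator (T j) y) \<longlonglongrightarrow> 0" by (rule tendsto_eventually)
      qed
    qed (auto simp: indicator_def)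
  qed auto
  then have "e \<longlonglongrightarrow> 0" by simp
  then have "(\<lambda>j. ennreal B * e j) \<longlonglongrightarrow> ennreal B * 0" by (intro ennreal_tendsto_cmult) auto
  then have e0: "(\<lambda>j. ennreal B * e j) \<longlonglongrightarrow> 0" by simp
  have "(\<lambda>j. ennreal \<bar>\<integral>x. ?b j x \<partial>lborel\<bar>) \<longlonglongrightarrow> 0"
  proof (rule tendsto_sandwich[OF _ _ tendsto_const e0])
    show "\<forall>\<^sub>F j in sequentially. ennreal \<bar>\<integral>x. ?b j x \<partial>lborel\<bar> \<le> ennreal B * e j"
      by (intro always_eventually allI bound)
  qed simp
  then have "(\<lambda>j. \<bar>\<integral>x. ?b j x \<partial>lborel\<bar>) \<longlonglongrightarrow> 0" by (subst (asm) ennreal_tendsto_0_iff) auto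
  then show ?thesis by (rule tendsto_rabs_zero_cancel)
qed

text \<open>The integral is split into the domain, where the approximation is a mollification of \<open>D js\<close>, the
  thin layer \<open>0 < rho \<le> 2 sc j\<close>, and the rest, where it agrees with the extension. The condition on \<open>N\<close>
  ensures that the large scales cut off in the sum are inactive on the support of \<open>\<zeta>\<close>.\<close>
lemma glue_limit:
  assumes js: "length js = l" and t: "test_function UNIV \<zeta>" and N: "\<And>x. \<zeta> x \<noteq> 0 \<Longrightarrow> \<rho> x < sc (- int N) / 2"
  shows "(\<lambda>j. \<integral>x. pds js (U (int j) {- int N..<int j}) x * \<zeta> x \<partial>lborel) \<longlonglongrightarrow> (\<integral>x. g js x * \<zeta> x \<partial>lborel)"
proof -
  obtain B R where B: "B \<ge> 0" "\<And>x. \<bar>\<zeta> x\<bar> \<le> B" and R: "\<And>x. norm x > R \<Longrightarrow> \<zeta> x = 0"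
    using test_function_bounds[OF t, of "[]"] by (metis foldr.simps(1) id_apply)
  note zm[measurable] = test_function_measurable[OF t]
  have zc: "continuous_on UNIV \<zeta>" using t by (simp add: test_function_def smooth_continuous)
  have jl: "length js \<le> l" using js by simp
  let ?u = "\<lambda>j. pds js (U (int j) {- int N..<int j})"
  let ?O = "indicator \<Omega> :: 'n rvec \<Rightarrow> real"
  let ?T = "\<lambda>j. indicator {x. 0 < \<rho> x \<and> \<rho> x \<le> 2 * sc (int j)} :: 'n rvec \<Rightarrow> real"
  let ?P = "\<lambda>j. indicator {x. 2 * sc (int j) < \<rho> x} :: 'n rvec \<Rightarrow> real"
  have Om: "\<Omega> \<in> sets borel" using open_Omega by simp
  have Tm: "{x. 0 < \<rho> x \<and> \<rho> x \<le> 2 * sc (int j)} \<in> sets borel" and Pm: "{x. 2 * sc (int j) < \<rho> x} \<in> sets borel" for j by measurable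
  have ind_le: "\<bar>indicator S x * \<zeta> x\<bar> \<le> B" for S x using B by (auto simp: indicator_def)
  have ind_R: "indicator S x * \<zeta> x = 0" if "norm x > R" for S x using R[OF that] by simp
  have im: "(\<lambda>x. indicator S x * \<zeta> x) \<in> borel_measurable borel" if "S \<in> sets borel" for S
    using that zm by (intro borel_measurable_times borel_measurable_indicator)
  have loc_ind: "integrable lborel (\<lambda>x. h x * (indicator S x * \<zeta> x))" if "loc_int h" "S \<in> sets borel" for h S
    by (rule loc_int_mult_bounded[OF that(1) im[OF that(2)] ind_le ind_R])
  have inside: "?u j x = av \<omega> A (sc (int j)) (D js) x" if "x \<in> \<Omega>" for j x
  proof -
    have x: "\<rho> x < 0" using that by (simp add: Omega_eq)
    have "pds a (\<psi> k) x = 0" for a k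
      using psi_supp(3)[of x k] x by (intro pds_outside_supp) (auto simp: G_eq)
    then have "?u j x = pds js (fk (int j)) x" unfolding pds_U by (simp add: case_prod_unfold)
    also have "\<dots> = av \<omega> A (sc (int j)) (D js) x"
      using x by (intro pds_fk jl) (simp add: order_trans[OF less_imp_le[OF x]])
    finally show ?thesis .
  qed
  have far: "?u j x = gG js x" if x: "2 * sc (int j) < \<rho> x" "\<zeta> x \<noteq> 0" for j x
  proof (rule gG_eventually(1)[of "max N j", symmetric])
    fix N' assume N': "max N j \<le> N'"
    show "pds js (V N') x = ?u j x"
    proof (rule V_eq_U[where O'="{y. 2 * sc (int j) < \<rho> y} \<inter> {y. \<rho> y < sc (- int N) / 2}"])
      show "open ({y. 2 * sc (int j) < \<rho> y} \<inter> {y. \<rho> y < sc (- int N) / 2})"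
        by (intro open_Int open_Collect_less rho_continuous continuous_on_const)
      show "{y. 2 * sc (int j) < \<rho> y} \<inter> {y. \<rho> y < sc (- int N) / 2} \<subseteq> G"
        using sc_pos[of "int j"] by (auto simp: G_eq intro: less_trans[rotated])
      show "x \<in> {y. 2 * sc (int j) < \<rho> y} \<inter> {y. \<rho> y < sc (- int N) / 2}" using x N[OF x(2)] by simp
      show "{- int N..<int j} \<subseteq> {- int N'..int N'}" using N' by auto
      fix y k assume y: "y \<in> {y. 2 * sc (int j) < \<rho> y} \<inter> {y. \<rho> y < sc (- int N) / 2}" and k: "\<psi> k y \<noteq> 0"
      have a: "sc k < 2 * sc (- int N)" "sc (int j) < sc k" using psi_nz[OF k] y by auto
      have "\<not> k \<le> - int N - 1"
      proof
        assume "k \<le> - int N - 1"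
        then have "sc (- int N - 1) \<le> sc k" by (rule sc_mono)
        then show False using a(1) sc_minus[of "- int N" 1] by simp
      qed
      moreover have "\<not> int j \<le> k" using a(2) sc_mono[of "int j" k] by linarith
      ultimately show "k \<in> {- int N..<int j}" by auto
    qed simp
  qed
  have lim1: "(\<lambda>j. \<integral>x. av \<omega> A (sc (int j)) (D js) x * (?O x * \<zeta> x) \<partial>lborel) \<longlonglongrightarrow> (\<integral>x. D js x * (?O x * \<zeta> x) \<partial>lborel)"
  proof (rule filterlim_compose[OF av_weak_tendsto[OF test int1 A im[OF Om] ind_le ind_R D_loc[OF jl]]])
    show "filterlim (\<lambda>j. sc (int j)) (at_right 0) sequentially"
      unfolding filterlim_at using sc_tendsto_0 by (auto intro!: always_eventually simp: less_imp_neq[OF sc_pos, symmetric])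
    fix y assume "D js y \<noteq> 0"
    then have y: "y \<in> \<Omega>" using D_zero[OF jl] by blast
    have "\<forall>\<^sub>F w in nhds y. ?O w * \<zeta> w = \<zeta> w"
      using eventually_nhds_in_open[OF open_Omega y] by eventually_elim simp
    then show "isCont (\<lambda>x. ?O x * \<zeta> x) y"
      using zc by (subst isCont_cong) (auto simp: continuous_on_eq_continuous_at)
  qed
  have lim2: "(\<lambda>j. \<integral>x. ?u j x * (?T j x * \<zeta> x) \<partial>lborel) \<longlonglongrightarrow> 0"
    by (rule thin_layer_vanishes[OF js B R zm])
  have lim3: "(\<lambda>j. \<integral>x. gG js x * (?P j x * \<zeta> x) \<partial>lborel) \<longlonglongrightarrow> (\<integral>x. gG js x * \<zeta> x \<partial>lborel)"
  proof (rule integral_dominated_convergence[where w="\<lambda>x. \<bar>gG js x * \<zeta> x\<bar>"])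
    show "integrable lborel (\<lambda>x. \<bar>gG js x * \<zeta> x\<bar>)"
      using loc_ind[OF gG_loc_int[OF js], of UNIV] by (intro integrable_abs) simp
    show "(\<lambda>x. gG js x * (?P j x * \<zeta> x)) \<in> borel_measurable lborel" for j
      using borel_measurable_integrable[OF loc_ind[OF gG_loc_int[OF js] Pm]] .
    show "AE x in lborel. norm (gG js x * (?P j x * \<zeta> x)) \<le> \<bar>gG js x * \<zeta> x\<bar>" for j
      by (intro AE_I2) (auto simp: indicator_def)
    show "AE x in lborel. (\<lambda>j. gG js x * (?P j x * \<zeta> x)) \<longlonglongrightarrow> gG js x * \<zeta> x"
    proof (rule AE_I2)
      fix x
      show "(\<lambda>j. gG js x * (?P j x * \<zeta> x)) \<longlonglongrightarrow> gG js x * \<zeta> x"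
      proof (cases "\<rho> x > 0")
        case True
        have "(\<lambda>j. 2 * sc (int j)) \<longlonglongrightarrow> 2 * 0" by (intro tendsto_mult tendsto_const sc_tendsto_0)
        from order_tendstoD(2)[OF this, of "\<rho> x"] True
        have "\<forall>\<^sub>F j in sequentially. 2 * sc (int j) < \<rho> x" by simp
        then have "\<forall>\<^sub>F j in sequentially. gG js x * (?P j x * \<zeta> x) = gG js x * \<zeta> x" by eventually_elim simp
        then show ?thesis by (rule tendsto_eventually)
      qed (simp add: gG_outside G_eq)
    qed
  qed measurable
  have split: "(\<integral>x. ?u j x * \<zeta> x \<partial>lborel) = (\<integral>x. av \<omega> A (sc (int j)) (D js) x * (?O x * \<zeta> x) \<partial>lborel)
      + (\<integral>x. ?u j x * (?T j x * \<zeta> x) \<partial>lborel) + (\<integral>x. gG js x * (?P j x * \<zeta> x) \<partial>lborel)" for j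
  proof -
    have um: "loc_int (?u j)" by (intro loc_int_continuous smooth_continuous smooth_pds U_smooth)
    have am: "loc_int (av \<omega> A (sc (int j)) (D js))"
      by (intro loc_int_continuous smooth_continuous smooth_av[OF test sc_pos A D_loc[OF jl]])
    note ints = loc_ind[OF am Om] loc_ind[OF um Tm[of j]] loc_ind[OF gG_loc_int[OF js] Pm[of j]]
    have "AE x in lborel. x \<notin> {x. \<rho> x = 0}" using boundary_null by (rule AE_not_in)
    then have "(\<integral>x. ?u j x * \<zeta> x \<partial>lborel) = (\<integral>x. av \<omega> A (sc (int j)) (D js) x * (?O x * \<zeta> x) + ?u j x * (?T j x * \<zeta> x) + gG js x * (?P j x * \<zeta> x) \<partial>lborel)"
    proof (intro integral_cong_AE)
      show "(\<lambda>x. ?u j x * \<zeta> x) \<in> borel_measurable lborel" using pds_U_measurable zm by simp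
      show "(\<lambda>x. av \<omega> A (sc (int j)) (D js) x * (?O x * \<zeta> x) + ?u j x * (?T j x * \<zeta> x) + gG js x * (?P j x * \<zeta> x)) \<in> borel_measurable lborel"
        by (intro borel_measurable_add ints[THEN borel_measurable_integrable])
      assume "AE x in lborel. x \<notin> {x. \<rho> x = 0}"
      then show "AE x in lborel. ?u j x * \<zeta> x = av \<omega> A (sc (int j)) (D js) x * (?O x * \<zeta> x) + ?u j x * (?T j x * \<zeta> x) + gG js x * (?P j x * \<zeta> x)"
      proof eventually_elim
        case (elim x)
        then consider "\<rho> x < 0" | "0 < \<rho> x" "\<rho> x \<le> 2 * sc (int j)" | "2 * sc (int j) < \<rho> x" by fastforce
        then show ?case
        proof cases
          case 1
          then have "x \<in> \<Omega>" "\<not> 0 < \<rho> x" by (auto simp: Omega_eq)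
          moreover have "\<not> 2 * sc (int j) < \<rho> x" using 1 sc_pos[of "int j"] by linarith
          ultimately have "x \<in> \<Omega>" "\<not> 0 < \<rho> x" "\<not> 2 * sc (int j) < \<rho> x" .
          then show ?thesis by (simp add: inside)
        next
          case 2
          then have "x \<notin> \<Omega>" by (auto simp: Omega_eq)
          then show ?thesis using 2 by simp
        next
          case 3
          then have "\<not> \<rho> x < 0" using sc_pos[of "int j"] by linarith
          then have "x \<notin> \<Omega>" by (auto simp: Omega_eq)
          moreover have "?u j x * \<zeta> x = gG js x * \<zeta> x" using far[OF 3] by (cases "\<zeta> x = 0") auto
          ultimately show ?thesis using 3 by simp
        qed
      qed
    qed
    also have "\<dots> = (\<integral>x. av \<omega> A (sc (int j)) (D js) x * (?O x * \<zeta> x) \<partial>lborel)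
      + (\<integral>x. ?u j x * (?T j x * \<zeta> x) \<partial>lborel) + (\<integral>x. gG js x * (?P j x * \<zeta> x) \<partial>lborel)"
      by (subst Bochner_Integration.integral_add[OF Bochner_Integration.integrable_add[OF ints(1,2)] ints(3)],
          subst Bochner_Integration.integral_add[OF ints(1,2)]) simp
    finally show ?thesis .
  qed
  have "(\<integral>x. g js x * \<zeta> x \<partial>lborel) = (\<integral>x. D js x * (?O x * \<zeta> x) \<partial>lborel) + 0 + (\<integral>x. gG js x * \<zeta> x \<partial>lborel)"
  proof -
    have e: "g js x * \<zeta> x = D js x * (?O x * \<zeta> x) + gG js x * (indicator UNIV x * \<zeta> x)" for x
      using D_zero[OF jl, of x] by (cases "x \<in> \<Omega>") (simp_all add: g_def distrib_right)
    show ?thesis unfolding e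
      using Bochner_Integration.integral_add[OF loc_ind[OF D_loc[OF jl] Om] loc_ind[OF gG_loc_int[OF js], of UNIV]] by simp
  qed
  then show ?thesis unfolding split using tendsto_add[OF tendsto_add[OF lim1 lim2] lim3] by simp
qed

end

text \<open>The limit of the approximations themselves is the case of order 0 of the same lemmas.\<close>
lemma (in burenkov_family) family_order_0: "burenkov_family \<omega> A M p 0 vphi \<psi> D"
proof unfold_locales
  show "test_function UNIV \<omega>" by (rule test)
qed (use supp_w int1 A p M A_eq lip part D_borel D_zero D_Lp in \<open>auto simp: weakly_def\<close>)

context burenkov_family
begin

interpretation l0: burenkov_family \<omega> A M p 0 vphi \<psi> D by (rule family_order_0)

lemma g_Nil_loc_int: "loc_int (g [])" by (rule l0.g_loc_int) simp

text \<open>Integration by parts for the smooth approximations, and passage to the limit on both sides: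
  with order 0 on the left and order \<open>l\<close> on the right.\<close>
lemma weakly_g: assumes js: "length js = l" shows "weakly UNIV js (g []) (g js)"
  unfolding weakly_def
proof (intro allI impI)
  fix \<eta> :: "'n rvec \<Rightarrow> real" assume t: "test_function UNIV \<eta>"
  have cs: "compact (supp \<eta>)" using t by (simp add: test_function_def)
  then have "bounded (\<rho> ` supp \<eta>)"
    by (intro compact_imp_bounded compact_continuous_image continuous_on_subset[OF rho_continuous]) auto
  then obtain b where b: "\<And>x. x \<in> supp \<eta> \<Longrightarrow> \<bar>\<rho> x\<bar> \<le> b" unfolding bounded_iff by auto
  obtain N :: nat where N: "2 * b < 2 ^ N" using real_arch_pow[of 2 "2 * b"] by auto
  have sN: "sc (- int N) = 2 ^ N" by (simp add: sc_def)
  have r: "\<rho> x < sc (- int N) / 2" if "x \<in> supp \<eta>" for x using b[OF that] N unfolding sN by linarith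
  let ?F = "\<lambda>j. U (int j) {- int N..<int j}"
  have "(\<lambda>j. \<integral>x. pds js (?F j) x * \<eta> x \<partial>lborel) \<longlonglongrightarrow> (\<integral>x. g js x * \<eta> x \<partial>lborel)"
    by (rule glue_limit[OF js t]) (use r in_suppI in blast)
  then have 1: "(\<lambda>j. (-1) ^ length js * (\<integral>x. pds js (?F j) x * \<eta> x \<partial>lborel)) \<longlonglongrightarrow> (-1) ^ length js * (\<integral>x. g js x * \<eta> x \<partial>lborel)"
    by (intro tendsto_mult tendsto_const)
  have "(\<lambda>j. \<integral>x. pds [] (?F j) x * pds js \<eta> x \<partial>lborel) \<longlonglongrightarrow> (\<integral>x. g [] x * pds js \<eta> x \<partial>lborel)"
    by (rule l0.glue_limit[OF _ test_function_pds[OF t]]) (use r pds_outside_supp[of _ \<eta> js] in auto)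
  then have 2: "(\<lambda>j. \<integral>x. ?F j x * pds js \<eta> x \<partial>lborel) \<longlonglongrightarrow> (\<integral>x. g [] x * pds js \<eta> x \<partial>lborel)" by simp
  show "(\<integral>x. g [] x * pds js \<eta> x \<partial>lborel) = (-1) ^ length js * (\<integral>x. g js x * \<eta> x \<partial>lborel)"
    using LIMSEQ_unique[OF 2] 1 unfolding integration_by_parts[OF U_smooth t] by blast
qed

end

section \<open>Borel representatives and the extension operator\<close>

text \<open>Lebesgue measure is complete.\<close>
lemma lebesgue_measurable_AE:
  fixes f d :: "'a::euclidean_space \<Rightarrow> real"
  assumes d: "d \<in> borel_measurable borel" and ae: "AE x in lebesgue. f x = d x"
  shows "f \<in> borel_measurable lebesgue"
proof (rule measurableI)
  fix S :: "real set" assume S: "S \<in> sets borel"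
  have ae': "AE x in lborel. f x = d x" using ae by (simp add: AE_completion_iff)
  have 1: "d -` S \<in> sets lebesgue"
    using measurable_sets[OF d S] by (simp add: sets_completionI_sets)
  have "Measurable.pred lebesgue (\<lambda>x. f x \<noteq> d x)"
    by (rule sets_completion_AE) (use ae' in auto)
  then have 2: "{x. f x \<noteq> d x} \<in> sets lebesgue" by (simp add: pred_def)
  have "Measurable.pred lebesgue (\<lambda>x. f x \<noteq> d x \<and> f x \<in> S)"
    by (rule sets_completion_AE) (use ae' in \<open>auto elim: eventually_mono\<close>)
  then have 3: "{x. f x \<noteq> d x \<and> f x \<in> S} \<in> sets lebesgue" by (simp add: pred_def)
  have "f -` S \<inter> space lebesgue = (d -` S - {x. f x \<noteq> d x}) \<union> {x. f x \<noteq> d x \<and> f x \<in> S}" by auto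
  also have "\<dots> \<in> sets lebesgue" using 1 2 3 by (intro sets.Un sets.Diff)
  finally show "f -` S \<inter> space lebesgue \<in> sets lebesgue" .
qed simp

lemma set_integral_AE_eq:
  fixes f d k :: "'a::euclidean_space \<Rightarrow> real"
  assumes d: "d \<in> borel_measurable borel" "\<And>y. y \<notin> U \<Longrightarrow> d y = 0"
    and ae: "AE y in lebesgue. y \<in> U \<longrightarrow> f y = d y" and k: "k \<in> borel_measurable borel"
  shows "(LINT x:U|lebesgue. f x * k x) = (\<integral>x. d x * k x \<partial>lborel)"
proof -
  have dk: "(\<lambda>x. d x * k x) \<in> borel_measurable borel" using d(1) k by measurable
  have ae': "AE x in lebesgue. indicator U x *\<^sub>R (f x * k x) = d x * k x"
    using ae by eventually_elim (use d(2) in \<open>auto simp: indicator_def\<close>)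
  have "(LINT x:U|lebesgue. f x * k x) = (\<integral>x. d x * k x \<partial>lebesgue)"
    unfolding set_lebesgue_integral_def
    using ae' lebesgue_measurable_AE[OF dk ae'] dk by (intro integral_cong_AE) (auto simp: measurable_completion)
  also have "\<dots> = (\<integral>x. d x * k x \<partial>lborel)" using dk by (intro integral_completion) simp
  finally show ?thesis .
qed

lemma Lp_borel_representative:
  fixes U :: "'n::finite rvec set"
  assumes U: "open U" and h: "h \<in> Lp_on p U" and p: "p \<ge> 1"
  shows "\<exists>d. d \<in> borel_measurable borel \<and> (\<forall>y. y \<notin> U \<longrightarrow> d y = 0) \<and> (AE y in lebesgue. y \<in> U \<longrightarrow> d y = h y)
    \<and> (\<integral>\<^sup>+y. ennreal (\<bar>d y\<bar> powr p) \<partial>lborel) < \<infinity>"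
proof -
  have Um: "U \<inter> space lebesgue \<in> sets lebesgue" using U by (simp add: sets_completionI_sets)
  have "(\<lambda>x. indicator U x *\<^sub>R h x) \<in> borel_measurable lebesgue"
    using h borel_measurable_restrict_space_iff[OF Um, of h] by (simp add: Lp_on_def)
  from completion_ex_borel_measurable_real[OF this]
  obtain d0 where d0: "d0 \<in> borel_measurable borel" "AE x in lborel. indicator U x *\<^sub>R h x = d0 x" by auto
  define d where "d x = indicator U x * d0 x" for x
  have Ub: "U \<in> sets borel" using U by simp
  have dm: "d \<in> borel_measurable borel"
    unfolding d_def[abs_def] using d0(1) Ub by (intro borel_measurable_times borel_measurable_indicator)
  have ae: "AE x in lebesgue. d x = indicator U x * h x"
    using AE_completion[OF d0(2)] by eventually_elim (auto simp: d_def indicator_def)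
  have "integrable lebesgue (\<lambda>x. indicator U x *\<^sub>R (\<bar>h x\<bar> powr p))"
    using h integrable_restrict_space[OF Um, of "\<lambda>x. \<bar>h x\<bar> powr p"] by (simp add: Lp_on_def)
  then have fin: "(\<integral>\<^sup>+x. ennreal (norm (indicator U x *\<^sub>R (\<bar>h x\<bar> powr p))) \<partial>lebesgue) < \<infinity>"
    by (simp only: integrable_iff_bounded)
  have "(\<integral>\<^sup>+y. ennreal (\<bar>d y\<bar> powr p) \<partial>lborel) = (\<integral>\<^sup>+y. ennreal (\<bar>d y\<bar> powr p) \<partial>lebesgue)"
    by (simp add: nn_integral_completion)
  also have "\<dots> = (\<integral>\<^sup>+x. ennreal (norm (indicator U x *\<^sub>R (\<bar>h x\<bar> powr p))) \<partial>lebesgue)"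
    using ae p by (intro nn_integral_cong_AE) (auto elim!: eventually_mono simp: indicator_def)
  finally have "(\<integral>\<^sup>+y. ennreal (\<bar>d y\<bar> powr p) \<partial>lborel) < \<infinity>" using fin by simp
  moreover have "AE y in lebesgue. y \<in> U \<longrightarrow> d y = h y" using ae by eventually_elim auto
  ultimately show ?thesis using dm by (intro exI[of _ d]) (auto simp: d_def)
qed

lemma mi_power_count_list: "mi_power z (count_list js) = monom_at js z"
proof (induction js)
  case (Cons j js)
  have "mi_power z (count_list (j # js)) = (\<Prod>i\<in>UNIV. (if i = j then z $ i else 1) * (z $ i) ^ count_list js i)"
    unfolding mi_power_def by (intro prod.cong) auto
  also have "\<dots> = z $ j * mi_power z (count_list js)"
    unfolding mi_power_def by (simp add: prod.distrib)
  finally show ?case by (simp only: Cons.IH monom_at_def list.map prod_list.Cons)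
qed (simp add: mi_power_def monom_at_def)

lemma mollifier_of_kernel:
  fixes \<omega> :: "'n::{finite,linorder} rvec \<Rightarrow> real"
  assumes w: "burenkov_kernel l \<omega>" and "A > 0" "p \<ge> 1"
  shows "mollifier \<omega> A p l"
proof
  have s: "smooth \<omega>" and sup: "supp \<omega> \<subseteq> {x \<in> cball 0 1. 1 / 2 \<le> x $ last_ix}" and i: "(LINT z|lebesgue. \<omega> z) = 1"
    and m: "\<And>\<alpha>. 0 < mi_order \<alpha> \<Longrightarrow> mi_order \<alpha> \<le> l \<Longrightarrow> (LINT z|lebesgue. \<omega> z * mi_power z \<alpha>) = 0"
    using w unfolding burenkov_kernel_def by auto
  have wm: "\<omega> \<in> borel_measurable borel" by (rule smooth_measurable[OF s])
  have "supp \<omega> \<subseteq> cball 0 1" using sup by blast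
  from bounded_subset[OF bounded_cball this] have "compact (supp \<omega>)"
    by (simp add: compact_eq_bounded_closed supp_def)
  then show "test_function UNIV \<omega>" using s by (simp add: test_function_def)
  show "supp \<omega> \<subseteq> {x \<in> cball 0 1. 1 / 2 \<le> x $ last_ix}" by (rule sup)
  show "(\<integral>z. \<omega> z \<partial>lborel) = 1" using i integral_completion[of \<omega> lborel] wm by simp
  fix js :: "'n list" assume js: "0 < length js" "length js \<le> l"
  have mm: "monom_at js \<in> borel_measurable borel"
    by (intro borel_measurable_continuous_onI monom_at_continuous continuous_on_id)
  have "(LINT z|lebesgue. \<omega> z * mi_power z (count_list js)) = 0"
    using m[of "count_list js"] js by (simp add: mi_order_count_list)
  then have "(LINT z|lebesgue. monom_at js z * \<omega> z) = 0" by (simp add: mi_power_count_list mult.commute)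
  then show "(\<integral>z. monom_at js z * \<omega> z \<partial>lborel) = 0"
    using integral_completion[of "\<lambda>z. monom_at js z * \<omega> z" lborel] wm mm by simp
qed (use assms in auto)

text \<open>The affine map \<open>z \<mapsto> x - s stretch A z\<close> is invertible, so preimages of null sets are null sets.\<close>
lemma AE_affine_stretch:
  fixes x :: "'n::{finite,linorder} rvec"
  assumes P: "AE y in lborel. P y" and "s > 0" "A > 0"
  shows "AE z in lborel. P (x - s *\<^sub>R stretch A z)"
proof -
  obtain N where N0: "{y \<in> space lborel. \<not> P y} \<subseteq> N" "emeasure lborel N = 0" "N \<in> sets lborel"
    by (rule AE_E[OF P])
  have N: "{y. \<not> P y} \<subseteq> N" "N \<in> sets borel" "emeasure lborel N = 0"
    using N0 by simp_all
  let ?c = "\<lambda>i::'n. - (s * (if i = last_ix then A else 1))"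
  have d: "x + diag_mult ?c z = x - s *\<^sub>R stretch A z" for z
    by (auto simp: vec_eq_iff diag_mult_def stretch_def)
  have c: "?c i \<noteq> 0" for i using assms by simp
  have nm: "indicator N \<in> borel_measurable (borel :: 'n rvec measure)" using N(2) by (rule borel_measurable_indicator)
  have pos: "(\<Prod>i\<in>UNIV. \<bar>?c i\<bar>) > 0" using assms by (intro prod_pos) auto
  have s1: "(\<integral>\<^sup>+y. ennreal (indicator N y) \<partial>lborel) = ennreal (\<Prod>i\<in>UNIV. \<bar>?c i\<bar>) * (\<integral>\<^sup>+z. ennreal (indicator N (x + diag_mult ?c z)) \<partial>lborel)"
    by (rule lborel_integral_diag(2)[OF nm c])
  have s0: "(\<integral>\<^sup>+y. ennreal (indicator N y) \<partial>lborel) = 0" using N by (simp add: ennreal_indicator)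
  have z: "(\<integral>\<^sup>+z. ennreal (indicator N (x - s *\<^sub>R stretch A z)) \<partial>lborel) = 0"
  proof -
    have gen: "ennreal q * Y = 0 \<Longrightarrow> q > 0 \<Longrightarrow> Y = 0" for q and Y :: ennreal
      by (auto simp: ennreal_eq_0_iff)
    show ?thesis by (rule gen[OF trans[OF s1[unfolded d, symmetric] s0] pos])
  qed
  have "(\<lambda>z. x - s *\<^sub>R stretch A z) \<in> borel_measurable borel" by measurable
  from measurable_compose[OF this nm]
  have "(\<lambda>z. ennreal (indicator N (x - s *\<^sub>R stretch A z))) \<in> borel_measurable lborel" by simp
  from nn_integral_0_iff_AE[OF this] z have "AE z in lborel. ennreal (indicator N (x - s *\<^sub>R stretch A z)) = 0" by simp
  then show ?thesis by eventually_elim (use N(1) in \<open>auto simp: indicator_def split: if_splits\<close>)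
qed

lemma has_weak_deriv_self:
  assumes "locally_integrable U f" shows "has_weak_deriv U (\<lambda>_. 0) f f"
proof -
  have "mi_list (\<lambda>_::'a. 0 :: nat) = []" using length_mi_list[of "\<lambda>_::'a. 0"] by (simp add: mi_order_def)
  then show ?thesis using assms by (simp add: has_weak_deriv_def mi_deriv_eq_pds mi_order_def)
qed

context burenkov
begin

text \<open>By uniqueness all weak derivatives of a given order agree almost everywhere on the domain, in
  particular the unspecified representative chosen by \<open>weak_deriv\<close>, and \<open>f\<close> itself for order 0.\<close>
lemma sobolev_family:
  assumes f: "f \<in> sobolev l p \<Omega>"
  shows "\<exists>D. burenkov_family \<omega> A M p l vphi \<psi> D \<and> (AE y in lebesgue. y \<in> \<Omega> \<longrightarrow> f y = D [] y)
    \<and> (\<forall>js. length js \<le> l \<longrightarrow> (AE y in lebesgue. y \<in> \<Omega> \<longrightarrow> weak_deriv \<Omega> (count_list js) f y = D js y))"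
proof -
  have "\<exists>h d. length js \<le> l \<longrightarrow> (h \<in> Lp_on p \<Omega> \<and> has_weak_deriv \<Omega> (count_list js) f h \<and>
     d \<in> borel_measurable borel \<and> (\<forall>y. y \<notin> \<Omega> \<longrightarrow> d y = 0) \<and> (AE y in lebesgue. y \<in> \<Omega> \<longrightarrow> d y = h y)
    \<and> (\<integral>\<^sup>+y. ennreal (\<bar>d y\<bar> powr p) \<partial>lborel) < \<infinity>)" for js :: "'n list"
  proof (cases "length js \<le> l")
    case True
    then have "\<exists>h\<in>Lp_on p \<Omega>. has_weak_deriv \<Omega> (count_list js) f h"
      using f unfolding sobolev_def by (simp add: mi_order_count_list)
    then obtain h where "h \<in> Lp_on p \<Omega>" "has_weak_deriv \<Omega> (count_list js) f h" by blast
    then show ?thesis using Lp_borel_representative[OF open_Omega _ p] by blast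
  qed auto
  then have "\<forall>js. \<exists>h d. length js \<le> l \<longrightarrow> (h \<in> Lp_on p \<Omega> \<and> has_weak_deriv \<Omega> (count_list js) f h \<and>
     d \<in> borel_measurable borel \<and> (\<forall>y. y \<notin> \<Omega> \<longrightarrow> d y = 0) \<and> (AE y in lebesgue. y \<in> \<Omega> \<longrightarrow> d y = h y)
    \<and> (\<integral>\<^sup>+y. ennreal (\<bar>d y\<bar> powr p) \<partial>lborel) < \<infinity>)" by (rule allI)
  from choice[OF this] obtain h where "\<forall>js. \<exists>d. length js \<le> l \<longrightarrow> (h js \<in> Lp_on p \<Omega> \<and> has_weak_deriv \<Omega> (count_list js) f (h js) \<and>
     d \<in> borel_measurable borel \<and> (\<forall>y. y \<notin> \<Omega> \<longrightarrow> d y = 0) \<and> (AE y in lebesgue. y \<in> \<Omega> \<longrightarrow> d y = h js y)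
    \<and> (\<integral>\<^sup>+y. ennreal (\<bar>d y\<bar> powr p) \<partial>lborel) < \<infinity>)" by (rule exE)
  from choice[OF this] obtain D where all: "\<forall>js. length js \<le> l \<longrightarrow> (h js \<in> Lp_on p \<Omega> \<and> has_weak_deriv \<Omega> (count_list js) f (h js) \<and>
     D js \<in> borel_measurable borel \<and> (\<forall>y. y \<notin> \<Omega> \<longrightarrow> D js y = 0) \<and> (AE y in lebesgue. y \<in> \<Omega> \<longrightarrow> D js y = h js y)
    \<and> (\<integral>\<^sup>+y. ennreal (\<bar>D js y\<bar> powr p) \<partial>lborel) < \<infinity>)" by (rule exE)
  have hD: "h js \<in> Lp_on p \<Omega>" "has_weak_deriv \<Omega> (count_list js) f (h js)"
     "D js \<in> borel_measurable borel" "\<And>y. y \<notin> \<Omega> \<Longrightarrow> D js y = 0"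
     "AE y in lebesgue. y \<in> \<Omega> \<longrightarrow> D js y = h js y"
     "(\<integral>\<^sup>+y. ennreal (\<bar>D js y\<bar> powr p) \<partial>lborel) < \<infinity>" if "length js \<le> l" for js
    using all[rule_format, OF that] by simp_all
  have rep: "AE y in lebesgue. y \<in> \<Omega> \<longrightarrow> k y = D js y" if js: "length js \<le> l" and k: "has_weak_deriv \<Omega> (count_list js) f k" for js k
    using weak_deriv_AE_unique[OF test int1 open_Omega k hD(2)[OF js]] hD(5)[OF js] by eventually_elim auto
  have c0: "count_list ([] :: 'n list) = (\<lambda>_. 0)" by auto
  have "locally_integrable \<Omega> f" using hD(2)[of "[]"] by (simp add: has_weak_deriv_def)
  from has_weak_deriv_self[OF this] have f0: "AE y in lebesgue. y \<in> \<Omega> \<longrightarrow> f y = D [] y"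
    by (intro rep) (auto simp: c0)
  have wd: "AE y in lebesgue. y \<in> \<Omega> \<longrightarrow> weak_deriv \<Omega> (count_list js) f y = D js y" if js: "length js \<le> l" for js
    by (rule rep[OF js]) (unfold weak_deriv_def, rule someI[of _ "h js"], rule hD(2)[OF js])
  have "burenkov_family \<omega> A M p l vphi \<psi> D"
  proof unfold_locales
    fix js :: "'n list" assume js: "length js \<le> l"
    show "D js \<in> borel_measurable borel" "(\<integral>\<^sup>+y. ennreal (\<bar>D js y\<bar> powr p) \<partial>lborel) < \<infinity>" using hD js by auto
    show "D js y = 0" if "y \<notin> \<Omega>" for y using hD js that by auto
    show "weakly \<Omega> js (D []) (D js)"
      unfolding weakly_def
    proof (intro allI impI)
      fix \<eta> assume t: "test_function \<Omega> \<eta>"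
      then have s: "smooth \<eta>" by (simp add: test_function_def)
      have m: "pds js \<eta> \<in> borel_measurable borel" "\<eta> \<in> borel_measurable borel"
        using s smooth_pds smooth_measurable by blast+
      have "(LINT x:\<Omega>|lebesgue. f x * mi_deriv (count_list js) \<eta> x) = (-1) ^ mi_order (count_list js) * (LINT x:\<Omega>|lebesgue. h js x * \<eta> x)"
        using hD(2)[OF js] t by (simp add: has_weak_deriv_def)
      moreover have "(LINT x:\<Omega>|lebesgue. f x * pds js \<eta> x) = (\<integral>x. D [] x * pds js \<eta> x \<partial>lborel)"
        by (rule set_integral_AE_eq[OF hD(3) hD(4) f0 m(1)]) auto
      moreover have "(LINT x:\<Omega>|lebesgue. h js x * \<eta> x) = (\<integral>x. D js x * \<eta> x \<partial>lborel)"
        by (rule set_integral_AE_eq[OF hD(3)[OF js] hD(4)[OF js] rep[OF js hD(2)[OF js]] m(2)])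
      ultimately show "(\<integral>x. D [] x * pds js \<eta> x \<partial>lborel) = (-1) ^ length js * (\<integral>x. D js x * \<eta> x \<partial>lborel)"
        by (simp add: pds_eq_mi_deriv[OF s] mi_order_count_list)
    qed
  qed
  then show ?thesis using f0 wd by blast
qed

end

context burenkov_family
begin

text \<open>For \<open>x\<close> in the support of \<open>\<psi> k\<close> the operator averages \<open>f\<close> over points of the domain only, so the
  Borel representative has the same average, for every such \<open>x\<close> and not just almost everywhere.\<close>
lemma burenkov_avg_eq_fk:
  assumes f: "AE y in lebesgue. y \<in> \<Omega> \<longrightarrow> f y = D [] y" and x: "\<rho> x \<le> 2 * sc k"
  shows "burenkov_avg M \<omega> f k x = fk k x"
proof -
  have sh: "burenkov_shift (16 * (M + 1)) k x z = x - sc k *\<^sub>R stretch A z" for z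
    by (auto simp: burenkov_shift_def vec_eq_iff stretch_def diag_mult_def sc_def A_eq)
  have "AE y in lborel. y \<in> \<Omega> \<longrightarrow> f y = D [] y" using f by (simp add: AE_completion_iff)
  from AE_affine_stretch[OF this sc_pos[of k] A, of x]
  have ae: "AE z in lborel. f (x - sc k *\<^sub>R stretch A z) * \<omega> z = D [] (x - sc k *\<^sub>R stretch A z) * \<omega> z"
  proof eventually_elim
    case (elim z)
    show ?case
    proof (cases "\<omega> z = 0")
      case False
      have "x - sc k *\<^sub>R stretch A z \<in> \<Omega>"
        by (rule stretch_in_Omega[OF supp_w_Z[OF w_nz(1)[OF False]] sc_pos x])
      then show ?thesis using elim by simp
    qed simp
  qed
  then have ae': "AE z in lebesgue. f (x - sc k *\<^sub>R stretch A z) * \<omega> z = D [] (x - sc k *\<^sub>R stretch A z) * \<omega> z"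
    by (rule AE_completion)
  have [measurable]: "D [] \<in> borel_measurable borel" by (rule D_borel) simp
  have m: "(\<lambda>z. D [] (x - sc k *\<^sub>R stretch A z) * \<omega> z) \<in> borel_measurable borel" by measurable
  have "burenkov_avg M \<omega> f k x = (\<integral>z. D [] (x - sc k *\<^sub>R stretch A z) * \<omega> z \<partial>lebesgue)"
    unfolding burenkov_avg_def sh
    using ae' lebesgue_measurable_AE[OF m ae'] m by (intro integral_cong_AE) (auto simp: measurable_completion)
  also have "\<dots> = fk k x" unfolding fk_def av_def using m by (intro integral_completion) simp
  finally show ?thesis .
qed

lemma burenkov_op_AE:
  assumes f: "AE y in lebesgue. y \<in> \<Omega> \<longrightarrow> f y = D [] y"
  shows "AE y in lebesgue. burenkov_op M vphi \<psi> \<omega> f y = g [] y"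
proof -
  have "AE y in lebesgue. y \<notin> {x. \<rho> x = 0}"
    by (rule AE_completion[OF AE_not_in[OF boundary_null]])
  then show ?thesis using f
  proof eventually_elim
    case (elim x)
    show ?case
    proof (cases "x \<in> \<Omega>")
      case True
      then have "x \<notin> G" by (auto simp: Omega_eq G_eq)
      then show ?thesis using True elim by (simp add: burenkov_op_def g_def gG_outside)
    next
      case False
      then have "x \<in> G" using elim(1) by (auto simp: Omega_eq G_eq)
      then obtain j where j: "x \<in> layer j" unfolding G_union_layers by blast
      define N where "N = nat (\<bar>j\<bar> + 3)"
      have N: "\<bar>j\<bar> + 3 \<le> int N" by (simp add: N_def)
      have k: "k \<in> {- int N..int N}" if nz: "\<psi> k x \<noteq> 0" for k
      proof -
        have a: "sc k < 8 * sc j" "sc j < 2 * sc k" using psi_nz[OF nz] j by (auto simp: layer_def)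
        have "\<not> k \<le> j - 3"
        proof
          assume "k \<le> j - 3"
          then have "sc (j - 3) \<le> sc k" by (rule sc_mono)
          then show False using a(1) sc_minus[of j 3] by simp
        qed
        moreover have "\<not> j + 1 \<le> k"
        proof
          assume "j + 1 \<le> k"
          then have "sc k \<le> sc (j + 1)" by (rule sc_mono)
          moreover have "sc j = 2 * sc (j + 1)" using sc_diff[of j "j + 1"] by simp
          ultimately show False using a(2) by simp
        qed
        ultimately show ?thesis using N by auto
      qed
      have e: "\<psi> k x * burenkov_avg M \<omega> f k x = \<psi> k x * fk k x" for k
        using burenkov_avg_eq_fk[OF f, of x k] psi_nz(2)[of k x] by (cases "\<psi> k x = 0") auto
      have "burenkov_op M vphi \<psi> \<omega> f x = (\<Sum>\<^sub>\<infinity>k\<in>UNIV. \<psi> k x * fk k x)"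
        using False by (simp add: burenkov_op_def e)
      also have "\<dots> = (\<Sum>\<^sub>\<infinity>k\<in>{- int N..int N}. \<psi> k x * fk k x)"
        by (rule infsum_cong_neutral) (use k in auto)
      also have "\<dots> = V N x" by (simp add: V_def)
      also have "\<dots> = gG [] x" using V_eq_U_layer[OF j N, of "[]"] gG_layer[OF j, of "[]"] by simp
      also have "\<dots> = g [] x" using D_zero[OF _ False, of "[]"] by (simp add: g_def)
      finally show ?thesis .
    qed
  qed
qed

lemma locally_integrable_of_loc_int:
  fixes d F :: "'n rvec \<Rightarrow> real"
  assumes d: "loc_int d" and ae: "AE y in lebesgue. F y = d y"
  shows "locally_integrable UNIV F"
  unfolding locally_integrable_def
proof (intro allI impI)
  fix K :: "'n rvec set" assume "compact K \<and> K \<subseteq> UNIV"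
  then have K: "compact K" by simp
  obtain R where R: "\<And>x. x \<in> K \<Longrightarrow> norm x \<le> R" using compact_imp_bounded[OF K] by (auto simp: bounded_iff)
  have dm: "d \<in> borel_measurable borel" using d by (simp add: loc_int_def)
  have Kb: "K \<in> sets borel" by (rule borel_compact[OF K])
  have im: "(\<lambda>x. indicat_real K x) \<in> borel_measurable borel" using Kb by (rule borel_measurable_indicator)
  have "integrable lborel (\<lambda>x. d x * indicat_real K x)"
    by (rule loc_int_mult_bounded[OF d im, of 1 R]) (use R in \<open>force simp: indicator_def\<close>)+
  then have i: "integrable lebesgue (\<lambda>x. d x * indicat_real K x)"
    using dm im by (subst integrable_completion) auto
  have dk: "(\<lambda>x. d x * indicat_real K x) \<in> borel_measurable borel" using dm im by (intro borel_measurable_times)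
  have ae': "AE x in lebesgue. indicat_real K x *\<^sub>R F x = d x * indicat_real K x"
    using ae by eventually_elim simp
  have "integrable lebesgue (\<lambda>x. indicat_real K x *\<^sub>R F x)"
    by (rule integrable_cong_AE_imp[OF i lebesgue_measurable_AE[OF dk ae']]) (use ae' in \<open>auto elim: eventually_mono\<close>)
  then show "set_integrable lebesgue K F" by (simp add: set_integrable_def)
qed

lemma extension_has_weak_deriv:
  assumes f: "AE y in lebesgue. y \<in> \<Omega> \<longrightarrow> f y = D [] y" and \<alpha>: "mi_order \<alpha> = l"
  shows "has_weak_deriv UNIV \<alpha> (burenkov_op M vphi \<psi> \<omega> f) (g (mi_list \<alpha>))"
proof -
  let ?js = "mi_list \<alpha>" and ?F = "burenkov_op M vphi \<psi> \<omega> f"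
  have js: "length ?js = l" using \<alpha> by (simp add: length_mi_list)
  note T = burenkov_op_AE[OF f]
  have gm: "g [] \<in> borel_measurable borel" "g ?js \<in> borel_measurable borel" using g_measurable js by auto
  show ?thesis
    unfolding has_weak_deriv_def
  proof (intro conjI allI impI)
    show "locally_integrable UNIV ?F" by (rule locally_integrable_of_loc_int[OF g_Nil_loc_int T])
    show "locally_integrable UNIV (g ?js)" by (rule locally_integrable_of_loc_int[OF g_loc_int[OF js]]) simp
    fix \<eta> :: "'n rvec \<Rightarrow> real" assume t: "test_function UNIV \<eta>"
    have m: "pds ?js \<eta> \<in> borel_measurable borel" "\<eta> \<in> borel_measurable borel"
      using t smooth_pds smooth_measurable by (auto simp: test_function_def)
    have "(LINT x:UNIV|lebesgue. ?F x * mi_deriv \<alpha> \<eta> x) = (\<integral>x. g [] x * pds ?js \<eta> x \<partial>lborel)"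
      unfolding mi_deriv_eq_pds using T by (intro set_integral_AE_eq gm m) auto
    moreover have "(LINT x:UNIV|lebesgue. g ?js x * \<eta> x) = (\<integral>x. g ?js x * \<eta> x \<partial>lborel)"
      by (intro set_integral_AE_eq gm m) auto
    ultimately show "(LINT x:UNIV|lebesgue. ?F x * mi_deriv \<alpha> \<eta> x) = (-1) ^ mi_order \<alpha> * (LINT x:UNIV|lebesgue. g ?js x * \<eta> x)"
      using weakly_g[OF js] t js \<alpha> by (simp add: weakly_def)
  qed
qed

text \<open>If one of the norms on the right is infinite there is nothing to prove. Otherwise their sum
  \<open>mm\<close> bounds every integral of \<open>|D c|\<^sup>p\<close> over a ball of radius \<open>r\<close> by \<open>\<phi> r mm\<^sup>p\<close>, and \<open>g_morrey\<close>
  is applied with this bound. The summand 1 makes the constant positive.\<close>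
lemma morrey_norm_bound:
  assumes js: "length js = l" and F: "AE y in lebesgue. F y = g js y"
    and h: "\<And>c. length c = l \<Longrightarrow> AE y in lebesgue. y \<in> \<Omega> \<longrightarrow> h (count_list c) y = D c y"
    and \<phi>: "\<And>r. 0 < r \<Longrightarrow> 0 < \<phi> r"
  shows "morrey_norm \<phi> \<delta> p UNIV F \<le> ennreal ((morrey_const * real (card {c :: 'n list. length c = l}) + 1) powr (1 / p))
     * (\<Sum>\<beta> | mi_order \<beta> = l. morrey_norm \<phi> \<delta> p \<Omega> (h \<beta>))"
proof -
  let ?n = "real (card {c :: 'n list. length c = l})" and ?B = "{\<beta> :: 'n multi_index. mi_order \<beta> = l}"
  let ?C = "(morrey_const * ?n + 1) powr (1 / p)"
  have mc: "morrey_const \<ge> 0" using local_const_nonneg by (simp add: morrey_const_def)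
  have "morrey_const * ?n + 1 \<noteq> 0" using mult_nonneg_nonneg[OF mc, of ?n] by linarith
  then have C: "?C > 0" by simp
  have B: "?B = count_list ` {c. length c = l}"
    by (auto simp: mi_order_count_list) (metis (mono_tags) count_list_mi_list image_iff length_mi_list mem_Collect_eq)
  have finB: "finite ?B" unfolding B by (intro finite_imageI finite_lists_of_length)
  show ?thesis
  proof (cases "\<exists>\<beta>\<in>?B. morrey_norm \<phi> \<delta> p \<Omega> (h \<beta>) = \<infinity>")
    case True
    then obtain \<beta> where b: "\<beta> \<in> ?B" "morrey_norm \<phi> \<delta> p \<Omega> (h \<beta>) = \<infinity>" by blast
    have "morrey_norm \<phi> \<delta> p \<Omega> (h \<beta>) \<le> (\<Sum>\<beta> | mi_order \<beta> = l. morrey_norm \<phi> \<delta> p \<Omega> (h \<beta>))"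
      using b(1) finB by (intro member_le_sum) auto
    then have "(\<Sum>\<beta> | mi_order \<beta> = l. morrey_norm \<phi> \<delta> p \<Omega> (h \<beta>)) = \<infinity>" using b(2) by (simp add: top_unique)
    then show ?thesis using C by (simp add: ennreal_mult_top)
  next
    case False
    define m where "m \<beta> = enn2real (morrey_norm \<phi> \<delta> p \<Omega> (h \<beta>))" for \<beta>
    have m: "morrey_norm \<phi> \<delta> p \<Omega> (h \<beta>) = ennreal (m \<beta>)" "m \<beta> \<ge> 0" if "\<beta> \<in> ?B" for \<beta>
      using False that by (auto simp: m_def less_top)
    define mm where "mm = (\<Sum>\<beta>\<in>?B. m \<beta>)"
    have mm: "mm \<ge> 0" "\<And>\<beta>. \<beta> \<in> ?B \<Longrightarrow> m \<beta> \<le> mm"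
      unfolding mm_def using m(2) finB by (auto intro!: sum_nonneg member_le_sum)
    have "(\<Sum>\<beta> | mi_order \<beta> = l. morrey_norm \<phi> \<delta> p \<Omega> (h \<beta>)) = (\<Sum>\<beta>\<in>?B. ennreal (m \<beta>))"
      by (rule sum.cong[OF refl m(1)])
    also have "\<dots> = ennreal mm" unfolding mm_def by (rule sum_ennreal[OF m(2)])
    finally have sum: "(\<Sum>\<beta> | mi_order \<beta> = l. morrey_norm \<phi> \<delta> p \<Omega> (h \<beta>)) = ennreal mm" .
    have key: "lp_int p (ball w r) (D c) \<le> ennreal (\<phi> r * mm powr p)"
      if r: "0 < r" "ennreal r < \<delta>" and w: "w \<in> \<Omega>" and c: "length c = l" for r w c
    proof -
      let ?b = "count_list c"
      have b: "?b \<in> ?B" using c by (simp add: mi_order_count_list)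
      define I where "I = (\<integral>\<^sup>+y. ennreal (\<bar>h ?b y\<bar> powr p) * indicator (ball w r \<inter> \<Omega>) y \<partial>lebesgue)"
      have "ennreal_powr (I / ennreal (\<phi> r)) (1 / p) \<le> morrey_norm \<phi> \<delta> p \<Omega> (h ?b)"
        unfolding morrey_norm_def I_def using r w by (intro SUP_upper2[of w] SUP_upper2[of r]) auto
      then have le: "ennreal_powr (I / ennreal (\<phi> r)) (1 / p) \<le> ennreal (m ?b)" using m(1)[OF b] by simp
      then have ni: "I / ennreal (\<phi> r) \<noteq> \<infinity>" by (auto simp: ennreal_powr_def top_unique)
      then obtain a where a: "I / ennreal (\<phi> r) = ennreal a" "a \<ge> 0" by (cases "I / ennreal (\<phi> r)") auto
      have "a powr (1 / p) \<le> m ?b" using le a m(2)[OF b] by (simp add: ennreal_powr_def)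
      then have "(a powr (1 / p)) powr p \<le> mm powr p"
        using mm(2)[OF b] p by (intro powr_mono2) auto
      then have "a \<le> mm powr p" using p a(2) by (simp add: powr_powr)
      have "I = (I / ennreal (\<phi> r)) * ennreal (\<phi> r)"
        using \<phi>[OF r(1)] by (simp add: ennreal_divide_times mult_divide_eq_ennreal)
      also have "\<dots> = ennreal (\<phi> r * a)" unfolding a(1) using a(2) \<phi>[OF r(1)] by (simp add: ennreal_mult mult.commute)
      also have "\<dots> \<le> ennreal (\<phi> r * mm powr p)"
        using \<open>a \<le> mm powr p\<close> \<phi>[OF r(1)] by (intro ennreal_leI mult_left_mono) auto
      finally have "I \<le> ennreal (\<phi> r * mm powr p)" .
      moreover have "lp_int p (ball w r) (D c) = I"
      proof -
        have "lp_int p (ball w r) (D c) = (\<integral>\<^sup>+y\<in>ball w r. ennreal (\<bar>D c y\<bar> powr p) \<partial>lebesgue)"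
          by (simp add: nn_integral_completion)
        also have "\<dots> = I" unfolding I_def
        proof (rule nn_integral_cong_AE)
          show "AE y in lebesgue. ennreal (\<bar>D c y\<bar> powr p) * indicator (ball w r) y = ennreal (\<bar>h ?b y\<bar> powr p) * indicator (ball w r \<inter> \<Omega>) y"
            using h[OF c]
          proof eventually_elim
            case (elim y)
            show ?case using elim D_zero[of c y] c p by (cases "y \<in> \<Omega>") (auto simp: indicator_def)
          qed
        qed
        finally show ?thesis .
      qed
      ultimately show ?thesis by simp
    qed
    have "ennreal_powr ((\<integral>\<^sup>+y. ennreal (\<bar>F y\<bar> powr p) * indicator (ball x r \<inter> UNIV) y \<partial>lebesgue) / ennreal (\<phi> r)) (1 / p) \<le> ennreal (?C * mm)"
      if r: "0 < r" "ennreal r < \<delta>" for x r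
    proof -
      define I where "I = (\<integral>\<^sup>+y. ennreal (\<bar>F y\<bar> powr p) * indicator (ball x r \<inter> UNIV) y \<partial>lebesgue)"
      have "I = (\<integral>\<^sup>+y\<in>ball x r. ennreal (\<bar>g js y\<bar> powr p) \<partial>lebesgue)"
        unfolding I_def using F by (intro nn_integral_cong_AE) (auto elim!: eventually_mono)
      also have "\<dots> = lp_int p (ball x r) (g js)" by (simp add: nn_integral_completion)
      also have "\<dots> \<le> ennreal morrey_const * (\<Sum>c :: 'n list | length c = l. ennreal (\<phi> r * mm powr p))"
        by (rule g_morrey[OF js r(1)]) (rule key[OF r])
      also have "\<dots> = ennreal (morrey_const * (?n * (\<phi> r * mm powr p)))"
        using mc \<phi>[OF r(1)] by (simp add: ennreal_mult ennreal_of_nat_eq_real_of_nat)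
      finally have "I / ennreal (\<phi> r) \<le> ennreal (morrey_const * (?n * (\<phi> r * mm powr p))) / ennreal (\<phi> r)"
        by (rule divide_right_mono_ennreal)
      also have "\<dots> = ennreal (morrey_const * ?n * mm powr p)"
        using \<phi>[OF r(1)] mc by (subst divide_ennreal) (auto simp: field_simps)
      finally have le: "I / ennreal (\<phi> r) \<le> ennreal (morrey_const * ?n * mm powr p)" .
      then have ni: "I / ennreal (\<phi> r) \<noteq> \<infinity>" by (auto simp: top_unique)
      then obtain a where a: "I / ennreal (\<phi> r) = ennreal a" "a \<ge> 0" by (cases "I / ennreal (\<phi> r)") auto
      have "a \<le> morrey_const * ?n * mm powr p" using le a mc by (simp add: ennreal_le_iff)
      also have "\<dots> \<le> (morrey_const * ?n + 1) * mm powr p" by (intro mult_right_mono) auto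
      finally have "a powr (1 / p) \<le> ((morrey_const * ?n + 1) * mm powr p) powr (1 / p)"
        using a(2) p by (intro powr_mono2) auto
      also have "\<dots> = ?C * mm" using mc mm(1) p by (simp add: powr_mult powr_powr)
      finally show ?thesis unfolding I_def[symmetric] using a ni by (simp add: ennreal_powr_def ennreal_leI)
    qed
    then have "morrey_norm \<phi> \<delta> p UNIV F \<le> ennreal (?C * mm)"
      unfolding morrey_norm_def by (intro SUP_least) auto
    also have "\<dots> = ennreal ?C * ennreal mm" using C mm(1) by (simp add: ennreal_mult)
    finally show ?thesis unfolding sum .
  qed
qed

end

lemma sobolev_order_0: "f \<in> sobolev l p U \<Longrightarrow> f \<in> sobolev 0 p U"
  unfolding sobolev_def by auto

lemma burenkov_kernel_order_0: "burenkov_kernel l \<omega> \<Longrightarrow> burenkov_kernel 0 \<omega>"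
  unfolding burenkov_kernel_def by auto

theorem corollary2p1:
  fixes vphi :: "'n::{finite,linorder} rvec \<Rightarrow> real"
    and \<psi> :: "int \<Rightarrow> 'n rvec \<Rightarrow> real"
    and \<omega> :: "'n rvec \<Rightarrow> real"
    and \<phi> :: "real \<Rightarrow> real"
    and M p :: real
    and l :: nat
  assumes "M > 0"
    and "\<And>x y. \<bar>vphi (hbar x) - vphi (hbar y)\<bar> \<le> M * norm (hbar x - hbar y)"
    and "burenkov_partition vphi \<psi>"
    and "burenkov_kernel l \<omega>"
    and "1 \<le> p"
    and "\<And>r. 0 < r \<Longrightarrow> 0 < \<phi> r"
  defines "T \<equiv> burenkov_op M vphi \<psi> \<omega>"
  shows
    "(\<exists>c>0. \<forall>\<delta>>0. \<forall>f \<in> sobolev l p (Omega vphi).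
        morrey_norm \<phi> \<delta> p UNIV (T f) \<le> ennreal c * morrey_norm \<phi> \<delta> p (Omega vphi) f)
     \<and>
     (\<forall>D>0. \<exists>c>0. \<forall>\<delta>>0. \<forall>f \<in> sobolev l p (Omega vphi).
        ess_supp (Omega vphi) f \<subseteq> {x \<in> Omega vphi. \<bar>rho vphi x\<bar> < D} \<longrightarrow>
        (\<forall>\<alpha>. mi_order \<alpha> = l \<longrightarrow>
           morrey_norm \<phi> \<delta> p UNIV (weak_deriv UNIV \<alpha> (T f))
             \<le> ennreal c * (\<Sum>\<beta> | mi_order \<beta> = l.
                  morrey_norm \<phi> \<delta> p (Omega vphi) (weak_deriv (Omega vphi) \<beta> f))))"
proof -
  define A where "A = 16 * (M + 1)"
  have A: "A > 0" using assms(1) by (simp add: A_def)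
  have B: "burenkov \<omega> A M p k vphi \<psi>" if "burenkov_kernel k \<omega>" for k
    using mollifier_of_kernel[OF that A assms(5)] assms(1-3)
    by (simp add: burenkov_def burenkov_axioms_def A_def)
  interpret b0: burenkov \<omega> A M p 0 vphi \<psi> by (rule B[OF burenkov_kernel_order_0[OF assms(4)]])
  interpret bl: burenkov \<omega> A M p l vphi \<psi> by (rule B[OF assms(4)])
  have mc: "b0.morrey_const \<ge> 0" "bl.morrey_const \<ge> 0"
    using b0.local_const_nonneg bl.local_const_nonneg by (simp_all add: b0.morrey_const_def bl.morrey_const_def)
  show ?thesis
  proof (intro conjI)
    let ?c = "(b0.morrey_const * real (card {c :: 'n list. length c = 0}) + 1) powr (1 / p)"
    show "\<exists>c>0. \<forall>\<delta>>0. \<forall>f \<in> sobolev l p (Omega vphi).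
        morrey_norm \<phi> \<delta> p UNIV (T f) \<le> ennreal c * morrey_norm \<phi> \<delta> p (Omega vphi) f"
    proof (intro exI[of _ ?c] conjI allI ballI impI)
      have "b0.morrey_const * real (card {c :: 'n list. length c = 0}) + 1 \<noteq> 0"
        using mult_nonneg_nonneg[OF mc(1), of "real (card {c :: 'n list. length c = 0})"] by linarith
      then show "?c > 0" by simp
      fix \<delta> :: ennreal and f assume "f \<in> sobolev l p (Omega vphi)"
      from b0.sobolev_family[OF sobolev_order_0[OF this]] obtain D where
        D: "burenkov_family \<omega> A M p 0 vphi \<psi> D" and f: "AE y in lebesgue. y \<in> Omega vphi \<longrightarrow> f y = D [] y" by blast
      interpret burenkov_family \<omega> A M p 0 vphi \<psi> D by (rule D)
      have "{\<beta> :: 'n multi_index. mi_order \<beta> = 0} = {\<lambda>_. 0}" by (auto simp: mi_order_def)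
      moreover have "morrey_norm \<phi> \<delta> p UNIV (T f) \<le> ennreal ?c * (\<Sum>\<beta> :: 'n multi_index | mi_order \<beta> = 0. morrey_norm \<phi> \<delta> p (Omega vphi) f)"
        by (rule morrey_norm_bound[of "[]"]) (use f burenkov_op_AE[OF f] assms(6) in \<open>auto simp: T_def\<close>)
      ultimately show "morrey_norm \<phi> \<delta> p UNIV (T f) \<le> ennreal ?c * morrey_norm \<phi> \<delta> p (Omega vphi) f" by simp
    qed
  next
    let ?c = "(bl.morrey_const * real (card {c :: 'n list. length c = l}) + 1) powr (1 / p)"
    show "\<forall>D>0. \<exists>c>0. \<forall>\<delta>>0. \<forall>f \<in> sobolev l p (Omega vphi).
        ess_supp (Omega vphi) f \<subseteq> {x \<in> Omega vphi. \<bar>rho vphi x\<bar> < D} \<longrightarrow>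
        (\<forall>\<alpha>. mi_order \<alpha> = l \<longrightarrow>
           morrey_norm \<phi> \<delta> p UNIV (weak_deriv UNIV \<alpha> (T f))
             \<le> ennreal c * (\<Sum>\<beta> | mi_order \<beta> = l.
                  morrey_norm \<phi> \<delta> p (Omega vphi) (weak_deriv (Omega vphi) \<beta> f)))"
    proof (intro allI impI exI[of _ ?c] conjI ballI)
      have "bl.morrey_const * real (card {c :: 'n list. length c = l}) + 1 \<noteq> 0"
        using mult_nonneg_nonneg[OF mc(2), of "real (card {c :: 'n list. length c = l})"] by linarith
      then show "?c > 0" by simp
      fix \<delta> :: ennreal and f and \<alpha> :: "'n multi_index"
      assume "f \<in> sobolev l p (Omega vphi)" and \<alpha>: "mi_order \<alpha> = l"
      from bl.sobolev_family[OF this(1)] obtain D where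
        D: "burenkov_family \<omega> A M p l vphi \<psi> D" and f: "AE y in lebesgue. y \<in> Omega vphi \<longrightarrow> f y = D [] y"
        and wd: "\<And>js. length js \<le> l \<Longrightarrow> AE y in lebesgue. y \<in> Omega vphi \<longrightarrow> weak_deriv (Omega vphi) (count_list js) f y = D js y" by blast
      interpret burenkov_family \<omega> A M p l vphi \<psi> D by (rule D)
      have h: "has_weak_deriv UNIV \<alpha> (T f) (g (mi_list \<alpha>))"
        unfolding T_def by (rule extension_has_weak_deriv[OF f \<alpha>])
      have "has_weak_deriv UNIV \<alpha> (T f) (weak_deriv UNIV \<alpha> (T f))"
        unfolding weak_deriv_def by (rule someI[of "\<lambda>k. has_weak_deriv UNIV \<alpha> (T f) k", OF h])
      from weak_deriv_AE_unique[OF bl.test bl.int1 open_UNIV this h]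
      have "AE y in lebesgue. weak_deriv UNIV \<alpha> (T f) y = g (mi_list \<alpha>) y" by simp
      then show "morrey_norm \<phi> \<delta> p UNIV (weak_deriv UNIV \<alpha> (T f))
             \<le> ennreal ?c * (\<Sum>\<beta> | mi_order \<beta> = l. morrey_norm \<phi> \<delta> p (Omega vphi) (weak_deriv (Omega vphi) \<beta> f))"
        by (rule morrey_norm_bound[rotated]) (use \<alpha> wd assms(6) in \<open>auto simp: length_mi_list\<close>)
    qed
  qed
qed

end
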